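(* For sets $\Gamma,\Delta$ and bornologies $\mathcal{F},\mathcal{G}$ on $\Gamma$ and $\Delta$ respectively, there is a canonical isomorphism $$\mathbf{k}[\Gamma;\mathcal{F}]\mathbin{\hat\otimes}\mathbf{k}[\Delta;\mathcal{G}]\cong\mathbf{k}[\Gamma\times\Delta;\mathcal{F}\otimes\mathcal{G}],$$ where $\mathcal{F}\otimes\mathcal{G}$ is the smallest bornology on $\Gamma\times\Delta$ containing all the sets $F\times G$ with $F\in\mathcal{F}$ and $G\in\mathcal{G}$.
   Context: Fix a field $\mathbf{k}$ and a (non-trivial) Grothendieck universe; sets in it are small; all index sets are small. $\mathrm{Vect}$ is the category of small $\mathbf{k}$-vector spaces, $[\mathrm{Vect},\mathrm{Vect}]$ the category of $\mathbf{k}$-additive functors (acting $\mathbf{k}$-linearly on hom-spaces) and natural transformations, $\mathbb{Y}V:=\mathrm{Vect}(V,-)$. $\mathrm{Ind}\text{-}(\mathrm{Vect}^{\mathrm{op}})$ is the full subcategory of $[\mathrm{Vect},\mathrm{Vect}]$ on the small functors, i.e. those isomorphic to a colimit, over a small directed poset, of representables $\mathbb{Y}V$. A bornology on a set $\Gamma$ is (identified with) an ideal $\mathcal{F}$ of subsets of $\Gamma$ (closed under subsets and finite unions) containing all finite subsets. $\mathbf{k}[\Gamma;\mathcal{F}]\in\mathrm{Ind}\text{-}(\mathrm{Vect}^{\mathrm{op}})$ is the functor $V\mapsto\bigcup_{F\in\mathcal{F}}V^F\subseteq V^\Gamma$, i.e. the functions $\Gamma\to V$ whose support belongs to $\mathcal{F}$;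 equivalently $\mathbf{k}[\Gamma;\mathcal{F}]\cong\varinjlim_{F\in\mathcal{F}}\mathbb{Y}(\mathbf{k}^{\oplus F})$. The tensor product $\hat\otimes$ on $\mathrm{Ind}\text{-}(\mathrm{Vect}^{\mathrm{op}})$ is the functor induced by $\otimes_{\mathbf{k}}$ on $\mathrm{Vect}^{\mathrm{op}}$: $(X\hat\otimes Y)(V)\cong\int^{H_0}\int^{H_1}X(H_0)\otimes Y(H_1)\otimes\mathrm{Vect}(H_0\otimes H_1,V)$; equivalently, if $X\cong\varinjlim_{d}\mathbb{Y}(Fd)$ and $Y\cong\varinjlim_b\mathbb{Y}(Gb)$ are small directed colimits of representables, then $X\hat\otimes Y\cong\varinjlim_{d,b}\mathbb{Y}(Fd\otimes Gb)$. *)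

theory Defs
  imports "HOL-Algebra.Module" "HOL-Algebra.AbelCoset" "HOL-Library.Equipollence"
begin

section \<open>Grothendieck universe and smallness\<close>

text \<open>
  The type \<open>'u\<close> is the universe itself: a value of type \<open>'u\<close> is a set belonging to the universe
  and \<open>elts x\<close> is its set of elements. That elements of members are again members
  (transitivity) is expressed by the type of \<open>elts\<close>; the power set axiom says that all subsets of
  \<open>elts x\<close> are members and that they are collected in a member. The universe is nonempty because
  HOL types are; no infinite member is required.
\<close>

locale grothendieck_universe =
  fixes elts :: "'u \<Rightarrow> 'u set"
  assumes extensionality: "inj elts"
    and pairing: "\<exists>z. elts z = {x, y}"
    and power_set: "\<exists>p. elts ` elts p = Pow (elts x)"
    and indexed_union: "\<exists>u. elts u = (\<Union>i\<in>elts I. elts (f i))"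

text \<open>Smallness is up to bijection, so that it makes sense for sets over any HOL type. For a set over
  \<open>'u\<close> it coincides with being of the form \<open>elts u\<close>.\<close>

definition small :: "('u \<Rightarrow> 'u set) \<Rightarrow> 'a set \<Rightarrow> bool" where
  "small elts A \<longleftrightarrow> (\<exists>u. A \<approx> elts u)"


section \<open>Vector spaces\<close>

text \<open>
  The library type \<open>module\<close> of module records extends that of rings; the fields \<open>mult\<close> and
  \<open>one\<close> play no role for modules and are filled with dummy values.
\<close>

definition mk_space ::
    "'a set \<Rightarrow> 'a \<Rightarrow> ('a \<Rightarrow> 'a \<Rightarrow> 'a) \<Rightarrow> ('k \<Rightarrow> 'a \<Rightarrow> 'a) \<Rightarrow> ('k, 'a) module" where
  "mk_space A z p s = \<lparr>carrier = A, monoid.mult = (\<lambda>_ _. z), monoid.one = z, ring.zero = z, ring.add = p, smult = s\<rparr>"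

text \<open>With carrier type \<open>'u\<close> these are the objects of the category Vect on which functors are
  defined; values of functors may have any carrier type, as long as the carrier is small.\<close>

definition vect :: "('u \<Rightarrow> 'u set) \<Rightarrow> 'k ring \<Rightarrow> ('k, 'a) module \<Rightarrow> bool" where
  "vect elts K V \<longleftrightarrow> module K V \<and> small elts (carrier V)"

definition lin :: "'k ring \<Rightarrow> ('k, 'a) module \<Rightarrow> ('k, 'b) module \<Rightarrow> ('a \<Rightarrow> 'b) set" where
  "lin K V W = {f \<in> carrier V \<rightarrow>\<^sub>E carrier W.
     (\<forall>x\<in>carrier V. \<forall>y\<in>carrier V. f (x \<oplus>\<^bsub>V\<^esub> y) = f x \<oplus>\<^bsub>W\<^esub> f y) \<and>
     (\<forall>a\<in>carrier K. \<forall>x\<in>carrier V. f (a \<odot>\<^bsub>V\<^esub> x) = a \<odot>\<^bsub>W\<^esub> f x)}"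

definition homs :: "'k ring \<Rightarrow> ('k, 'a) module \<Rightarrow> ('k, 'b) module \<Rightarrow> ('k, 'a \<Rightarrow> 'b) module" where
  "homs K V W = mk_space (lin K V W)
     (\<lambda>x\<in>carrier V. \<zero>\<^bsub>W\<^esub>)
     (\<lambda>f g. \<lambda>x\<in>carrier V. f x \<oplus>\<^bsub>W\<^esub> g x)
     (\<lambda>a f. \<lambda>x\<in>carrier V. a \<odot>\<^bsub>W\<^esub> f x)"

definition scalars :: "'k ring \<Rightarrow> ('k, 'k) module" where
  "scalars K = mk_space (carrier K) \<zero>\<^bsub>K\<^esub> (\<lambda>x y. x \<oplus>\<^bsub>K\<^esub> y) (\<lambda>a x. a \<otimes>\<^bsub>K\<^esub> x)"

definition direct_sum :: "'i set \<Rightarrow> ('i \<Rightarrow> ('k, 'a) module) \<Rightarrow> ('k, 'i \<Rightarrow> 'a) module" where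
  "direct_sum S M = mk_space
     {s \<in> \<Pi>\<^sub>E i\<in>S. carrier (M i). finite {i \<in> S. s i \<noteq> \<zero>\<^bsub>M i\<^esub>}}
     (\<lambda>i\<in>S. \<zero>\<^bsub>M i\<^esub>)
     (\<lambda>s t. \<lambda>i\<in>S. s i \<oplus>\<^bsub>M i\<^esub> t i)
     (\<lambda>a s. \<lambda>i\<in>S. a \<odot>\<^bsub>M i\<^esub> s i)"

definition inject :: "'i set \<Rightarrow> ('i \<Rightarrow> ('k, 'a) module) \<Rightarrow> 'i \<Rightarrow> 'a \<Rightarrow> ('i \<Rightarrow> 'a)" where
  "inject S M i x = (\<lambda>j\<in>S. if j = i then x else \<zero>\<^bsub>M j\<^esub>)"

definition span_of :: "'k ring \<Rightarrow> ('k, 'a) module \<Rightarrow> 'a set \<Rightarrow> 'a set" where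
  "span_of K M A = \<Inter>{N. submodule N K M \<and> A \<subseteq> N}"

definition quotient_space :: "('k, 'a) module \<Rightarrow> 'a set \<Rightarrow> ('k, 'a set) module" where
  "quotient_space M N = mk_space
     (a_rcosets\<^bsub>M\<^esub> N) N
     (\<lambda>C D. C <+>\<^bsub>M\<^esub> D)
     (\<lambda>a C. N <+>\<^bsub>M\<^esub> ((\<lambda>x. a \<odot>\<^bsub>M\<^esub> x) ` C))"


section \<open>Tensor product of vector spaces\<close>

definition free_space :: "'k ring \<Rightarrow> 's set \<Rightarrow> ('k, 's \<Rightarrow> 'k) module" where
  "free_space K S = direct_sum S (\<lambda>_. scalars K)"

definition free_gen :: "'k ring \<Rightarrow> 's set \<Rightarrow> 's \<Rightarrow> ('s \<Rightarrow> 'k)" where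
  "free_gen K S s = inject S (\<lambda>_. scalars K) s \<one>\<^bsub>K\<^esub>"

definition tensor_rels ::
    "'k ring \<Rightarrow> ('k, 'a) module \<Rightarrow> ('k, 'b) module \<Rightarrow> ('a \<times> 'b \<Rightarrow> 'k) set" where
  "tensor_rels K V W =
    (let S = carrier V \<times> carrier W; M = free_space K S; e = free_gen K S in
      {e (x \<oplus>\<^bsub>V\<^esub> x', y) \<ominus>\<^bsub>M\<^esub> (e (x, y) \<oplus>\<^bsub>M\<^esub> e (x', y)) | x x' y.
          x \<in> carrier V \<and> x' \<in> carrier V \<and> y \<in> carrier W} \<union>
      {e (x, y \<oplus>\<^bsub>W\<^esub> y') \<ominus>\<^bsub>M\<^esub> (e (x, y) \<oplus>\<^bsub>M\<^esub> e (x, y')) | x y y'.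
          x \<in> carrier V \<and> y \<in> carrier W \<and> y' \<in> carrier W} \<union>
      {e (a \<odot>\<^bsub>V\<^esub> x, y) \<ominus>\<^bsub>M\<^esub> (a \<odot>\<^bsub>M\<^esub> e (x, y)) | a x y.
          a \<in> carrier K \<and> x \<in> carrier V \<and> y \<in> carrier W} \<union>
      {e (x, a \<odot>\<^bsub>W\<^esub> y) \<ominus>\<^bsub>M\<^esub> (a \<odot>\<^bsub>M\<^esub> e (x, y)) | a x y.
          a \<in> carrier K \<and> x \<in> carrier V \<and> y \<in> carrier W})"

definition tensor_ker ::
    "'k ring \<Rightarrow> ('k, 'a) module \<Rightarrow> ('k, 'b) module \<Rightarrow> ('a \<times> 'b \<Rightarrow> 'k) set" where
  "tensor_ker K V W =
     span_of K (free_space K (carrier V \<times> carrier W)) (tensor_rels K V W)"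

definition tensor ::
    "'k ring \<Rightarrow> ('k, 'a) module \<Rightarrow> ('k, 'b) module \<Rightarrow> ('k, ('a \<times> 'b \<Rightarrow> 'k) set) module" where
  "tensor K V W = quotient_space (free_space K (carrier V \<times> carrier W)) (tensor_ker K V W)"

definition pure ::
    "'k ring \<Rightarrow> ('k, 'a) module \<Rightarrow> ('k, 'b) module \<Rightarrow> 'a \<Rightarrow> 'b \<Rightarrow> ('a \<times> 'b \<Rightarrow> 'k) set" where
  "pure K V W x y =
    (let S = carrier V \<times> carrier W
     in tensor_ker K V W +>\<^bsub>free_space K S\<^esub> free_gen K S (x, y))"

definition tensor_map ::
    "'k ring \<Rightarrow> ('k, 'a) module \<Rightarrow> ('k, 'b) module \<Rightarrow> ('k, 'c) module \<Rightarrow> ('k, 'd) module \<Rightarrow>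
     ('a \<Rightarrow> 'c) \<Rightarrow> ('b \<Rightarrow> 'd) \<Rightarrow> ('a \<times> 'b \<Rightarrow> 'k) set \<Rightarrow> ('c \<times> 'd \<Rightarrow> 'k) set" where
  "tensor_map K V W V' W' f g =
    (THE h. h \<in> lin K (tensor K V W) (tensor K V' W') \<and>
       (\<forall>x\<in>carrier V. \<forall>y\<in>carrier W. h (pure K V W x y) = pure K V' W' (f x) (g y)))"


section \<open>The category of linear endofunctors of Vect\<close>

text \<open>A map \<open>'u \<Rightarrow> 'u\<close> does not determine its source and target as vector spaces, hence the two
  object arguments of \<open>fmap\<close>.\<close>

record ('k, 'u, 'a) vfunctor =
  fobj :: "('k, 'u) module \<Rightarrow> ('k, 'a) module"
  fmap :: "('k, 'u) module \<Rightarrow> ('k, 'u) module \<Rightarrow> ('u \<Rightarrow> 'u) \<Rightarrow> ('a \<Rightarrow> 'a)"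

definition linear_functor ::
    "('u \<Rightarrow> 'u set) \<Rightarrow> 'k ring \<Rightarrow> ('k, 'u, 'a) vfunctor \<Rightarrow> bool" where
  "linear_functor elts K X \<longleftrightarrow>
    (\<forall>V. vect elts K V \<longrightarrow> vect elts K (fobj X V)) \<and>
    (\<forall>V W. vect elts K V \<longrightarrow> vect elts K W \<longrightarrow>
       (\<lambda>f\<in>lin K V W. fmap X V W f) \<in> lin K (homs K V W) (homs K (fobj X V) (fobj X W))) \<and>
    (\<forall>V. vect elts K V \<longrightarrow>
       fmap X V V (\<lambda>x\<in>carrier V. x) = (\<lambda>x\<in>carrier (fobj X V). x)) \<and>
    (\<forall>U V W f g. vect elts K U \<longrightarrow> vect elts K V \<longrightarrow> vect elts K W \<longrightarrow>
       f \<in> lin K U V \<longrightarrow> g \<in> lin K V W \<longrightarrow>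
       fmap X U W (compose (carrier U) g f) =
         compose (carrier (fobj X U)) (fmap X V W g) (fmap X U V f))"

definition nat_trans ::
    "('u \<Rightarrow> 'u set) \<Rightarrow> 'k ring \<Rightarrow> ('k, 'u, 'a) vfunctor \<Rightarrow> ('k, 'u, 'b) vfunctor \<Rightarrow>
     (('k, 'u) module \<Rightarrow> 'a \<Rightarrow> 'b) \<Rightarrow> bool" where
  "nat_trans elts K X Y \<phi> \<longleftrightarrow>
    (\<forall>V. vect elts K V \<longrightarrow> \<phi> V \<in> lin K (fobj X V) (fobj Y V)) \<and>
    (\<forall>V W f. vect elts K V \<longrightarrow> vect elts K W \<longrightarrow> f \<in> lin K V W \<longrightarrow>
       (\<forall>x\<in>carrier (fobj X V). \<phi> W (fmap X V W f x) = fmap Y V W f (\<phi> V x)))"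

definition nat_iso ::
    "('u \<Rightarrow> 'u set) \<Rightarrow> 'k ring \<Rightarrow> ('k, 'u, 'a) vfunctor \<Rightarrow> ('k, 'u, 'b) vfunctor \<Rightarrow>
     (('k, 'u) module \<Rightarrow> 'a \<Rightarrow> 'b) \<Rightarrow> bool" where
  "nat_iso elts K X Y \<phi> \<longleftrightarrow> nat_trans elts K X Y \<phi> \<and>
    (\<exists>\<psi>. nat_trans elts K Y X \<psi> \<and>
      (\<forall>V. vect elts K V \<longrightarrow>
         (\<forall>x\<in>carrier (fobj X V). \<psi> V (\<phi> V x) = x) \<and>
         (\<forall>y\<in>carrier (fobj Y V). \<phi> V (\<psi> V y) = y)))"

definition yoneda :: "'k ring \<Rightarrow> ('k, 'u) module \<Rightarrow> ('k, 'u, 'u \<Rightarrow> 'u) vfunctor" where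
  "yoneda K H = \<lparr>fobj = (\<lambda>V. homs K H V),
     fmap = (\<lambda>V W f. \<lambda>h\<in>lin K H V. compose (carrier H) f h)\<rparr>"


section \<open>Small directed colimits of representables\<close>

definition directed_poset :: "'i set \<Rightarrow> ('i \<times> 'i) set \<Rightarrow> bool" where
  "directed_poset I r \<longleftrightarrow> I \<noteq> {} \<and> partial_order_on I r \<and>
     (\<forall>i\<in>I. \<forall>j\<in>I. \<exists>k\<in>I. (i, k) \<in> r \<and> (j, k) \<in> r)"

definition poset_diagram ::
    "('u \<Rightarrow> 'u set) \<Rightarrow> 'k ring \<Rightarrow> 'i set \<Rightarrow> ('i \<times> 'i) set \<Rightarrow> ('i \<Rightarrow> ('k, 'u, 'a) vfunctor) \<Rightarrow>
     ('i \<Rightarrow> 'i \<Rightarrow> ('k, 'u) module \<Rightarrow> 'a \<Rightarrow> 'a) \<Rightarrow> bool" where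
  "poset_diagram elts K I r D \<tau> \<longleftrightarrow>
    (\<forall>i\<in>I. linear_functor elts K (D i)) \<and>
    (\<forall>i\<in>I. \<forall>j\<in>I. (i, j) \<in> r \<longrightarrow> nat_trans elts K (D i) (D j) (\<tau> i j)) \<and>
    (\<forall>i\<in>I. \<forall>V. vect elts K V \<longrightarrow> (\<forall>x\<in>carrier (fobj (D i) V). \<tau> i i V x = x)) \<and>
    (\<forall>i\<in>I. \<forall>j\<in>I. \<forall>k\<in>I. (i, j) \<in> r \<longrightarrow> (j, k) \<in> r \<longrightarrow> (\<forall>V. vect elts K V \<longrightarrow>
       (\<forall>x\<in>carrier (fobj (D i) V). \<tau> j k V (\<tau> i j V x) = \<tau> i k V x)))"

definition cocone ::
    "('u \<Rightarrow> 'u set) \<Rightarrow> 'k ring \<Rightarrow> 'i set \<Rightarrow> ('i \<times> 'i) set \<Rightarrow> ('i \<Rightarrow> ('k, 'u, 'a) vfunctor) \<Rightarrow>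
     ('i \<Rightarrow> 'i \<Rightarrow> ('k, 'u) module \<Rightarrow> 'a \<Rightarrow> 'a) \<Rightarrow> ('k, 'u, 'b) vfunctor \<Rightarrow>
     ('i \<Rightarrow> ('k, 'u) module \<Rightarrow> 'a \<Rightarrow> 'b) \<Rightarrow> bool" where
  "cocone elts K I r D \<tau> X c \<longleftrightarrow>
    (\<forall>i\<in>I. nat_trans elts K (D i) X (c i)) \<and>
    (\<forall>i\<in>I. \<forall>j\<in>I. (i, j) \<in> r \<longrightarrow> (\<forall>V. vect elts K V \<longrightarrow>
       (\<forall>x\<in>carrier (fobj (D i) V). c j V (\<tau> i j V x) = c i V x)))"

text \<open>It suffices to test the universal property against functors with values on the carrier type
  \<open>'u\<close>, because every linear functor with small values is isomorphic to one of these.\<close>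

definition colimit_cocone ::
    "('u \<Rightarrow> 'u set) \<Rightarrow> 'k ring \<Rightarrow> 'i set \<Rightarrow> ('i \<times> 'i) set \<Rightarrow> ('i \<Rightarrow> ('k, 'u, 'a) vfunctor) \<Rightarrow>
     ('i \<Rightarrow> 'i \<Rightarrow> ('k, 'u) module \<Rightarrow> 'a \<Rightarrow> 'a) \<Rightarrow> ('k, 'u, 'b) vfunctor \<Rightarrow>
     ('i \<Rightarrow> ('k, 'u) module \<Rightarrow> 'a \<Rightarrow> 'b) \<Rightarrow> bool" where
  "colimit_cocone elts K I r D \<tau> X c \<longleftrightarrow> cocone elts K I r D \<tau> X c \<and>
    (\<forall>(Z :: ('k, 'u, 'u) vfunctor) d.
       linear_functor elts K Z \<longrightarrow> cocone elts K I r D \<tau> Z d \<longrightarrow>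
       (\<exists>\<phi>. nat_trans elts K X Z \<phi> \<and>
          (\<forall>i\<in>I. \<forall>V. vect elts K V \<longrightarrow>
             (\<forall>x\<in>carrier (fobj (D i) V). \<phi> V (c i V x) = d i V x)) \<and>
          (\<forall>\<phi>'. nat_trans elts K X Z \<phi>' \<longrightarrow>
             (\<forall>i\<in>I. \<forall>V. vect elts K V \<longrightarrow>
                (\<forall>x\<in>carrier (fobj (D i) V). \<phi>' V (c i V x) = d i V x)) \<longrightarrow>
             (\<forall>V. vect elts K V \<longrightarrow> \<phi>' V = \<phi> V))))"

text \<open>Objects and isomorphisms of the full subcategory \<open>Ind-(Vect\<^sup>o\<^sup>p)\<close>.\<close>

definition ind_vect_op :: "('u \<Rightarrow> 'u set) \<Rightarrow> 'k ring \<Rightarrow> ('k, 'u, 'a) vfunctor \<Rightarrow> bool" where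
  "ind_vect_op elts K X \<longleftrightarrow> linear_functor elts K X \<and>
    (\<exists>I r G \<tau> c. directed_poset (elts I) r \<and>
       (\<forall>i\<in>elts I. vect elts K (G i)) \<and>
       poset_diagram elts K (elts I) r (\<lambda>i. yoneda K (G i)) \<tau> \<and>
       colimit_cocone elts K (elts I) r (\<lambda>i. yoneda K (G i)) \<tau> X c)"

definition ind_iso ::
    "('u \<Rightarrow> 'u set) \<Rightarrow> 'k ring \<Rightarrow> ('k, 'u, 'a) vfunctor \<Rightarrow> ('k, 'u, 'b) vfunctor \<Rightarrow>
     (('k, 'u) module \<Rightarrow> 'a \<Rightarrow> 'b) \<Rightarrow> bool" where
  "ind_iso elts K X Y \<phi> \<longleftrightarrow>
     ind_vect_op elts K X \<and> ind_vect_op elts K Y \<and> nat_iso elts K X Y \<phi>"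


section \<open>Bornologies\<close>

definition bornology :: "'g set \<Rightarrow> 'g set set \<Rightarrow> bool" where
  "bornology \<Gamma> \<F> \<longleftrightarrow> \<F> \<subseteq> Pow \<Gamma> \<and>
     (\<forall>A\<in>\<F>. \<forall>B. B \<subseteq> A \<longrightarrow> B \<in> \<F>) \<and>
     (\<forall>A\<in>\<F>. \<forall>B\<in>\<F>. A \<union> B \<in> \<F>) \<and>
     (\<forall>A. A \<subseteq> \<Gamma> \<longrightarrow> finite A \<longrightarrow> A \<in> \<F>)"

definition born_tensor ::
    "'g set \<Rightarrow> 'g set set \<Rightarrow> 'd set \<Rightarrow> 'd set set \<Rightarrow> ('g \<times> 'd) set set" where
  "born_tensor \<Gamma> \<F> \<Delta> \<G> =
     \<Inter>{\<B>. bornology (\<Gamma> \<times> \<Delta>) \<B> \<and> (\<forall>F\<in>\<F>. \<forall>G\<in>\<G>. F \<times> G \<in> \<B>)}"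

definition born_space ::
    "'g set \<Rightarrow> 'g set set \<Rightarrow> ('k, 'a) module \<Rightarrow> ('k, 'g \<Rightarrow> 'a) module" where
  "born_space \<Gamma> \<F> V = mk_space
     {s \<in> \<Gamma> \<rightarrow>\<^sub>E carrier V. {\<gamma> \<in> \<Gamma>. s \<gamma> \<noteq> \<zero>\<^bsub>V\<^esub>} \<in> \<F>}
     (\<lambda>\<gamma>\<in>\<Gamma>. \<zero>\<^bsub>V\<^esub>)
     (\<lambda>s t. \<lambda>\<gamma>\<in>\<Gamma>. s \<gamma> \<oplus>\<^bsub>V\<^esub> t \<gamma>)
     (\<lambda>a s. \<lambda>\<gamma>\<in>\<Gamma>. a \<odot>\<^bsub>V\<^esub> s \<gamma>)"

text \<open>The functor \<open>k[\<Gamma>; \<F>]\<close>.\<close>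

definition born_functor :: "'g set \<Rightarrow> 'g set set \<Rightarrow> ('k, 'u, 'g \<Rightarrow> 'u) vfunctor" where
  "born_functor \<Gamma> \<F> = \<lparr>fobj = (\<lambda>V. born_space \<Gamma> \<F> V),
     fmap = (\<lambda>V W f. \<lambda>s\<in>carrier (born_space \<Gamma> \<F> V). compose \<Gamma> f s)\<rparr>"


section \<open>The tensor product of functors as a coend\<close>

text \<open>
  Coend of a bifunctor \<open>T\<close>, contravariant in the first and covariant in the second argument, on a
  category with objects \<open>Ob\<close> and arrows \<open>Hom c d\<close>. For \<open>f \<in> Hom c d\<close> the two actions are
  \<open>L c d f : T d c \<rightarrow> T c c\<close> and \<open>R c d f : T d c \<rightarrow> T d d\<close>.
\<close>

definition coend_ker ::
    "'k ring \<Rightarrow> 'i set \<Rightarrow> ('i \<Rightarrow> 'i \<Rightarrow> 'h set) \<Rightarrow> ('i \<Rightarrow> 'i \<Rightarrow> ('k, 'a) module) \<Rightarrow>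
     ('i \<Rightarrow> 'i \<Rightarrow> 'h \<Rightarrow> 'a \<Rightarrow> 'a) \<Rightarrow> ('i \<Rightarrow> 'i \<Rightarrow> 'h \<Rightarrow> 'a \<Rightarrow> 'a) \<Rightarrow> ('i \<Rightarrow> 'a) set" where
  "coend_ker K Ob Hom T L R =
    (let M = (\<lambda>c. T c c) in
     span_of K (direct_sum Ob M)
       {inject Ob M c (L c d f t) \<ominus>\<^bsub>direct_sum Ob M\<^esub> inject Ob M d (R c d f t) | c d f t.
          c \<in> Ob \<and> d \<in> Ob \<and> f \<in> Hom c d \<and> t \<in> carrier (T d c)})"

definition coend ::
    "'k ring \<Rightarrow> 'i set \<Rightarrow> ('i \<Rightarrow> 'i \<Rightarrow> 'h set) \<Rightarrow> ('i \<Rightarrow> 'i \<Rightarrow> ('k, 'a) module) \<Rightarrow>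
     ('i \<Rightarrow> 'i \<Rightarrow> 'h \<Rightarrow> 'a \<Rightarrow> 'a) \<Rightarrow> ('i \<Rightarrow> 'i \<Rightarrow> 'h \<Rightarrow> 'a \<Rightarrow> 'a) \<Rightarrow>
     ('k, ('i \<Rightarrow> 'a) set) module" where
  "coend K Ob Hom T L R =
     quotient_space (direct_sum Ob (\<lambda>c. T c c)) (coend_ker K Ob Hom T L R)"

definition coend_inject ::
    "'k ring \<Rightarrow> 'i set \<Rightarrow> ('i \<Rightarrow> 'i \<Rightarrow> 'h set) \<Rightarrow> ('i \<Rightarrow> 'i \<Rightarrow> ('k, 'a) module) \<Rightarrow>
     ('i \<Rightarrow> 'i \<Rightarrow> 'h \<Rightarrow> 'a \<Rightarrow> 'a) \<Rightarrow> ('i \<Rightarrow> 'i \<Rightarrow> 'h \<Rightarrow> 'a \<Rightarrow> 'a) \<Rightarrow>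
     'i \<Rightarrow> 'a \<Rightarrow> ('i \<Rightarrow> 'a) set" where
  "coend_inject K Ob Hom T L R c t =
     coend_ker K Ob Hom T L R +>\<^bsub>direct_sum Ob (\<lambda>c. T c c)\<^esub> inject Ob (\<lambda>c. T c c) c t"

text \<open>
  The iterated coend over \<open>H\<^sub>0\<close> and \<open>H\<^sub>1\<close> is taken as one coend over the product category
  \<open>Vect \<times> Vect\<close>, whose objects are the pairs \<open>(H\<^sub>0, H\<^sub>1)\<close>. The integrand at contravariant argument
  \<open>d\<close> and covariant argument \<open>c\<close> is \<open>(X c\<^sub>0 \<otimes> Y c\<^sub>1) \<otimes> Vect(d\<^sub>0 \<otimes> d\<^sub>1, V)\<close>.
\<close>

type_synonym ('k, 'u) vpair = "('k, 'u) module \<times> ('k, 'u) module"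

type_synonym ('k, 'u, 'a, 'b) day_elem =
  "(('a \<times> 'b \<Rightarrow> 'k) set \<times> (('u \<times> 'u \<Rightarrow> 'k) set \<Rightarrow> 'u) \<Rightarrow> 'k) set"

definition pair_objs :: "('u \<Rightarrow> 'u set) \<Rightarrow> 'k ring \<Rightarrow> ('k, 'u) vpair set" where
  "pair_objs elts K = {V. vect elts K V} \<times> {V. vect elts K V}"

definition pair_homs ::
    "'k ring \<Rightarrow> ('k, 'u) vpair \<Rightarrow> ('k, 'u) vpair \<Rightarrow> (('u \<Rightarrow> 'u) \<times> ('u \<Rightarrow> 'u)) set" where
  "pair_homs K c d = lin K (fst c) (fst d) \<times> lin K (snd c) (snd d)"

definition day_integrand ::
    "'k ring \<Rightarrow> ('k, 'u, 'a) vfunctor \<Rightarrow> ('k, 'u, 'b) vfunctor \<Rightarrow> ('k, 'u) module \<Rightarrow>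
     ('k, 'u) vpair \<Rightarrow> ('k, 'u) vpair \<Rightarrow> ('k, ('k, 'u, 'a, 'b) day_elem) module" where
  "day_integrand K X Y V d c =
     tensor K (tensor K (fobj X (fst c)) (fobj Y (snd c)))
              (homs K (tensor K (fst d) (snd d)) V)"

definition day_left ::
    "'k ring \<Rightarrow> ('k, 'u, 'a) vfunctor \<Rightarrow> ('k, 'u, 'b) vfunctor \<Rightarrow> ('k, 'u) module \<Rightarrow>
     ('k, 'u) vpair \<Rightarrow> ('k, 'u) vpair \<Rightarrow> ('u \<Rightarrow> 'u) \<times> ('u \<Rightarrow> 'u) \<Rightarrow>
     ('k, 'u, 'a, 'b) day_elem \<Rightarrow> ('k, 'u, 'a, 'b) day_elem" where
  "day_left K X Y V c d fg =
    (let XY = tensor K (fobj X (fst c)) (fobj Y (snd c));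
         C = tensor K (fst c) (snd c);
         D = tensor K (fst d) (snd d);
         q = tensor_map K (fst c) (snd c) (fst d) (snd d) (fst fg) (snd fg)
     in tensor_map K XY (homs K D V) XY (homs K C V)
          (\<lambda>x\<in>carrier XY. x) (\<lambda>h\<in>lin K D V. compose (carrier C) h q))"

definition day_right ::
    "'k ring \<Rightarrow> ('k, 'u, 'a) vfunctor \<Rightarrow> ('k, 'u, 'b) vfunctor \<Rightarrow> ('k, 'u) module \<Rightarrow>
     ('k, 'u) vpair \<Rightarrow> ('k, 'u) vpair \<Rightarrow> ('u \<Rightarrow> 'u) \<times> ('u \<Rightarrow> 'u) \<Rightarrow>
     ('k, 'u, 'a, 'b) day_elem \<Rightarrow> ('k, 'u, 'a, 'b) day_elem" where
  "day_right K X Y V c d fg =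
    (let XYc = tensor K (fobj X (fst c)) (fobj Y (snd c));
         XYd = tensor K (fobj X (fst d)) (fobj Y (snd d));
         D = tensor K (fst d) (snd d);
         p = tensor_map K (fobj X (fst c)) (fobj Y (snd c)) (fobj X (fst d)) (fobj Y (snd d))
               (fmap X (fst c) (fst d) (fst fg)) (fmap Y (snd c) (snd d) (snd fg))
     in tensor_map K XYc (homs K D V) XYd (homs K D V) p (\<lambda>h\<in>lin K D V. h))"

definition day_space ::
    "('u \<Rightarrow> 'u set) \<Rightarrow> 'k ring \<Rightarrow> ('k, 'u, 'a) vfunctor \<Rightarrow> ('k, 'u, 'b) vfunctor \<Rightarrow>
     ('k, 'u) module \<Rightarrow> ('k, (('k, 'u) vpair \<Rightarrow> ('k, 'u, 'a, 'b) day_elem) set) module" where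
  "day_space elts K X Y V =
     coend K (pair_objs elts K) (pair_homs K)
       (day_integrand K X Y V) (day_left K X Y V) (day_right K X Y V)"

text \<open>The class in the coend of \<open>(x \<otimes> y) \<otimes> h\<close> with \<open>x \<in> X H\<^sub>0\<close>, \<open>y \<in> Y H\<^sub>1\<close> and
  \<open>h : H\<^sub>0 \<otimes> H\<^sub>1 \<rightarrow> V\<close>.\<close>

definition day_gen ::
    "('u \<Rightarrow> 'u set) \<Rightarrow> 'k ring \<Rightarrow> ('k, 'u, 'a) vfunctor \<Rightarrow> ('k, 'u, 'b) vfunctor \<Rightarrow>
     ('k, 'u) module \<Rightarrow> ('k, 'u) module \<Rightarrow> ('k, 'u) module \<Rightarrow>
     'a \<Rightarrow> 'b \<Rightarrow> (('u \<times> 'u \<Rightarrow> 'k) set \<Rightarrow> 'u) \<Rightarrow>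
     (('k, 'u) vpair \<Rightarrow> ('k, 'u, 'a, 'b) day_elem) set" where
  "day_gen elts K X Y V H\<^sub>0 H\<^sub>1 x y h =
     coend_inject K (pair_objs elts K) (pair_homs K)
       (day_integrand K X Y V) (day_left K X Y V) (day_right K X Y V) (H\<^sub>0, H\<^sub>1)
       (pure K (tensor K (fobj X H\<^sub>0) (fobj Y H\<^sub>1)) (homs K (tensor K H\<^sub>0 H\<^sub>1) V)
          (pure K (fobj X H\<^sub>0) (fobj Y H\<^sub>1) x y) h)"

definition day_map ::
    "('u \<Rightarrow> 'u set) \<Rightarrow> 'k ring \<Rightarrow> ('k, 'u, 'a) vfunctor \<Rightarrow> ('k, 'u, 'b) vfunctor \<Rightarrow>
     ('k, 'u) module \<Rightarrow> ('k, 'u) module \<Rightarrow> ('u \<Rightarrow> 'u) \<Rightarrow>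
     (('k, 'u) vpair \<Rightarrow> ('k, 'u, 'a, 'b) day_elem) set \<Rightarrow>
     (('k, 'u) vpair \<Rightarrow> ('k, 'u, 'a, 'b) day_elem) set" where
  "day_map elts K X Y V W f =
    (THE m. m \<in> lin K (day_space elts K X Y V) (day_space elts K X Y W) \<and>
       (\<forall>H\<^sub>0 H\<^sub>1. vect elts K H\<^sub>0 \<longrightarrow> vect elts K H\<^sub>1 \<longrightarrow>
          (\<forall>x\<in>carrier (fobj X H\<^sub>0). \<forall>y\<in>carrier (fobj Y H\<^sub>1). \<forall>h\<in>lin K (tensor K H\<^sub>0 H\<^sub>1) V.
             m (day_gen elts K X Y V H\<^sub>0 H\<^sub>1 x y h) =
             day_gen elts K X Y W H\<^sub>0 H\<^sub>1 x y (compose (carrier (tensor K H\<^sub>0 H\<^sub>1)) f h))))"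

definition functor_tensor ::
    "('u \<Rightarrow> 'u set) \<Rightarrow> 'k ring \<Rightarrow> ('k, 'u, 'a) vfunctor \<Rightarrow> ('k, 'u, 'b) vfunctor \<Rightarrow>
     ('k, 'u, (('k, 'u) vpair \<Rightarrow> ('k, 'u, 'a, 'b) day_elem) set) vfunctor" where
  "functor_tensor elts K X Y =
     \<lparr>fobj = day_space elts K X Y, fmap = day_map elts K X Y\<rparr>"

end

theory Submission
  imports Defs
begin

text \<open>
  By the Yoneda lemma an element of \<open>k[\<Gamma>; \<F>](H)\<close> supported in \<open>F \<in> \<F>\<close> is the same as a linear map
  from the free space on \<open>F\<close> to \<open>H\<close>. The coend relation therefore rewrites every generator
  \<open>(s \<otimes> t) \<otimes> h\<close> of the tensor product at \<open>V\<close>, with \<open>s\<close> supported in \<open>F\<close> and \<open>t\<close> in \<open>G\<close>, as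
  \<open>(e\<^sub>F \<otimes> e\<^sub>G) \<otimes> h'\<close>, where \<open>e\<^sub>F\<close> and \<open>e\<^sub>G\<close> are the universal elements. As \<open>F\<close> and \<open>G\<close> may be enlarged,
  sums of such elements are again of this form, and \<open>h'\<close> is determined by its values on pairs of
  basis vectors, which are the values of a function \<open>\<Gamma> \<times> \<Delta> \<rightarrow> V\<close> supported in \<open>F \<times> G\<close>. Hence the
  comparison map is bijective. Smallness of the coend, functoriality of the tensor product and its
  presentation as a directed colimit of representables are then transferred from
  \<open>k[\<Gamma> \<times> \<Delta>; \<F> \<otimes> \<G>]\<close>, which is the directed union of the representables attached to its bounded
  sets.
\<close>

section \<open>Spaces and linear maps\<close>

text \<open>The coend defining the tensor product is a quotient of a direct sum over all pairs of
  vector spaces, and nothing in this construction bounds the size of its values. Since a linear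
  functor must have small values, functoriality cannot be checked directly. Before the comparison
  only the module structure and the linear action on arrows are available, and
  \<open>functor_transfer\<close> starts from exactly these data. A second obstacle is that objects
  of Vect have carrier type \<open>'u\<close>, while free spaces and tensor products live on other
  types. The representing spaces are therefore copies of free spaces, handled through
  \<open>basis\<close>. The directed presentation is indexed by all bounded subsets of \<Gamma>
  \<times> \<Delta> and uses free spaces on these, so that no tensor product ever has to be replaced
  by a copy on \<open>'u\<close>; tensor products occur only as sources of maps \<open>h\<close>.
  The actions on arrows are definite descriptions. Hence every universal property is needed in both
  halves: existence of a map with prescribed values on generators, and uniqueness by an induction
  over generators.\<close>

lemma mk_space_simps [simp]:
  "carrier (mk_space A z p s) = A"
  "\<zero>\<^bsub>mk_space A z p s\<^esub> = z"
  "x \<oplus>\<^bsub>mk_space A z p s\<^esub> y = p x y"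
  "a \<odot>\<^bsub>mk_space A z p s\<^esub> x = s a x"
  by (simp_all add: mk_space_def)

text \<open>Additive inverses come for free: by distributivity and the laws \<open>null\<close> and
  \<open>unit\<close>, the multiple of \<open>x\<close> by minus one is an inverse of
  \<open>x\<close>.\<close>

lemma module_mk_space:
  assumes K: "cring K"
    and "z \<in> A"
    and "\<And>x y. x \<in> A \<Longrightarrow> y \<in> A \<Longrightarrow> p x y \<in> A"
    and "\<And>a x. a \<in> carrier K \<Longrightarrow> x \<in> A \<Longrightarrow> s a x \<in> A"
    and "\<And>x y w. x \<in> A \<Longrightarrow> y \<in> A \<Longrightarrow> w \<in> A \<Longrightarrow> p (p x y) w = p x (p y w)"
    and "\<And>x y. x \<in> A \<Longrightarrow> y \<in> A \<Longrightarrow> p x y = p y x"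
    and "\<And>x. x \<in> A \<Longrightarrow> p z x = x"
    and null: "\<And>x. x \<in> A \<Longrightarrow> s \<zero>\<^bsub>K\<^esub> x = z"
    and distr: "\<And>a b x. a \<in> carrier K \<Longrightarrow> b \<in> carrier K \<Longrightarrow> x \<in> A \<Longrightarrow>
           s (a \<oplus>\<^bsub>K\<^esub> b) x = p (s a x) (s b x)"
    and "\<And>a x y. a \<in> carrier K \<Longrightarrow> x \<in> A \<Longrightarrow> y \<in> A \<Longrightarrow> s a (p x y) = p (s a x) (s a y)"
    and "\<And>a b x. a \<in> carrier K \<Longrightarrow> b \<in> carrier K \<Longrightarrow> x \<in> A \<Longrightarrow>
           s (a \<otimes>\<^bsub>K\<^esub> b) x = s a (s b x)"
    and unit: "\<And>x. x \<in> A \<Longrightarrow> s \<one>\<^bsub>K\<^esub> x = x"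
  shows "module K (mk_space A z p s)"
proof -
  interpret cring K by (rule K)
  have "abelian_group (mk_space A z p s)"
  proof (rule abelian_groupI)
    fix x assume "x \<in> carrier (mk_space A z p s)"
    then have x: "x \<in> A" by simp
    have "p (s (\<ominus>\<^bsub>K\<^esub> \<one>\<^bsub>K\<^esub>) x) x = s (\<ominus>\<^bsub>K\<^esub> \<one>\<^bsub>K\<^esub> \<oplus>\<^bsub>K\<^esub> \<one>\<^bsub>K\<^esub>) x"
      using x distr unit by simp
    also have "\<dots> = z"
      using x null by (simp add: l_neg)
    finally show "\<exists>y\<in>carrier (mk_space A z p s). y \<oplus>\<^bsub>mk_space A z p s\<^esub> x = \<zero>\<^bsub>mk_space A z p s\<^esub>"
      using x assms(4) by auto
  qed (use assms in auto)
  then show ?thesis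
    by (intro moduleI) (use assms in auto)
qed

text \<open>Equational laws pass from \<open>M\<close> to any image whose operations are induced
  from \<open>M\<close>. As \<open>\<pi>\<close> may identify elements, this covers quotients as
  well as copies of a space on another type.\<close>

lemma module_image:
  assumes M: "module K M"
    and A: "A = \<pi> ` carrier M" and z: "z = \<pi> \<zero>\<^bsub>M\<^esub>"
    and p: "\<And>x y. x \<in> carrier M \<Longrightarrow> y \<in> carrier M \<Longrightarrow> p (\<pi> x) (\<pi> y) = \<pi> (x \<oplus>\<^bsub>M\<^esub> y)"
    and s: "\<And>a x. a \<in> carrier K \<Longrightarrow> x \<in> carrier M \<Longrightarrow> s a (\<pi> x) = \<pi> (a \<odot>\<^bsub>M\<^esub> x)"
  shows "module K (mk_space A z p s)"
proof -
  interpret module K M by (rule M)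
  show ?thesis
    by (rule module_mk_space)
      (auto simp: A z p s M.a_ac smult_l_distr smult_r_distr smult_assoc1 R.is_cring
        intro!: imageI)
qed

lemma scalars_module:
  assumes "cring K" shows "module K (scalars K)"
proof -
  interpret cring K by (rule assms)
  show ?thesis unfolding scalars_def
    by (rule module_mk_space) (auto simp: a_ac m_assoc l_distr r_distr assms)
qed

lemma scalars_simps [simp]:
  "carrier (scalars K) = carrier K"
  "\<zero>\<^bsub>scalars K\<^esub> = \<zero>\<^bsub>K\<^esub>"
  "x \<oplus>\<^bsub>scalars K\<^esub> y = x \<oplus>\<^bsub>K\<^esub> y"
  "a \<odot>\<^bsub>scalars K\<^esub> x = a \<otimes>\<^bsub>K\<^esub> x"
  by (simp_all add: scalars_def)

text \<open>Spaces of linear maps, direct sums and spaces of functions with bounded support all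
  consist of extensional functions with pointwise operations. For each of them only the closure
  properties remain to be checked.\<close>

lemma module_pointwise:
  assumes K: "cring K" and M: "\<And>i. i \<in> S \<Longrightarrow> module K (M i)"
    and A: "A \<subseteq> (\<Pi>\<^sub>E i\<in>S. carrier (M i))"
    and zero: "(\<lambda>i\<in>S. \<zero>\<^bsub>M i\<^esub>) \<in> A"
    and add: "\<And>s t. s \<in> A \<Longrightarrow> t \<in> A \<Longrightarrow> (\<lambda>i\<in>S. s i \<oplus>\<^bsub>M i\<^esub> t i) \<in> A"
    and smult: "\<And>a s. a \<in> carrier K \<Longrightarrow> s \<in> A \<Longrightarrow> (\<lambda>i\<in>S. a \<odot>\<^bsub>M i\<^esub> s i) \<in> A"
  shows "module K (mk_space A (\<lambda>i\<in>S. \<zero>\<^bsub>M i\<^esub>) (\<lambda>s t. \<lambda>i\<in>S. s i \<oplus>\<^bsub>M i\<^esub> t i)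
    (\<lambda>a s. \<lambda>i\<in>S. a \<odot>\<^bsub>M i\<^esub> s i))"
proof -
  have ab: "abelian_group (M i)" if "i \<in> S" for i
    using M[OF that] by (rule module.axioms)
  have mo: "abelian_monoid (M i)" if "i \<in> S" for i
    using ab[OF that] by (rule abelian_group.axioms)
  have c: "s i \<in> carrier (M i)" if "s \<in> A" "i \<in> S" for s i
    using A that by (auto dest: PiE_mem)
  have e: "(\<lambda>i\<in>S. f i) = s" if "s \<in> A" "\<And>i. i \<in> S \<Longrightarrow> f i = s i" for f s
    using A that by (intro extensionalityI[of _ S]) (auto simp: PiE_def)
  show ?thesis
    by (rule module_mk_space)
      (auto simp: K zero add smult c e intro!: restrict_ext e
        abelian_monoid.a_assoc[OF mo] abelian_monoid.a_comm[OF mo] abelian_monoid.l_zero[OF mo]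
        module.smult_l_null[OF M] module.smult_l_distr[OF M] module.smult_r_distr[OF M]
        module.smult_assoc1[OF M] module.smult_one[OF M])
qed

lemma (in module) submoduleI':
  assumes "H \<subseteq> carrier M" "\<zero>\<^bsub>M\<^esub> \<in> H"
    and "\<And>x y. x \<in> H \<Longrightarrow> y \<in> H \<Longrightarrow> x \<oplus>\<^bsub>M\<^esub> y \<in> H"
    and "\<And>a x. a \<in> carrier R \<Longrightarrow> x \<in> H \<Longrightarrow> a \<odot>\<^bsub>M\<^esub> x \<in> H"
  shows "submodule H R M"
proof (rule submoduleI)
  fix x assume x: "x \<in> H"
  then have "\<ominus>\<^bsub>M\<^esub> x = (\<ominus> \<one>) \<odot>\<^bsub>M\<^esub> x"
    using assms(1) by (subst smult_l_minus) auto
  then show "\<ominus>\<^bsub>M\<^esub> x \<in> H" using assms(4) x by simp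
qed (use assms in auto)

lemma submodule_zero: "submodule H K M \<Longrightarrow> \<zero>\<^bsub>M\<^esub> \<in> H"
  using subgroup.one_closed[OF submodule.axioms(1)] by fastforce

section \<open>Linear maps and spaces of linear maps\<close>

lemma linI:
  assumes "\<And>x. x \<in> carrier V \<Longrightarrow> f x \<in> carrier W" "f \<in> extensional (carrier V)"
    and "\<And>x y. x \<in> carrier V \<Longrightarrow> y \<in> carrier V \<Longrightarrow> f (x \<oplus>\<^bsub>V\<^esub> y) = f x \<oplus>\<^bsub>W\<^esub> f y"
    and "\<And>a x. a \<in> carrier K \<Longrightarrow> x \<in> carrier V \<Longrightarrow> f (a \<odot>\<^bsub>V\<^esub> x) = a \<odot>\<^bsub>W\<^esub> f x"
  shows "f \<in> lin K V W"
  using assms by (auto simp: lin_def PiE_def)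

lemma lin_restrictI:
  assumes V: "module K V"
    and "\<And>x. x \<in> carrier V \<Longrightarrow> f x \<in> carrier W"
    and "\<And>x y. x \<in> carrier V \<Longrightarrow> y \<in> carrier V \<Longrightarrow> f (x \<oplus>\<^bsub>V\<^esub> y) = f x \<oplus>\<^bsub>W\<^esub> f y"
    and "\<And>a x. a \<in> carrier K \<Longrightarrow> x \<in> carrier V \<Longrightarrow> f (a \<odot>\<^bsub>V\<^esub> x) = a \<odot>\<^bsub>W\<^esub> f x"
  shows "(\<lambda>x\<in>carrier V. f x) \<in> lin K V W"
proof -
  interpret module K V by (rule V)
  show ?thesis by (rule linI) (use assms in auto)
qed

lemma lin_closed: "f \<in> lin K V W \<Longrightarrow> x \<in> carrier V \<Longrightarrow> f x \<in> carrier W"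
  and lin_extensional: "f \<in> lin K V W \<Longrightarrow> f \<in> extensional (carrier V)"
  and lin_add: "f \<in> lin K V W \<Longrightarrow> x \<in> carrier V \<Longrightarrow> y \<in> carrier V \<Longrightarrow>
    f (x \<oplus>\<^bsub>V\<^esub> y) = f x \<oplus>\<^bsub>W\<^esub> f y"
  and lin_smult: "f \<in> lin K V W \<Longrightarrow> a \<in> carrier K \<Longrightarrow> x \<in> carrier V \<Longrightarrow>
    f (a \<odot>\<^bsub>V\<^esub> x) = a \<odot>\<^bsub>W\<^esub> f x"
  by (auto simp: lin_def PiE_def)

lemma lin_eqI:
  assumes "f \<in> lin K V W" "g \<in> lin K V W'" "\<And>x. x \<in> carrier V \<Longrightarrow> f x = g x"
  shows "f = g"
  using assms by (intro extensionalityI) (auto intro: lin_extensional)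

lemma lin_zero:
  assumes f: "f \<in> lin K V W" and V: "module K V" and W: "module K W"
  shows "f \<zero>\<^bsub>V\<^esub> = \<zero>\<^bsub>W\<^esub>"
proof -
  interpret V: module K V by (rule V)
  interpret W: module K W by (rule W)
  have "f \<zero>\<^bsub>V\<^esub> = f (\<zero>\<^bsub>K\<^esub> \<odot>\<^bsub>V\<^esub> \<zero>\<^bsub>V\<^esub>)" by simp
  also have "\<dots> = \<zero>\<^bsub>W\<^esub>"
    using lin_closed[OF f, of "\<zero>\<^bsub>V\<^esub>"] by (subst lin_smult[OF f]) auto
  finally show ?thesis .
qed

text \<open>The relations divided out in a tensor product or a coend are differences. This turns the
  vanishing of a map on such a relation into an equation between two of its values.\<close>

lemma lin_minus_eq_zero_iff:
  assumes f: "f \<in> lin K V W" and V: "module K V" and W: "module K W"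
    and x: "x \<in> carrier V" and y: "y \<in> carrier V"
  shows "f (x \<ominus>\<^bsub>V\<^esub> y) = \<zero>\<^bsub>W\<^esub> \<longleftrightarrow> f x = f y"
proof -
  interpret V: module K V by (rule V)
  interpret W: module K W by (rule W)
  have m: "x \<ominus>\<^bsub>V\<^esub> y \<in> carrier V" using x y by simp
  have "f x = f ((x \<ominus>\<^bsub>V\<^esub> y) \<oplus>\<^bsub>V\<^esub> y)"
    using x y by (simp add: a_minus_def V.a_assoc V.l_neg)
  also have "\<dots> = f (x \<ominus>\<^bsub>V\<^esub> y) \<oplus>\<^bsub>W\<^esub> f y"
    using f m y by (rule lin_add)
  finally show ?thesis
    using lin_closed[OF f] m x y by auto
qed

lemma lin_id: "module K V \<Longrightarrow> (\<lambda>x\<in>carrier V. x) \<in> lin K V V"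
  by (rule lin_restrictI) auto

lemma lin_compose:
  assumes f: "f \<in> lin K U V" and g: "g \<in> lin K V W" and U: "module K U"
  shows "compose (carrier U) g f \<in> lin K U W"
  unfolding compose_def using U
  by (rule lin_restrictI)
    (simp_all add: lin_add[OF f] lin_smult[OF f] lin_add[OF g] lin_smult[OF g] lin_closed[OF f]
      lin_closed[OF g])

lemma lin_inverse:
  assumes f: "f \<in> lin K V W" and V: "module K V" and W: "module K W"
    and bij: "bij_betw f (carrier V) (carrier W)"
  shows "(\<lambda>y\<in>carrier W. inv_into (carrier V) f y) \<in> lin K W V"
proof -
  interpret V: module K V by (rule V)
  interpret W: module K W by (rule W)
  let ?g = "inv_into (carrier V) f"
  have inj: "inj_on f (carrier V)" and surj: "f ` carrier V = carrier W"
    using bij by (auto simp: bij_betw_def)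
  have g: "?g y \<in> carrier V" "f (?g y) = y" if "y \<in> carrier W" for y
    using that surj by (auto intro: inv_into_into f_inv_into_f)
  show ?thesis
    by (rule lin_restrictI[OF W])
      (auto simp: g lin_add[OF f] lin_smult[OF f] intro!: inj_onD[OF inj] )
qed

lemma homs_simps [simp]:
  "carrier (homs K V W) = lin K V W"
  "\<zero>\<^bsub>homs K V W\<^esub> = (\<lambda>x\<in>carrier V. \<zero>\<^bsub>W\<^esub>)"
  "f \<oplus>\<^bsub>homs K V W\<^esub> g = (\<lambda>x\<in>carrier V. f x \<oplus>\<^bsub>W\<^esub> g x)"
  "a \<odot>\<^bsub>homs K V W\<^esub> f = (\<lambda>x\<in>carrier V. a \<odot>\<^bsub>W\<^esub> f x)"
  by (simp_all add: homs_def)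

lemma homs_module:
  assumes V: "module K V" and W: "module K W"
  shows "module K (homs K V W)"
proof -
  interpret V: module K V by (rule V)
  interpret W: module K W by (rule W)
  show ?thesis
    unfolding homs_def
  proof (rule module_pointwise)
    fix f g assume f: "f \<in> lin K V W" and g: "g \<in> lin K V W"
    show "(\<lambda>x\<in>carrier V. f x \<oplus>\<^bsub>W\<^esub> g x) \<in> lin K V W"
      by (rule lin_restrictI[OF V])
        (auto simp: lin_closed[OF f] lin_closed[OF g] lin_add[OF f] lin_add[OF g]
          lin_smult[OF f] lin_smult[OF g] W.smult_r_distr W.a_ac)
  next
    fix a f assume a: "a \<in> carrier K" and f: "f \<in> lin K V W"
    show "(\<lambda>x\<in>carrier V. a \<odot>\<^bsub>W\<^esub> f x) \<in> lin K V W"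
      by (rule lin_restrictI[OF V])
        (auto simp: a lin_closed[OF f] lin_add[OF f] lin_smult[OF f] W.smult_r_distr
          W.smult_assoc1[symmetric] V.R.m_comm)
  qed (auto simp: V.R.is_cring W intro: lin_restrictI[OF V] simp: lin_def)
qed

lemma homs_precompose:
  assumes U: "module K U" and V: "module K V" and P: "module K P" and q: "q \<in> lin K U V"
  shows "(\<lambda>h\<in>lin K V P. compose (carrier U) h q) \<in> lin K (homs K V P) (homs K U P)"
proof -
  have "(\<lambda>h\<in>carrier (homs K V P). compose (carrier U) h q) \<in> lin K (homs K V P) (homs K U P)"
    by (rule lin_restrictI[OF homs_module[OF V P]])
      (auto simp: compose_def fun_eq_iff lin_closed[OF q] intro: lin_compose[OF q _ U, unfolded compose_def])
  then show ?thesis by simp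
qed

lemma homs_postcompose:
  assumes U: "module K U" and V: "module K V" and f: "f \<in> lin K V W"
  shows "(\<lambda>h\<in>lin K U V. compose (carrier U) f h) \<in> lin K (homs K U V) (homs K U W)"
proof -
  have "(\<lambda>h\<in>carrier (homs K U V). compose (carrier U) f h) \<in> lin K (homs K U V) (homs K U W)"
    by (rule lin_restrictI[OF homs_module[OF U V]])
      (auto simp: compose_def fun_eq_iff lin_closed lin_add[OF f] lin_smult[OF f]
        intro: lin_compose[OF _ f U, unfolded compose_def])
  then show ?thesis by simp
qed

section \<open>Quotients\<close>

lemma span_of_superset: "A \<subseteq> span_of K M A"
  by (auto simp: span_of_def)

lemma submodule_span_of:
  assumes M: "module K M" and A: "A \<subseteq> carrier M"
  shows "submodule (span_of K M A) K M"
proof -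
  interpret module K M by (rule M)
  show ?thesis
  proof (rule submoduleI')
    show "span_of K M A \<subseteq> carrier M"
      using carrier_is_submodule A by (auto simp: span_of_def)
    show "\<zero>\<^bsub>M\<^esub> \<in> span_of K M A"
      by (auto simp: span_of_def intro: submodule_zero)
  qed (auto simp: span_of_def intro: submoduleE)
qed

lemma submodule_kernel:
  assumes M: "module K M" and P: "module K P" and f: "f \<in> lin K M P"
  shows "submodule {x \<in> carrier M. f x = \<zero>\<^bsub>P\<^esub>} K M"
proof -
  interpret M: module K M by (rule M)
  interpret P: module K P by (rule P)
  show ?thesis
    by (rule M.submoduleI') (auto simp: lin_zero[OF f M P] lin_add[OF f] lin_smult[OF f])
qed

text \<open>The kernel of \<open>f\<close> is one of the submodules whose intersection is the
  span.\<close>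

lemma span_of_kernel:
  assumes M: "module K M" and P: "module K P" and f: "f \<in> lin K M P"
    and A: "A \<subseteq> carrier M" "\<And>x. x \<in> A \<Longrightarrow> f x = \<zero>\<^bsub>P\<^esub>"
    and x: "x \<in> span_of K M A"
  shows "f x = \<zero>\<^bsub>P\<^esub>"
  using x A submodule_kernel[OF M P f] by (auto simp: span_of_def)

locale quotient_module = module K M for K :: "'k ring" (structure) and M :: "('k, 'a) module" +
  fixes N
  assumes submodule: "submodule N K M"
begin

lemma abelian_subgroup: "abelian_subgroup N M"
  by (intro abelian_subgroupI3 additive_subgroupI submodule.axioms(1)[OF submodule]
      abelian_group_axioms)

sublocale N: abelian_subgroup N M
  by (rule abelian_subgroup)

lemma quotient_carrier: "carrier (quotient_space M N) = (\<lambda>x. N +>\<^bsub>M\<^esub> x) ` carrier M"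
  by (auto simp: quotient_space_def A_RCOSETS_def')

text \<open>The definition adds \<open>N\<close> to the image of the coset because for the scalar
  zero that image is only the singleton of zero, which need not be a coset.\<close>

lemma coset_smult:
  assumes a: "a \<in> carrier K" and x: "x \<in> carrier M"
  shows "a \<odot>\<^bsub>quotient_space M N\<^esub> (N +>\<^bsub>M\<^esub> x) = N +>\<^bsub>M\<^esub> (a \<odot>\<^bsub>M\<^esub> x)"
proof -
  have "N <+>\<^bsub>M\<^esub> (\<lambda>x. a \<odot>\<^bsub>M\<^esub> x) ` (N +>\<^bsub>M\<^esub> x) = N +>\<^bsub>M\<^esub> (a \<odot>\<^bsub>M\<^esub> x)"
  proof (intro equalityI subsetI)
    fix y assume "y \<in> N <+>\<^bsub>M\<^esub> (\<lambda>x. a \<odot>\<^bsub>M\<^esub> x) ` (N +>\<^bsub>M\<^esub> x)"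
    then obtain n n' where n: "n \<in> N" "n' \<in> N" and y: "y = n \<oplus>\<^bsub>M\<^esub> a \<odot>\<^bsub>M\<^esub> (n' \<oplus>\<^bsub>M\<^esub> x)"
      by (auto simp: set_add_def' a_r_coset_def')
    have "n \<in> carrier M" "n' \<in> carrier M" using n N.a_subset by auto
    then have "y = (n \<oplus>\<^bsub>M\<^esub> a \<odot>\<^bsub>M\<^esub> n') \<oplus>\<^bsub>M\<^esub> a \<odot>\<^bsub>M\<^esub> x"
      using y a x by (simp add: smult_r_distr M.a_assoc)
    moreover have "n \<oplus>\<^bsub>M\<^esub> a \<odot>\<^bsub>M\<^esub> n' \<in> N"
      using submoduleE[OF submodule] n a by auto
    ultimately show "y \<in> N +>\<^bsub>M\<^esub> (a \<odot>\<^bsub>M\<^esub> x)"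
      by (auto simp: a_r_coset_def')
  next
    fix y assume "y \<in> N +>\<^bsub>M\<^esub> (a \<odot>\<^bsub>M\<^esub> x)"
    then obtain n where "n \<in> N" "y = n \<oplus>\<^bsub>M\<^esub> a \<odot>\<^bsub>M\<^esub> x" by (auto simp: a_r_coset_def')
    then show "y \<in> N <+>\<^bsub>M\<^esub> (\<lambda>x. a \<odot>\<^bsub>M\<^esub> x) ` (N +>\<^bsub>M\<^esub> x)"
      using N.a_rcos_self[OF x] by (auto simp: set_add_def')
  qed
  then show ?thesis by (simp add: quotient_space_def)
qed

lemma coset_add:
  assumes "x \<in> carrier M" "y \<in> carrier M"
  shows "(N +>\<^bsub>M\<^esub> x) \<oplus>\<^bsub>quotient_space M N\<^esub> (N +>\<^bsub>M\<^esub> y) = N +>\<^bsub>M\<^esub> (x \<oplus>\<^bsub>M\<^esub> y)"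
  using N.a_rcos_sum[OF assms] by (simp add: quotient_space_def)

lemma quotient_zero: "\<zero>\<^bsub>quotient_space M N\<^esub> = N +>\<^bsub>M\<^esub> \<zero>\<^bsub>M\<^esub>"
  by (simp add: quotient_space_def N.a_subset)

lemma quotient_module: "module K (quotient_space M N)"
  unfolding quotient_space_def
proof (rule module_image[OF module_axioms, where \<pi> = "\<lambda>x. N +>\<^bsub>M\<^esub> x"])
  show "a_rcosets\<^bsub>M\<^esub> N = (\<lambda>x. N +>\<^bsub>M\<^esub> x) ` carrier M" "N = N +>\<^bsub>M\<^esub> \<zero>\<^bsub>M\<^esub>"
    using quotient_carrier quotient_zero by (simp_all add: quotient_space_def)
qed (use coset_add coset_smult in \<open>simp_all add: quotient_space_def\<close>)

lemma coset_eqI: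
  assumes "x \<in> carrier M" "y \<in> carrier M" "x \<ominus>\<^bsub>M\<^esub> y \<in> N"
  shows "N +>\<^bsub>M\<^esub> x = N +>\<^bsub>M\<^esub> y"
proof -
  have "x = (x \<ominus>\<^bsub>M\<^esub> y) \<oplus>\<^bsub>M\<^esub> y"
    using assms by (simp add: a_minus_def M.a_assoc M.l_neg)
  then have "x \<in> N +>\<^bsub>M\<^esub> y"
    using assms(3) by (auto simp: a_r_coset_def')
  then show ?thesis
    using assms(2) N.a_subgroup M.a_repr_independence by metis
qed

lemma quotient_lift:
  assumes P: "module K P" and f: "f \<in> lin K M P" and ker: "\<And>x. x \<in> N \<Longrightarrow> f x = \<zero>\<^bsub>P\<^esub>"
  shows "\<exists>g\<in>lin K (quotient_space M N) P. \<forall>x\<in>carrier M. g (N +>\<^bsub>M\<^esub> x) = f x"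
proof -
  interpret P: module K P by (rule P)
  \<comment> \<open>Picking an arbitrary representative is harmless: two representatives of a coset
    differ by an element of \<open>N\<close>, where \<open>f\<close> vanishes.\<close>
  define g where "g = (\<lambda>C\<in>carrier (quotient_space M N). f (SOME x. x \<in> C))"
  have g: "g (N +>\<^bsub>M\<^esub> x) = f x" if x: "x \<in> carrier M" for x
  proof -
    have "(SOME y. y \<in> N +>\<^bsub>M\<^esub> x) \<in> N +>\<^bsub>M\<^esub> x"
      using N.a_rcos_self[OF x] by (rule someI)
    then obtain n where n: "n \<in> N" "(SOME y. y \<in> N +>\<^bsub>M\<^esub> x) = n \<oplus>\<^bsub>M\<^esub> x"
      by (auto simp: a_r_coset_def')
    moreover have "f (n \<oplus>\<^bsub>M\<^esub> x) = f x"
      using n x N.a_subset lin_closed[OF f x] by (subst lin_add[OF f]) (auto simp: ker)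
    ultimately show ?thesis
      using x by (simp add: g_def quotient_carrier)
  qed
  have "g \<in> lin K (quotient_space M N) P"
  proof (rule linI)
    show "g \<in> extensional (carrier (quotient_space M N))" by (simp add: g_def)
  qed (auto simp: quotient_carrier g coset_add coset_smult lin_add[OF f] lin_smult[OF f]
      lin_closed[OF f])
  then show ?thesis using g by blast
qed

end

section \<open>Direct sums and free spaces\<close>

lemma direct_sum_simps [simp]:
  "carrier (direct_sum S M) =
    {s \<in> \<Pi>\<^sub>E i\<in>S. carrier (M i). finite {i \<in> S. s i \<noteq> \<zero>\<^bsub>M i\<^esub>}}"
  "\<zero>\<^bsub>direct_sum S M\<^esub> = (\<lambda>i\<in>S. \<zero>\<^bsub>M i\<^esub>)"
  "s \<oplus>\<^bsub>direct_sum S M\<^esub> t = (\<lambda>i\<in>S. s i \<oplus>\<^bsub>M i\<^esub> t i)"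
  "a \<odot>\<^bsub>direct_sum S M\<^esub> s = (\<lambda>i\<in>S. a \<odot>\<^bsub>M i\<^esub> s i)"
  by (simp_all add: direct_sum_def)

context
  fixes K :: "'k ring" and S :: "'i set" and M :: "'i \<Rightarrow> ('k, 'a) module"
  assumes K: "cring K" and M: "\<And>i. i \<in> S \<Longrightarrow> module K (M i)"
begin

lemma summand_zero: "i \<in> S \<Longrightarrow> \<zero>\<^bsub>M i\<^esub> \<in> carrier (M i)"
  and summand_add: "i \<in> S \<Longrightarrow> x \<in> carrier (M i) \<Longrightarrow> y \<in> carrier (M i) \<Longrightarrow>
    x \<oplus>\<^bsub>M i\<^esub> y \<in> carrier (M i)"
  and summand_l_zero: "i \<in> S \<Longrightarrow> x \<in> carrier (M i) \<Longrightarrow> \<zero>\<^bsub>M i\<^esub> \<oplus>\<^bsub>M i\<^esub> x = x"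
  and summand_r_zero: "i \<in> S \<Longrightarrow> x \<in> carrier (M i) \<Longrightarrow> x \<oplus>\<^bsub>M i\<^esub> \<zero>\<^bsub>M i\<^esub> = x"
  using M[THEN module.axioms(2), THEN abelian_group.axioms(1)]
  by (blast intro: abelian_monoid.zero_closed abelian_monoid.a_closed
      abelian_monoid.l_zero abelian_monoid.r_zero)+

lemma summand_mem: "s \<in> (\<Pi>\<^sub>E i\<in>S. carrier (M i)) \<Longrightarrow> i \<in> S \<Longrightarrow> s i \<in> carrier (M i)"
  by (rule PiE_mem)

lemma direct_sum_module: "module K (direct_sum S M)"
proof -
  let ?D = "carrier (direct_sum S M)"
  have "module K (mk_space ?D (\<lambda>i\<in>S. \<zero>\<^bsub>M i\<^esub>) (\<lambda>s t. \<lambda>i\<in>S. s i \<oplus>\<^bsub>M i\<^esub> t i)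
      (\<lambda>a s. \<lambda>i\<in>S. a \<odot>\<^bsub>M i\<^esub> s i))"
  proof (rule module_pointwise)
    fix s t assume s: "s \<in> ?D" and t: "t \<in> ?D"
    have "{i \<in> S. s i \<oplus>\<^bsub>M i\<^esub> t i \<noteq> \<zero>\<^bsub>M i\<^esub>} \<subseteq> {i \<in> S. s i \<noteq> \<zero>\<^bsub>M i\<^esub>} \<union> {i \<in> S. t i \<noteq> \<zero>\<^bsub>M i\<^esub>}"
      using summand_l_zero summand_zero by auto
    then have "finite {i \<in> S. s i \<oplus>\<^bsub>M i\<^esub> t i \<noteq> \<zero>\<^bsub>M i\<^esub>}"
      using s t by (auto intro: finite_subset)
    then show "(\<lambda>i\<in>S. s i \<oplus>\<^bsub>M i\<^esub> t i) \<in> ?D"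
      using s t by (auto cong: conj_cong simp: summand_mem summand_add)
  next
    fix a s assume a: "a \<in> carrier K" and s: "s \<in> ?D"
    have "{i \<in> S. a \<odot>\<^bsub>M i\<^esub> s i \<noteq> \<zero>\<^bsub>M i\<^esub>} \<subseteq> {i \<in> S. s i \<noteq> \<zero>\<^bsub>M i\<^esub>}"
      using a by (auto simp: module.smult_r_null[OF M])
    then have "finite {i \<in> S. a \<odot>\<^bsub>M i\<^esub> s i \<noteq> \<zero>\<^bsub>M i\<^esub>}"
      using s by (auto intro: finite_subset)
    then show "(\<lambda>i\<in>S. a \<odot>\<^bsub>M i\<^esub> s i) \<in> ?D"
      using a s by (auto cong: conj_cong intro: module.smult_closed[OF M])
  qed (auto simp: K M summand_zero cong: conj_cong)
  then show ?thesis by (simp add: direct_sum_def)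
qed

lemma inject_closed:
  assumes "i \<in> S" "x \<in> carrier (M i)"
  shows "inject S M i x \<in> carrier (direct_sum S M)"
proof -
  have "{j \<in> S. inject S M i x j \<noteq> \<zero>\<^bsub>M j\<^esub>} \<subseteq> {i}" by (auto simp: inject_def)
  then show ?thesis
    using assms summand_zero by (auto simp: inject_def intro: finite_subset)
qed

lemma inject_add:
  assumes "i \<in> S" "x \<in> carrier (M i)" "y \<in> carrier (M i)"
  shows "inject S M i (x \<oplus>\<^bsub>M i\<^esub> y) = inject S M i x \<oplus>\<^bsub>direct_sum S M\<^esub> inject S M i y"
  using assms by (auto simp: inject_def summand_l_zero summand_zero fun_eq_iff)

lemma inject_smult:
  assumes "i \<in> S" "a \<in> carrier K" "x \<in> carrier (M i)"
  shows "inject S M i (a \<odot>\<^bsub>M i\<^esub> x) = a \<odot>\<^bsub>direct_sum S M\<^esub> inject S M i x"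
  using assms by (auto simp: inject_def fun_eq_iff module.smult_r_null[OF M])

text \<open>Induction on the support: the function \<open>?t\<close>, with one coordinate reset to
  zero, has a smaller support, and \<open>inject\<close> restores the deleted coordinate.\<close>

lemma direct_sum_induct [consumes 1, case_names zero inject add]:
  assumes s: "s \<in> carrier (direct_sum S M)"
    and zero: "P \<zero>\<^bsub>direct_sum S M\<^esub>"
    and inject: "\<And>i x. i \<in> S \<Longrightarrow> x \<in> carrier (M i) \<Longrightarrow> P (inject S M i x)"
    and add: "\<And>s t. s \<in> carrier (direct_sum S M) \<Longrightarrow> t \<in> carrier (direct_sum S M) \<Longrightarrow>
      P s \<Longrightarrow> P t \<Longrightarrow> P (s \<oplus>\<^bsub>direct_sum S M\<^esub> t)"
  shows "P s"
proof -
  have "finite {i \<in> S. s i \<noteq> \<zero>\<^bsub>M i\<^esub>}" using s by simp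
  then show ?thesis using s
  proof (induction "{i \<in> S. s i \<noteq> \<zero>\<^bsub>M i\<^esub>}" arbitrary: s rule: finite_induct)
    case empty
    then have "s = \<zero>\<^bsub>direct_sum S M\<^esub>" by (intro extensionalityI[of _ S]) (auto simp: PiE_def)
    then show ?case using zero by (simp only:)
  next
    case (insert i F)
    let ?t = "\<lambda>j\<in>S. if j = i then \<zero>\<^bsub>M j\<^esub> else s j"
    have i: "i \<in> S" using insert by auto
    have F: "F = {j \<in> S. ?t j \<noteq> \<zero>\<^bsub>M j\<^esub>}" using insert by auto
    then have "finite {j \<in> S. ?t j \<noteq> \<zero>\<^bsub>M j\<^esub>}" using insert(1) by simp
    then have t: "?t \<in> carrier (direct_sum S M)"
      using insert.prems summand_zero by auto
    have mem: "s j \<in> carrier (M j)" if "j \<in> S" for j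
      using insert.prems that by (simp add: summand_mem)
    note si = mem[OF i]
    have "s = inject S M i (s i) \<oplus>\<^bsub>direct_sum S M\<^esub> ?t"
      using insert.prems i by (intro extensionalityI[of _ S])
        (auto simp: PiE_def inject_def summand_l_zero summand_r_zero mem)
    then show ?case
      using add[OF inject_closed[OF i si] t inject[OF i si] insert.hyps(3)[OF F t]] by simp
  qed
qed

lemma direct_sum_lift:
  assumes P: "module K P" and f: "\<And>i. i \<in> S \<Longrightarrow> f i \<in> lin K (M i) P"
  shows "\<exists>g\<in>lin K (direct_sum S M) P. \<forall>i\<in>S. \<forall>x\<in>carrier (M i). g (inject S M i x) = f i x"
proof -
  interpret P: module K P by (rule P)
  interpret D: module K "direct_sum S M" by (rule direct_sum_module)
  define g where "g s = (\<Oplus>\<^bsub>P\<^esub>i\<in>{i \<in> S. s i \<noteq> \<zero>\<^bsub>M i\<^esub>}. f i (s i))" for s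
  \<comment> \<open>The sum may be taken over any finite set containing the support. The sums for
    two elements and for their sum can then be compared over one index set, although the three
    supports differ.\<close>
  have g: "g s = (\<Oplus>\<^bsub>P\<^esub>i\<in>T. f i (s i))"
    if "s \<in> carrier (direct_sum S M)" "finite T" "T \<subseteq> S" "{i \<in> S. s i \<noteq> \<zero>\<^bsub>M i\<^esub>} \<subseteq> T" for s T
    unfolding g_def
  proof (rule P.add.finprod_mono_neutral_cong_left)
    fix i assume "i \<in> T - {i \<in> S. s i \<noteq> \<zero>\<^bsub>M i\<^esub>}"
    then show "f i (s i) = \<zero>\<^bsub>P\<^esub>" using that lin_zero[OF f M P] by auto
  qed (use that in \<open>auto intro!: lin_closed[OF f]\<close>)
  have "(\<lambda>s\<in>carrier (direct_sum S M). g s) \<in> lin K (direct_sum S M) P"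
  proof (rule lin_restrictI[OF direct_sum_module])
    fix s assume "s \<in> carrier (direct_sum S M)"
    then show "g s \<in> carrier P"
      unfolding g_def by (intro P.finsum_closed) (auto intro!: lin_closed[OF f])
  next
    fix s t assume s: "s \<in> carrier (direct_sum S M)" and t: "t \<in> carrier (direct_sum S M)"
    let ?T = "{i \<in> S. s i \<noteq> \<zero>\<^bsub>M i\<^esub>} \<union> {i \<in> S. t i \<noteq> \<zero>\<^bsub>M i\<^esub>}"
    have T: "finite ?T" "?T \<subseteq> S" using s t by auto
    have sub: "{i \<in> S. (s \<oplus>\<^bsub>direct_sum S M\<^esub> t) i \<noteq> \<zero>\<^bsub>M i\<^esub>} \<subseteq> ?T"
      using summand_l_zero summand_zero by auto
    have "g (s \<oplus>\<^bsub>direct_sum S M\<^esub> t) = (\<Oplus>\<^bsub>P\<^esub>i\<in>?T. f i ((s \<oplus>\<^bsub>direct_sum S M\<^esub> t) i))"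
      using D.a_closed[OF s t] T sub by (rule g)
    also have "\<dots> = (\<Oplus>\<^bsub>P\<^esub>i\<in>?T. f i (s i) \<oplus>\<^bsub>P\<^esub> f i (t i))"
      using s t by (intro P.finsum_cong') (auto intro!: lin_closed[OF f] lin_add[OF f])
    also have "\<dots> = (\<Oplus>\<^bsub>P\<^esub>i\<in>?T. f i (s i)) \<oplus>\<^bsub>P\<^esub> (\<Oplus>\<^bsub>P\<^esub>i\<in>?T. f i (t i))"
      using s t by (intro P.finsum_addf) (auto intro!: lin_closed[OF f])
    also have "\<dots> = g s \<oplus>\<^bsub>P\<^esub> g t"
      using g[OF s T] g[OF t T] by auto
    finally show "g (s \<oplus>\<^bsub>direct_sum S M\<^esub> t) = g s \<oplus>\<^bsub>P\<^esub> g t" .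
  next
    fix a s assume a: "a \<in> carrier K" and s: "s \<in> carrier (direct_sum S M)"
    let ?T = "{i \<in> S. s i \<noteq> \<zero>\<^bsub>M i\<^esub>}"
    have T: "finite ?T" "?T \<subseteq> S" using s by auto
    have sub: "{i \<in> S. (a \<odot>\<^bsub>direct_sum S M\<^esub> s) i \<noteq> \<zero>\<^bsub>M i\<^esub>} \<subseteq> ?T"
      using a by (auto simp: module.smult_r_null[OF M])
    have "g (a \<odot>\<^bsub>direct_sum S M\<^esub> s) = (\<Oplus>\<^bsub>P\<^esub>i\<in>?T. f i ((a \<odot>\<^bsub>direct_sum S M\<^esub> s) i))"
      using D.smult_closed[OF a s] T sub by (rule g)
    also have "\<dots> = (\<Oplus>\<^bsub>P\<^esub>i\<in>?T. a \<odot>\<^bsub>P\<^esub> f i (s i))"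
      using s a by (intro P.finsum_cong') (auto intro!: lin_closed[OF f] lin_smult[OF f])
    also have "\<dots> = a \<odot>\<^bsub>P\<^esub> g s"
      unfolding g_def using s a T
      by (intro P.finsum_smult_ldistr[symmetric]) (auto intro!: lin_closed[OF f])
    finally show "g (a \<odot>\<^bsub>direct_sum S M\<^esub> s) = a \<odot>\<^bsub>P\<^esub> g s" .
  qed
  moreover have "g (inject S M i x) = f i x" if i: "i \<in> S" and x: "x \<in> carrier (M i)" for i x
  proof -
    have "g (inject S M i x) = (\<Oplus>\<^bsub>P\<^esub>j\<in>{i}. f j (inject S M i x j))"
      by (rule g[OF inject_closed[OF i x]]) (use i in \<open>auto simp: inject_def\<close>)
    then show ?thesis
      using i lin_closed[OF f[OF i] x] by (simp add: inject_def)
  qed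
  ultimately show ?thesis
    using inject_closed by (intro bexI[of _ "\<lambda>s\<in>carrier (direct_sum S M). g s"]) auto
qed

end

section \<open>Free spaces as direct sums of copies of the scalars\<close>

lemma free_space_module: "cring K \<Longrightarrow> module K (free_space K S)"
  unfolding free_space_def by (intro direct_sum_module scalars_module)

lemma free_gen_closed: "cring K \<Longrightarrow> s \<in> S \<Longrightarrow> free_gen K S s \<in> carrier (free_space K S)"
  unfolding free_space_def free_gen_def
  by (rule inject_closed[where K = K]) (simp_all add: scalars_module cring.cring_simprules)

lemma inject_scalars:
  assumes K: "cring K" and s: "s \<in> S" and a: "a \<in> carrier K"
  shows "inject S (\<lambda>_. scalars K) s a = a \<odot>\<^bsub>free_space K S\<^esub> free_gen K S s"
proof -
  interpret cring K by (rule K)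
  show ?thesis
    using inject_smult[of K S "\<lambda>_. scalars K" s a "\<one>\<^bsub>K\<^esub>"] s a
    by (simp add: K scalars_module free_space_def free_gen_def)
qed

lemma free_space_induct [consumes 2, case_names zero gen add]:
  assumes K: "cring K" and s: "s \<in> carrier (free_space K S)"
    and "P \<zero>\<^bsub>free_space K S\<^esub>"
    and "\<And>a i. a \<in> carrier K \<Longrightarrow> i \<in> S \<Longrightarrow> P (a \<odot>\<^bsub>free_space K S\<^esub> free_gen K S i)"
    and "\<And>s t. s \<in> carrier (free_space K S) \<Longrightarrow> t \<in> carrier (free_space K S) \<Longrightarrow>
      P s \<Longrightarrow> P t \<Longrightarrow> P (s \<oplus>\<^bsub>free_space K S\<^esub> t)"
  shows "P s"
proof -
  have "s \<in> carrier (direct_sum S (\<lambda>_. scalars K))"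
    using s by (simp add: free_space_def)
  with K scalars_module[OF K] show ?thesis
  proof (rule direct_sum_induct)
    fix i x assume "i \<in> S" "x \<in> carrier (scalars K)"
    then show "P (inject S (\<lambda>_. scalars K) i x)"
      using assms(4) by (simp add: inject_scalars[OF K])
  qed (use assms in \<open>auto simp only: free_space_def\<close>)
qed

lemma free_space_lift:
  assumes K: "cring K" and P: "module K P" and u: "\<And>s. s \<in> S \<Longrightarrow> u s \<in> carrier P"
  shows "\<exists>g\<in>lin K (free_space K S) P. \<forall>s\<in>S. g (free_gen K S s) = u s"
proof -
  interpret P: module K P by (rule P)
  define f where "f s = (\<lambda>a\<in>carrier (scalars K). a \<odot>\<^bsub>P\<^esub> u s)" for s
  have f: "f s \<in> lin K (scalars K) P" if "s \<in> S" for s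
    unfolding f_def using u[OF that]
    by (intro lin_restrictI scalars_module K) (auto simp: P.smult_l_distr P.smult_assoc1)
  have "\<exists>g\<in>lin K (free_space K S) P.
      \<forall>s\<in>S. \<forall>a\<in>carrier (scalars K). g (inject S (\<lambda>_. scalars K) s a) = f s a"
    unfolding free_space_def by (rule direct_sum_lift[OF K scalars_module[OF K] P f])
  then obtain g where "g \<in> lin K (free_space K S) P"
    and g: "\<forall>s\<in>S. \<forall>a\<in>carrier (scalars K). g (inject S (\<lambda>_. scalars K) s a) = f s a" ..
  moreover have "g (free_gen K S s) = u s" if "s \<in> S" for s
    using g[rule_format, OF that, of "\<one>\<^bsub>K\<^esub>"] u[OF that] by (simp add: free_gen_def f_def)
  ultimately show ?thesis by blast
qed

lemma free_space_eqI:
  assumes K: "cring K" and P: "module K P"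
    and f: "f \<in> lin K (free_space K S) P" and g: "g \<in> lin K (free_space K S) P"
    and eq: "\<And>s. s \<in> S \<Longrightarrow> f (free_gen K S s) = g (free_gen K S s)"
  shows "f = g"
proof (rule lin_eqI[OF f g])
  fix s assume "s \<in> carrier (free_space K S)"
  with K show "f s = g s"
    by (induction s rule: free_space_induct)
      (auto simp: lin_zero[OF f free_space_module[OF K] P] lin_zero[OF g free_space_module[OF K] P]
        lin_smult[OF f] lin_smult[OF g] lin_add[OF f] lin_add[OF g] free_gen_closed[OF K] eq)
qed


section \<open>Tensor products\<close>

text \<open>The restrictions to the carriers make the partial maps members of \<open>lin\<close>,
  which contains extensional functions only.\<close>

definition bilinear ::
    "'k ring \<Rightarrow> ('k, 'a) module \<Rightarrow> ('k, 'b) module \<Rightarrow> ('k, 'c) module \<Rightarrow> ('a \<Rightarrow> 'b \<Rightarrow> 'c) \<Rightarrow> bool" where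
  "bilinear K V W P b \<longleftrightarrow>
     (\<forall>y\<in>carrier W. (\<lambda>x\<in>carrier V. b x y) \<in> lin K V P) \<and>
     (\<forall>x\<in>carrier V. (\<lambda>y\<in>carrier W. b x y) \<in> lin K W P)"

lemma bilinearI:
  assumes "module K V" "module K W"
    and "\<And>x y. x \<in> carrier V \<Longrightarrow> y \<in> carrier W \<Longrightarrow> b x y \<in> carrier P"
    and "\<And>x x' y. x \<in> carrier V \<Longrightarrow> x' \<in> carrier V \<Longrightarrow> y \<in> carrier W \<Longrightarrow>
      b (x \<oplus>\<^bsub>V\<^esub> x') y = b x y \<oplus>\<^bsub>P\<^esub> b x' y"
    and "\<And>x y y'. x \<in> carrier V \<Longrightarrow> y \<in> carrier W \<Longrightarrow> y' \<in> carrier W \<Longrightarrow>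
      b x (y \<oplus>\<^bsub>W\<^esub> y') = b x y \<oplus>\<^bsub>P\<^esub> b x y'"
    and "\<And>a x y. a \<in> carrier K \<Longrightarrow> x \<in> carrier V \<Longrightarrow> y \<in> carrier W \<Longrightarrow>
      b (a \<odot>\<^bsub>V\<^esub> x) y = a \<odot>\<^bsub>P\<^esub> b x y"
    and "\<And>a x y. a \<in> carrier K \<Longrightarrow> x \<in> carrier V \<Longrightarrow> y \<in> carrier W \<Longrightarrow>
      b x (a \<odot>\<^bsub>W\<^esub> y) = a \<odot>\<^bsub>P\<^esub> b x y"
  shows "bilinear K V W P b"
  unfolding bilinear_def using assms by (auto intro!: lin_restrictI)

context
  fixes K :: "'k ring" and V :: "('k, 'a) module" and W :: "('k, 'b) module"
  assumes V: "module K V" and W: "module K W"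
begin

interpretation V: module K V by (rule V)
interpretation W: module K W by (rule W)

private abbreviation "F \<equiv> free_space K (carrier V \<times> carrier W)"
private abbreviation "e \<equiv> free_gen K (carrier V \<times> carrier W)"

interpretation F: module K F by (rule free_space_module[OF V.R.is_cring])

private lemma e_closed: "x \<in> carrier V \<Longrightarrow> y \<in> carrier W \<Longrightarrow> e (x, y) \<in> carrier F"
  by (rule free_gen_closed[OF V.R.is_cring]) simp

lemma bilinear_closed:
  "bilinear K V W P b \<Longrightarrow> x \<in> carrier V \<Longrightarrow> y \<in> carrier W \<Longrightarrow> b x y \<in> carrier P"
  using lin_closed[of "\<lambda>x\<in>carrier V. b x y" K V P x] by (auto simp: bilinear_def)

lemma bilinear_add_left:
  "bilinear K V W P b \<Longrightarrow> x \<in> carrier V \<Longrightarrow> x' \<in> carrier V \<Longrightarrow> y \<in> carrier W \<Longrightarrow>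
    b (x \<oplus>\<^bsub>V\<^esub> x') y = b x y \<oplus>\<^bsub>P\<^esub> b x' y"
  using lin_add[of "\<lambda>x\<in>carrier V. b x y" K V P x x'] by (auto simp: bilinear_def)

lemma bilinear_add_right:
  "bilinear K V W P b \<Longrightarrow> x \<in> carrier V \<Longrightarrow> y \<in> carrier W \<Longrightarrow> y' \<in> carrier W \<Longrightarrow>
    b x (y \<oplus>\<^bsub>W\<^esub> y') = b x y \<oplus>\<^bsub>P\<^esub> b x y'"
  using lin_add[of "\<lambda>y\<in>carrier W. b x y" K W P y y'] by (auto simp: bilinear_def)

lemma bilinear_smult_left:
  "bilinear K V W P b \<Longrightarrow> a \<in> carrier K \<Longrightarrow> x \<in> carrier V \<Longrightarrow> y \<in> carrier W \<Longrightarrow>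
    b (a \<odot>\<^bsub>V\<^esub> x) y = a \<odot>\<^bsub>P\<^esub> b x y"
  using lin_smult[of "\<lambda>x\<in>carrier V. b x y" K V P a x] by (auto simp: bilinear_def)

lemma bilinear_smult_right:
  "bilinear K V W P b \<Longrightarrow> a \<in> carrier K \<Longrightarrow> x \<in> carrier V \<Longrightarrow> y \<in> carrier W \<Longrightarrow>
    b x (a \<odot>\<^bsub>W\<^esub> y) = a \<odot>\<^bsub>P\<^esub> b x y"
  using lin_smult[of "\<lambda>y\<in>carrier W. b x y" K W P a y] by (auto simp: bilinear_def)

private lemma tensor_rels_closed: "tensor_rels K V W \<subseteq> carrier F"
  by (auto simp: tensor_rels_def Let_def intro!: e_closed F.minus_closed F.a_closed F.smult_closed)

interpretation Q: quotient_module K F "tensor_ker K V W"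
  by (intro quotient_module.intro quotient_module_axioms.intro F.module_axioms)
    (simp add: tensor_ker_def submodule_span_of F.module_axioms tensor_rels_closed)

private lemma pure_eq: "pure K V W x y = tensor_ker K V W +>\<^bsub>F\<^esub> e (x, y)"
  by (simp add: pure_def Let_def)

lemma tensor_module: "module K (tensor K V W)"
  using Q.quotient_module by (simp add: tensor_def)

lemma pure_closed: "x \<in> carrier V \<Longrightarrow> y \<in> carrier W \<Longrightarrow> pure K V W x y \<in> carrier (tensor K V W)"
  by (auto simp: pure_eq tensor_def Q.quotient_carrier intro: e_closed)

text \<open>Each defining relation is one generator minus some element \<open>t\<close>, so every
  law of bilinearity arises from this statement by inserting the right \<open>t\<close>.\<close>

private lemma pure_rel:
  assumes "x \<in> carrier V" "y \<in> carrier W" "t \<in> carrier F" "e (x, y) \<ominus>\<^bsub>F\<^esub> t \<in> tensor_rels K V W"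
  shows "pure K V W x y = tensor_ker K V W +>\<^bsub>F\<^esub> t"
  using assms span_of_superset[of "tensor_rels K V W" K F]
  unfolding pure_eq by (intro Q.coset_eqI e_closed) (auto simp: tensor_ker_def)

lemma bilinear_pure: "bilinear K V W (tensor K V W) (pure K V W)"
proof (rule bilinearI[OF V W pure_closed])
  fix x x' y assume *: "x \<in> carrier V" "x' \<in> carrier V" "y \<in> carrier W"
  then have "e (x \<oplus>\<^bsub>V\<^esub> x', y) \<ominus>\<^bsub>F\<^esub> (e (x, y) \<oplus>\<^bsub>F\<^esub> e (x', y)) \<in> tensor_rels K V W"
    unfolding tensor_rels_def Let_def by blast
  from pure_rel[OF _ _ _ this] *
  show "pure K V W (x \<oplus>\<^bsub>V\<^esub> x') y = pure K V W x y \<oplus>\<^bsub>tensor K V W\<^esub> pure K V W x' y"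
    by (simp add: pure_eq tensor_def Q.coset_add e_closed)
next
  fix x y y' assume *: "x \<in> carrier V" "y \<in> carrier W" "y' \<in> carrier W"
  then have "e (x, y \<oplus>\<^bsub>W\<^esub> y') \<ominus>\<^bsub>F\<^esub> (e (x, y) \<oplus>\<^bsub>F\<^esub> e (x, y')) \<in> tensor_rels K V W"
    unfolding tensor_rels_def Let_def by blast
  from pure_rel[OF _ _ _ this] *
  show "pure K V W x (y \<oplus>\<^bsub>W\<^esub> y') = pure K V W x y \<oplus>\<^bsub>tensor K V W\<^esub> pure K V W x y'"
    by (simp add: pure_eq tensor_def Q.coset_add e_closed)
next
  fix a x y assume *: "a \<in> carrier K" "x \<in> carrier V" "y \<in> carrier W"
  then have "e (a \<odot>\<^bsub>V\<^esub> x, y) \<ominus>\<^bsub>F\<^esub> (a \<odot>\<^bsub>F\<^esub> e (x, y)) \<in> tensor_rels K V W"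
    and "e (x, a \<odot>\<^bsub>W\<^esub> y) \<ominus>\<^bsub>F\<^esub> (a \<odot>\<^bsub>F\<^esub> e (x, y)) \<in> tensor_rels K V W"
    unfolding tensor_rels_def Let_def by blast+
  from pure_rel[OF _ _ _ this(1)] pure_rel[OF _ _ _ this(2)] *
  show "pure K V W (a \<odot>\<^bsub>V\<^esub> x) y = a \<odot>\<^bsub>tensor K V W\<^esub> pure K V W x y"
    and "pure K V W x (a \<odot>\<^bsub>W\<^esub> y) = a \<odot>\<^bsub>tensor K V W\<^esub> pure K V W x y"
    by (simp_all add: pure_eq tensor_def Q.coset_smult e_closed)
qed

text \<open>There are no cases for zero and for scalar multiples: a scalar is absorbed into the left
  factor of a pure tensor, and zero is itself a pure tensor.\<close>

lemma tensor_induct [consumes 1, case_names pure add]: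
  assumes t: "t \<in> carrier (tensor K V W)"
    and pure: "\<And>x y. x \<in> carrier V \<Longrightarrow> y \<in> carrier W \<Longrightarrow> P (pure K V W x y)"
    and add: "\<And>s t. s \<in> carrier (tensor K V W) \<Longrightarrow> t \<in> carrier (tensor K V W) \<Longrightarrow>
      P s \<Longrightarrow> P t \<Longrightarrow> P (s \<oplus>\<^bsub>tensor K V W\<^esub> t)"
  shows "P t"
proof -
  have "P (tensor_ker K V W +>\<^bsub>F\<^esub> s)" if "s \<in> carrier F" for s
    using V.R.is_cring that
  proof (induction s rule: free_space_induct)
    case zero
    have "tensor_ker K V W +>\<^bsub>F\<^esub> \<zero>\<^bsub>F\<^esub> = pure K V W (\<zero>\<^bsub>K\<^esub> \<odot>\<^bsub>V\<^esub> \<zero>\<^bsub>V\<^esub>) \<zero>\<^bsub>W\<^esub>"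
      using bilinear_smult_left[OF bilinear_pure, of "\<zero>\<^bsub>K\<^esub>" "\<zero>\<^bsub>V\<^esub>" "\<zero>\<^bsub>W\<^esub>"]
      by (simp add: module.smult_l_null[OF tensor_module] pure_closed)
        (simp add: tensor_def Q.quotient_zero)
    then show ?case using pure by simp
  next
    case (gen a i)
    then obtain x y where "i = (x, y)" "x \<in> carrier V" "y \<in> carrier W" by auto
    then have "tensor_ker K V W +>\<^bsub>F\<^esub> (a \<odot>\<^bsub>F\<^esub> e i) = pure K V W (a \<odot>\<^bsub>V\<^esub> x) y"
      using gen bilinear_smult_left[OF bilinear_pure, of a x y]
      by (simp add: pure_eq tensor_def Q.coset_smult e_closed)
    then show ?case
      using gen pure \<open>x \<in> carrier V\<close> \<open>y \<in> carrier W\<close> by simp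
  next
    case (add s t)
    then show ?case
      using assms(3)[of "tensor_ker K V W +>\<^bsub>F\<^esub> s" "tensor_ker K V W +>\<^bsub>F\<^esub> t"]
      by (simp add: tensor_def Q.quotient_carrier Q.coset_add)
  qed
  then show ?thesis
    using t by (auto simp: tensor_def Q.quotient_carrier)
qed

lemma tensor_eqI:
  assumes f: "f \<in> lin K (tensor K V W) P" and g: "g \<in> lin K (tensor K V W) P"
    and "\<And>x y. x \<in> carrier V \<Longrightarrow> y \<in> carrier W \<Longrightarrow> f (pure K V W x y) = g (pure K V W x y)"
  shows "f = g"
proof (rule lin_eqI[OF f g])
  fix t assume "t \<in> carrier (tensor K V W)"
  then show "f t = g t"
    by (induction t rule: tensor_induct) (auto simp: assms(3) lin_add[OF f] lin_add[OF g])
qed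

lemma tensor_lift:
  assumes P: "module K P" and b: "bilinear K V W P b"
  shows "\<exists>h\<in>lin K (tensor K V W) P.
    \<forall>x\<in>carrier V. \<forall>y\<in>carrier W. h (pure K V W x y) = b x y"
proof -
  interpret P: module K P by (rule P)
  obtain f where f: "f \<in> lin K F P"
    and f_e: "\<And>x y. x \<in> carrier V \<Longrightarrow> y \<in> carrier W \<Longrightarrow> f (e (x, y)) = b x y"
    using free_space_lift[OF V.R.is_cring P, of "carrier V \<times> carrier W" "\<lambda>(x, y). b x y"]
      bilinear_closed[OF b] by auto
  have eq: "f (s \<ominus>\<^bsub>F\<^esub> t) = \<zero>\<^bsub>P\<^esub>" if "s \<in> carrier F" "t \<in> carrier F" "f s = f t" for s t
    using lin_minus_eq_zero_iff[OF f F.module_axioms P] that by simp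
  have "f r = \<zero>\<^bsub>P\<^esub>" if "r \<in> tensor_rels K V W" for r
    using that unfolding tensor_rels_def Let_def
    by (auto intro!: eq e_closed simp: lin_add[OF f] lin_smult[OF f] e_closed f_e
        bilinear_add_left[OF b] bilinear_add_right[OF b]
        bilinear_smult_left[OF b] bilinear_smult_right[OF b])
  then have "f r = \<zero>\<^bsub>P\<^esub>" if "r \<in> tensor_ker K V W" for r
    using span_of_kernel[OF F.module_axioms P f tensor_rels_closed] that
    by (auto simp: tensor_ker_def)
  from Q.quotient_lift[OF P f this] show ?thesis
    unfolding tensor_def pure_eq by (auto simp: f_e e_closed intro!: rev_bexI)
qed

end

section \<open>Maps between tensor products, and threefold tensor products\<close>

lemma bilinear_lin:
  assumes V: "module K V" and W: "module K W"
    and V': "module K V'" and W': "module K W'"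
    and f: "f \<in> lin K V V'" and g: "g \<in> lin K W W'" and b: "bilinear K V' W' P b"
  shows "bilinear K V W P (\<lambda>x y. b (f x) (g y))"
  by (rule bilinearI[OF V W])
    (simp_all add: lin_closed[OF f] lin_closed[OF g] lin_add[OF f] lin_add[OF g]
      lin_smult[OF f] lin_smult[OF g] bilinear_closed[OF V' W' b]
      bilinear_add_left[OF V' W' b] bilinear_add_right[OF V' W' b]
      bilinear_smult_left[OF V' W' b] bilinear_smult_right[OF V' W' b])

text \<open>This justifies the definite description: the universal property provides a map with the
  required values, and there is only one because pure tensors generate.\<close>

lemma tensor_map:
  assumes V: "module K V" and W: "module K W"
    and V': "module K V'" and W': "module K W'"
    and f: "f \<in> lin K V V'" and g: "g \<in> lin K W W'"
  shows tensor_map_lin: "tensor_map K V W V' W' f g \<in> lin K (tensor K V W) (tensor K V' W')"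
    and tensor_map_pure: "x \<in> carrier V \<Longrightarrow> y \<in> carrier W \<Longrightarrow>
      tensor_map K V W V' W' f g (pure K V W x y) = pure K V' W' (f x) (g y)"
proof -
  have "\<exists>!h. h \<in> lin K (tensor K V W) (tensor K V' W') \<and>
       (\<forall>x\<in>carrier V. \<forall>y\<in>carrier W. h (pure K V W x y) = pure K V' W' (f x) (g y))"
    using tensor_lift[OF V W tensor_module[OF V' W']
        bilinear_lin[OF V W V' W' f g bilinear_pure[OF V' W']]]
    by (auto intro: tensor_eqI[OF V W])
  from theI'[OF this]
  show "tensor_map K V W V' W' f g \<in> lin K (tensor K V W) (tensor K V' W')"
    and "x \<in> carrier V \<Longrightarrow> y \<in> carrier W \<Longrightarrow>
      tensor_map K V W V' W' f g (pure K V W x y) = pure K V' W' (f x) (g y)"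
    by (auto simp: tensor_map_def)
qed

lemma pure_zero:
  assumes V: "module K V" and W: "module K W"
  shows "y \<in> carrier W \<Longrightarrow> pure K V W \<zero>\<^bsub>V\<^esub> y = \<zero>\<^bsub>tensor K V W\<^esub>"
    and "x \<in> carrier V \<Longrightarrow> pure K V W x \<zero>\<^bsub>W\<^esub> = \<zero>\<^bsub>tensor K V W\<^esub>"
proof -
  interpret V: module K V by (rule V)
  interpret W: module K W by (rule W)
  note b = bilinear_pure[OF V W, unfolded bilinear_def]
  show "y \<in> carrier W \<Longrightarrow> pure K V W \<zero>\<^bsub>V\<^esub> y = \<zero>\<^bsub>tensor K V W\<^esub>"
    using lin_zero[OF b[THEN conjunct1, rule_format] V tensor_module[OF V W]] by simp
  show "x \<in> carrier V \<Longrightarrow> pure K V W x \<zero>\<^bsub>W\<^esub> = \<zero>\<^bsub>tensor K V W\<^esub>"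
    using lin_zero[OF b[THEN conjunct2, rule_format] W tensor_module[OF V W]] by simp
qed

text \<open>Currying: for fixed \<open>u\<close> the first two variables are lifted to a map
  \<open>k u\<close> on their tensor product. Uniqueness on pure tensors shows that
  \<open>k u\<close> depends linearly on \<open>u\<close>, and a second lift takes care of the last
  variable. The bracketing is that of the integrand of the coend.\<close>

lemma tensor3_lift:
  assumes V: "module K V" and W: "module K W" and U: "module K U" and P: "module K P"
    and xy: "\<And>u. u \<in> carrier U \<Longrightarrow> bilinear K V W P (\<lambda>x y. b x y u)"
    and u: "\<And>x y. x \<in> carrier V \<Longrightarrow> y \<in> carrier W \<Longrightarrow> (\<lambda>u\<in>carrier U. b x y u) \<in> lin K U P"
  shows "\<exists>g\<in>lin K (tensor K (tensor K V W) U) P.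
    \<forall>x\<in>carrier V. \<forall>y\<in>carrier W. \<forall>u\<in>carrier U. g (pure K (tensor K V W) U (pure K V W x y) u) = b x y u"
proof -
  note VW = tensor_module[OF V W]
  interpret U: module K U by (rule U)
  interpret H: module K "homs K (tensor K V W) P" by (rule homs_module[OF VW P])
  have "\<forall>u\<in>carrier U. \<exists>k. k \<in> lin K (tensor K V W) P \<and>
      (\<forall>x\<in>carrier V. \<forall>y\<in>carrier W. k (pure K V W x y) = b x y u)"
  proof
    fix u assume "u \<in> carrier U"
    from tensor_lift[OF V W P xy[OF this]]
    show "\<exists>k. k \<in> lin K (tensor K V W) P \<and>
      (\<forall>x\<in>carrier V. \<forall>y\<in>carrier W. k (pure K V W x y) = b x y u)" by blast
  qed
  from bchoice[OF this] obtain k where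
    "\<forall>u\<in>carrier U. k u \<in> lin K (tensor K V W) P \<and>
      (\<forall>x\<in>carrier V. \<forall>y\<in>carrier W. k u (pure K V W x y) = b x y u)" ..
  then have k: "\<And>u. u \<in> carrier U \<Longrightarrow> k u \<in> lin K (tensor K V W) P"
    and k_pure: "\<And>u x y. u \<in> carrier U \<Longrightarrow> x \<in> carrier V \<Longrightarrow> y \<in> carrier W \<Longrightarrow>
      k u (pure K V W x y) = b x y u" by auto
  have add: "k (u \<oplus>\<^bsub>U\<^esub> u') = k u \<oplus>\<^bsub>homs K (tensor K V W) P\<^esub> k u'"
    if "u \<in> carrier U" "u' \<in> carrier U" for u u'
  proof (rule tensor_eqI[OF V W, where P = P])
    show "k u \<oplus>\<^bsub>homs K (tensor K V W) P\<^esub> k u' \<in> lin K (tensor K V W) P"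
      using H.a_closed k that by simp
    fix x y assume xy: "x \<in> carrier V" "y \<in> carrier W"
    show "k (u \<oplus>\<^bsub>U\<^esub> u') (pure K V W x y) =
        (k u \<oplus>\<^bsub>homs K (tensor K V W) P\<^esub> k u') (pure K V W x y)"
      using that xy lin_add[OF u[OF xy] that] by (simp add: k_pure pure_closed[OF V W])
  qed (use k that in auto)
  have smult: "k (a \<odot>\<^bsub>U\<^esub> u) = a \<odot>\<^bsub>homs K (tensor K V W) P\<^esub> k u"
    if "a \<in> carrier K" "u \<in> carrier U" for a u
  proof (rule tensor_eqI[OF V W, where P = P])
    show "a \<odot>\<^bsub>homs K (tensor K V W) P\<^esub> k u \<in> lin K (tensor K V W) P"
      using H.smult_closed k that by simp
    fix x y assume xy: "x \<in> carrier V" "y \<in> carrier W"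
    show "k (a \<odot>\<^bsub>U\<^esub> u) (pure K V W x y) =
        (a \<odot>\<^bsub>homs K (tensor K V W) P\<^esub> k u) (pure K V W x y)"
      using that xy lin_smult[OF u[OF xy] that] by (simp add: k_pure pure_closed[OF V W])
  qed (use k that in auto)
  have "bilinear K (tensor K V W) U P (\<lambda>t u. k u t)"
    by (rule bilinearI[OF VW U]) (simp_all add: lin_closed[OF k] lin_add[OF k] lin_smult[OF k] add smult)
  from tensor_lift[OF VW U P this] show ?thesis
    by (auto simp: k_pure pure_closed[OF V W] intro!: rev_bexI)
qed

text \<open>Two inductions are nested: additivity in the left factor reduces an arbitrary left
  factor to a pure tensor, after which the outer induction treats sums.\<close>

lemma tensor3_induct [consumes 4, case_names pure add]:
  assumes V: "module K V" and W: "module K W" and U: "module K U"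
    and t: "t \<in> carrier (tensor K (tensor K V W) U)"
    and pure: "\<And>x y u. x \<in> carrier V \<Longrightarrow> y \<in> carrier W \<Longrightarrow> u \<in> carrier U \<Longrightarrow>
      P (pure K (tensor K V W) U (pure K V W x y) u)"
    and add: "\<And>s t. s \<in> carrier (tensor K (tensor K V W) U) \<Longrightarrow> t \<in> carrier (tensor K (tensor K V W) U) \<Longrightarrow>
      P s \<Longrightarrow> P t \<Longrightarrow> P (s \<oplus>\<^bsub>tensor K (tensor K V W) U\<^esub> t)"
  shows "P t"
proof -
  note VW = tensor_module[OF V W]
  have "P (pure K (tensor K V W) U s u)" if s: "s \<in> carrier (tensor K V W)" and u: "u \<in> carrier U" for s u
  proof (rule tensor_induct[OF V W s])
    show "P (pure K (tensor K V W) U (pure K V W x y) u)"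
      if "x \<in> carrier V" "y \<in> carrier W" for x y
      using pure[OF that u] .
    show "P (pure K (tensor K V W) U (s \<oplus>\<^bsub>tensor K V W\<^esub> t) u)"
      if "s \<in> carrier (tensor K V W)" "t \<in> carrier (tensor K V W)"
        "P (pure K (tensor K V W) U s u)" "P (pure K (tensor K V W) U t u)" for s t
      using add[OF pure_closed[OF VW U that(1) u] pure_closed[OF VW U that(2) u] that(3,4)]
        bilinear_add_left[OF VW U bilinear_pure[OF VW U] that(1,2) u] by simp
  qed
  then show ?thesis
    using add by (rule tensor_induct[OF VW U t])
qed

section \<open>Small sets\<close>

context grothendieck_universe
begin

text \<open>By the power set axiom every subset of a member of the universe is a member, so an
  injection into a small set is enough.\<close>

lemma small_lepoll:
  assumes "A \<lesssim> B" "small elts B"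
  shows "small elts A"
proof -
  obtain u where "B \<approx> elts u" using assms(2) by (auto simp: small_def)
  then have "A \<lesssim> elts u" using assms(1) lepoll_trans1 lepoll_trans2 by blast
  then obtain f where f: "inj_on f A" "f ` A \<subseteq> elts u" by (auto simp: lepoll_def)
  obtain p where "elts ` elts p = Pow (elts u)" using power_set by blast
  then have "f ` A \<in> elts ` elts p" using f by auto
  then obtain v where "f ` A = elts v" by auto
  then have "A \<approx> elts v" using f(1) inj_on_image_eqpoll_self eqpoll_sym by metis
  then show ?thesis by (auto simp: small_def)
qed

lemma small_subset: "A \<subseteq> B \<Longrightarrow> small elts B \<Longrightarrow> small elts A"
  by (rule small_lepoll[OF subset_imp_lepoll])

lemma small_image: "small elts A \<Longrightarrow> small elts (f ` A)"
  by (rule small_lepoll[OF image_lepoll])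

lemma small_elts: "small elts (elts u)"
  by (auto simp: small_def)

lemma small_Pow:
  assumes "small elts A"
  shows "small elts (Pow A)"
proof -
  obtain u f where f: "bij_betw f A (elts u)"
    using assms by (auto simp: small_def eqpoll_def)
  obtain p where p: "elts ` elts p = Pow (elts u)" using power_set by blast
  then have "small elts (Pow (elts u))"
    using small_image[OF small_elts, of elts p] by simp
  moreover have "Pow A \<approx> Pow (elts u)"
    unfolding eqpoll_def using bij_betw_Pow[OF f] by (rule exI[of _ "image f"])
  then have "Pow A \<lesssim> Pow (elts u)" by (rule eqpoll_imp_lepoll)
  ultimately show ?thesis by (rule small_lepoll[rotated])
qed

lemma small_UN_elts: "small elts (\<Union>i\<in>elts u. elts (f i))"
  using indexed_union[where I = u and f = f] small_elts by metis

text \<open>Kuratowski pairs \<open>op\<close>, formed with the pairing axiom, embed the product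
  into a double indexed union of singletons, which is a member of the universe.\<close>

lemma small_Times:
  assumes "small elts A" "small elts B"
  shows "small elts (A \<times> B)"
proof -
  obtain u f where f: "bij_betw f A (elts u)"
    using assms(1) by (auto simp: small_def eqpoll_def)
  obtain v g where g: "bij_betw g B (elts v)"
    using assms(2) by (auto simp: small_def eqpoll_def)
  obtain pr where pr: "\<And>x y. elts (pr x y) = {x, y}"
    using pairing by metis
  have pr_eq: "pr x y = pr x' y' \<longleftrightarrow> {x, y} = {x', y'}" for x y x' y'
    using inj_eq[OF extensionality, of "pr x y" "pr x' y'"] by (simp add: pr)
  define op where "op x y = pr (pr x x) (pr x y)" for x y
  have op_eq: "op x y = op x' y' \<longleftrightarrow> x = x' \<and> y = y'" for x y x' y'
    unfolding op_def pr_eq by (auto simp: doubleton_eq_iff pr_eq)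
  have "\<exists>w. elts w = (\<Union>y\<in>elts v. elts (pr (op x y) (op x y)))" for x
    by (rule indexed_union)
  then obtain w where w: "\<And>x. elts (w x) = (\<Union>y\<in>elts v. elts (pr (op x y) (op x y)))"
    by metis
  have sub: "(\<lambda>(a, b). op (f a) (g b)) ` (A \<times> B) \<subseteq> (\<Union>x\<in>elts u. elts (w x))"
    using f g by (auto simp: w pr dest: bij_betwE)
  have "inj_on (\<lambda>(a, b). op (f a) (g b)) (A \<times> B)"
    using f g by (auto simp: inj_on_def op_eq bij_betw_def)
  with sub have "A \<times> B \<lesssim> (\<Union>x\<in>elts u. elts (w x))"
    by (auto simp: lepoll_def)
  then show ?thesis using small_UN_elts by (rule small_lepoll)
qed

text \<open>An extensional function is determined by its graph, a subset of a small product.\<close>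

lemma small_PiE:
  assumes "small elts A" "small elts B"
  shows "small elts (A \<rightarrow>\<^sub>E B)"
proof -
  have "inj_on (\<lambda>f. (\<lambda>a. (a, f a)) ` A) (A \<rightarrow>\<^sub>E B)"
  proof (rule inj_onI)
    fix f g assume *: "f \<in> A \<rightarrow>\<^sub>E B" "g \<in> A \<rightarrow>\<^sub>E B" "(\<lambda>a. (a, f a)) ` A = (\<lambda>a. (a, g a)) ` A"
    have "f a = g a" if "a \<in> A" for a
    proof -
      have "(a, f a) \<in> (\<lambda>a. (a, g a)) ` A" using that unfolding *(3)[symmetric] by (rule imageI)
      then show ?thesis by auto
    qed
    with * show "f = g" by (intro PiE_ext) auto
  qed
  moreover have "(\<lambda>f. (\<lambda>a. (a, f a)) ` A) ` (A \<rightarrow>\<^sub>E B) \<subseteq> Pow (A \<times> B)" by auto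
  ultimately have "(A \<rightarrow>\<^sub>E B) \<lesssim> Pow (A \<times> B)" unfolding lepoll_def by blast
  then show ?thesis using small_Pow[OF small_Times[OF assms]] by (rule small_lepoll)
qed

lemma small_lin:
  assumes "small elts (carrier V)" "small elts (carrier W)"
  shows "small elts (lin K V W)"
  by (rule small_subset[OF _ small_PiE[OF assms]]) (auto simp: lin_def)

end

section \<open>Bases\<close>

text \<open>The free space on \<open>A\<close> has carrier type \<open>'i \<Rightarrow> 'k\<close>,
  whereas objects of Vect have carrier type \<open>'u\<close>. A basis is therefore encoded as an
  isomorphism from the free space, which lets any isomorphic copy \<open>H\<close> play its
  part.\<close>

definition basis :: "'k ring \<Rightarrow> 'i set \<Rightarrow> ('k, 'a) module \<Rightarrow> ('i \<Rightarrow> 'a) \<Rightarrow> bool" where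
  "basis K A H e \<longleftrightarrow> cring K \<and> module K H \<and>
     (\<exists>\<beta>\<in>lin K (free_space K A) H. bij_betw \<beta> (carrier (free_space K A)) (carrier H) \<and>
       (\<forall>a\<in>A. \<beta> (free_gen K A a) = e a))"

lemma basis_module: "basis K A H e \<Longrightarrow> module K H"
  by (simp add: basis_def)

lemma basis_closed: "basis K A H e \<Longrightarrow> a \<in> A \<Longrightarrow> e a \<in> carrier H"
  unfolding basis_def using lin_closed free_gen_closed by metis

lemma basis_lift:
  assumes b: "basis K A H e" and P: "module K P" and u: "\<And>a. a \<in> A \<Longrightarrow> u a \<in> carrier P"
  shows "\<exists>f\<in>lin K H P. \<forall>a\<in>A. f (e a) = u a"
proof -
  let ?F = "free_space K A"
  obtain \<beta> where K: "cring K" and H: "module K H" and \<beta>: "\<beta> \<in> lin K ?F H"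
    and bij: "bij_betw \<beta> (carrier ?F) (carrier H)"
    and \<beta>_gen: "\<And>a. a \<in> A \<Longrightarrow> \<beta> (free_gen K A a) = e a"
    using b by (auto simp: basis_def)
  note F = free_space_module[OF K, of A]
  obtain g where g: "g \<in> lin K ?F P" and g_gen: "\<And>a. a \<in> A \<Longrightarrow> g (free_gen K A a) = u a"
    using free_space_lift[where u = u and S = A, OF K P u] by blast
  let ?i = "\<lambda>y\<in>carrier H. inv_into (carrier ?F) \<beta> y"
  have "?i (e a) = free_gen K A a" if "a \<in> A" for a
    using bij free_gen_closed[OF K that] basis_closed[OF b that] \<beta>_gen[OF that]
      inv_into_f_f[of \<beta> "carrier ?F" "free_gen K A a"]
    by (simp add: bij_betw_def)
  then have "\<forall>a\<in>A. compose (carrier H) g ?i (e a) = u a"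
    using basis_closed[OF b] g_gen by (simp add: compose_eq)
  then show ?thesis
    using lin_compose[OF lin_inverse[OF \<beta> F H bij] g H] by blast
qed

lemma basis_eqI:
  assumes b: "basis K A H e" and P: "module K P"
    and f: "f \<in> lin K H P" and g: "g \<in> lin K H P" and eq: "\<And>a. a \<in> A \<Longrightarrow> f (e a) = g (e a)"
  shows "f = g"
proof -
  let ?F = "free_space K A"
  obtain \<beta> where K: "cring K" and H: "module K H" and \<beta>: "\<beta> \<in> lin K ?F H"
    and bij: "bij_betw \<beta> (carrier ?F) (carrier H)"
    and \<beta>_gen: "\<And>a. a \<in> A \<Longrightarrow> \<beta> (free_gen K A a) = e a"
    using b by (auto simp: basis_def)
  note F = free_space_module[OF K, of A]
  have *: "compose (carrier ?F) f \<beta> = compose (carrier ?F) g \<beta>"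
    using lin_compose[OF \<beta> f F] lin_compose[OF \<beta> g F]
    by (rule free_space_eqI[OF K P]) (simp add: compose_eq free_gen_closed[OF K] \<beta>_gen eq)
  show ?thesis
  proof (rule lin_eqI[OF f g])
    fix y assume "y \<in> carrier H"
    then obtain x where "x \<in> carrier ?F" "y = \<beta> x" using bij by (auto simp: bij_betw_def)
    then show "f y = g y" using fun_cong[OF *, of x] by (simp add: compose_eq)
  qed
qed

text \<open>\<open>basis_lift\<close> is used twice, the second time with values in the space
  \<open>homs K H' P\<close>, and the result is a bilinear map. Together with
  \<open>basis_tensor_eqI\<close> this gives pairs of basis vectors the universal property of a
  basis of the tensor product, without an isomorphism from a free space.\<close>

lemma basis_tensor_lift:
  assumes b: "basis K A H e" and b': "basis K B H' e'" and P: "module K P"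
    and u: "\<And>a b. a \<in> A \<Longrightarrow> b \<in> B \<Longrightarrow> u a b \<in> carrier P"
  shows "\<exists>h\<in>lin K (tensor K H H') P. \<forall>a\<in>A. \<forall>b\<in>B. h (pure K H H' (e a) (e' b)) = u a b"
proof -
  note H = basis_module[OF b] and H' = basis_module[OF b']
  interpret H: module K H by (rule H)
  interpret H': module K H' by (rule H')
  interpret P: module K P by (rule P)
  have "\<forall>a\<in>A. \<exists>f\<in>lin K H' P. \<forall>b\<in>B. f (e' b) = u a b"
    using basis_lift[OF b' P] u by simp
  then obtain f where f: "\<And>a. a \<in> A \<Longrightarrow> f a \<in> lin K H' P"
    and f_e: "\<And>a b. a \<in> A \<Longrightarrow> b \<in> B \<Longrightarrow> f a (e' b) = u a b"
    by metis
  obtain m where m: "m \<in> lin K H (homs K H' P)" and m_e: "\<And>a. a \<in> A \<Longrightarrow> m (e a) = f a"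
    using basis_lift[OF b homs_module[OF H' P], of f] f by auto
  have m_lin: "m x \<in> lin K H' P" if "x \<in> carrier H" for x
    using lin_closed[OF m that] by simp
  have "bilinear K H H' P (\<lambda>x y. m x y)"
    by (rule bilinearI[OF H H'])
      (simp_all add: lin_closed[OF m_lin] lin_add[OF m_lin] lin_smult[OF m_lin]
        lin_add[OF m] lin_smult[OF m])
  from tensor_lift[OF H H' P this] show ?thesis
    using basis_closed[OF b] basis_closed[OF b'] by (auto simp: m_e f_e intro!: rev_bexI)
qed

text \<open>The two maps are compared one variable at a time: with a basis vector on the left first
  for all right factors, then for all left factors.\<close>

lemma basis_tensor_eqI:
  assumes b: "basis K A H e" and b': "basis K B H' e'" and P: "module K P"
    and f: "f \<in> lin K (tensor K H H') P" and g: "g \<in> lin K (tensor K H H') P"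
    and eq: "\<And>a b. a \<in> A \<Longrightarrow> b \<in> B \<Longrightarrow>
      f (pure K H H' (e a) (e' b)) = g (pure K H H' (e a) (e' b))"
  shows "f = g"
proof -
  note H = basis_module[OF b] and H' = basis_module[OF b']
  note pure = bilinear_pure[OF H H'] pure_closed[OF H H']
  have right: "(\<lambda>y\<in>carrier H'. k (pure K H H' x y)) \<in> lin K H' P"
    if k: "k \<in> lin K (tensor K H H') P" and x: "x \<in> carrier H" for k x
    using lin_compose[OF _ k H', of "\<lambda>y\<in>carrier H'. pure K H H' x y"] bilinear_pure[OF H H'] x
    by (simp add: bilinear_def compose_def cong: restrict_cong)
  have left: "(\<lambda>x\<in>carrier H. k (pure K H H' x y)) \<in> lin K H P"
    if k: "k \<in> lin K (tensor K H H') P" and y: "y \<in> carrier H'" for k y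
    using lin_compose[OF _ k H, of "\<lambda>x\<in>carrier H. pure K H H' x y"] bilinear_pure[OF H H'] y
    by (simp add: bilinear_def compose_def cong: restrict_cong)
  have eq1: "f (pure K H H' (e a) y) = g (pure K H H' (e a) y)" if "a \<in> A" "y \<in> carrier H'" for a y
  proof -
    have "(\<lambda>y\<in>carrier H'. f (pure K H H' (e a) y)) = (\<lambda>y\<in>carrier H'. g (pure K H H' (e a) y))"
      using right[OF f basis_closed[OF b \<open>a \<in> A\<close>]] right[OF g basis_closed[OF b \<open>a \<in> A\<close>]]
      by (rule basis_eqI[OF b' P]) (simp add: eq that basis_closed[OF b'])
    from fun_cong[OF this, of y] show ?thesis using that(2) by simp
  qed
  show ?thesis
  proof (rule tensor_eqI[OF H H' f g])
    fix x y assume x: "x \<in> carrier H" and y: "y \<in> carrier H'"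
    have "(\<lambda>x\<in>carrier H. f (pure K H H' x y)) = (\<lambda>x\<in>carrier H. g (pure K H H' x y))"
      using left[OF f y] left[OF g y]
      by (rule basis_eqI[OF b P]) (simp add: eq1 y basis_closed[OF b])
    from fun_cong[OF this, of x] show "f (pure K H H' x y) = g (pure K H H' x y)"
      using x by simp
  qed
qed

section \<open>Copies of spaces on another carrier type\<close>

definition transport :: "('a \<Rightarrow> 'b) \<Rightarrow> ('k, 'a) module \<Rightarrow> ('k, 'b) module" where
  "transport f V = mk_space (f ` carrier V) (f \<zero>\<^bsub>V\<^esub>)
     (\<lambda>x y. f (inv_into (carrier V) f x \<oplus>\<^bsub>V\<^esub> inv_into (carrier V) f y))
     (\<lambda>a x. f (a \<odot>\<^bsub>V\<^esub> inv_into (carrier V) f x))"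

lemma transport_module:
  assumes V: "module K V" and f: "inj_on f (carrier V)"
  shows "module K (transport f V)"
proof -
  have inv: "inv_into (carrier V) f (f x) = x" if "x \<in> carrier V" for x
    using f that by (rule inv_into_f_f)
  show ?thesis
    unfolding transport_def by (rule module_image[OF V, where \<pi> = f]) (simp_all add: inv)
qed

lemma transport_lin:
  assumes V: "module K V" and f: "inj_on f (carrier V)"
  shows "(\<lambda>x\<in>carrier V. f x) \<in> lin K V (transport f V)"
proof -
  have inv: "inv_into (carrier V) f (f x) = x" if "x \<in> carrier V" for x
    using f that by (rule inv_into_f_f)
  show ?thesis
    by (rule lin_restrictI[OF V]) (simp_all add: transport_def inv)
qed

text \<open>The free space consists of extensional functions from \<open>A\<close> to the scalars,
  so its carrier is small and in bijection with some \<open>elts u\<close>; along this bijection it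
  is transported to the type \<open>'u\<close>.\<close>

lemma (in grothendieck_universe) small_basis:
  assumes K: "cring K" and sK: "small elts (carrier K)" and sA: "small elts A"
  shows "\<exists>(H :: ('k, 'u) module) e. vect elts K H \<and> basis K A H e"
proof -
  let ?F = "free_space K A"
  note F = free_space_module[OF K, of A]
  have "small elts (carrier ?F)"
    by (rule small_subset[OF _ small_PiE[OF sA sK]]) (auto simp: free_space_def)
  then obtain u f where f: "bij_betw f (carrier ?F) (elts u)"
    by (auto simp: small_def eqpoll_def)
  then have inj: "inj_on f (carrier ?F)" by (simp add: bij_betw_def)
  have c: "carrier (transport f ?F) = elts u"
    using f by (simp add: transport_def bij_betw_def)
  have "vect elts K (transport f ?F)"
    using transport_module[OF F inj] small_elts by (simp add: vect_def c)
  moreover have "bij_betw (\<lambda>x\<in>carrier ?F. f x) (carrier ?F) (elts u)"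
    using f by (simp add: bij_betw_def)
  then have "basis K A (transport f ?F) (\<lambda>a. f (free_gen K A a))"
    unfolding basis_def c using K transport_module[OF F inj]
    by (intro conjI bexI[OF _ transport_lin[OF F inj]]) (simp_all add: free_gen_closed[OF K])
  ultimately show ?thesis by blast
qed

section \<open>Linear functors\<close>

lemma vect_module: "vect elts K V \<Longrightarrow> module K V"
  by (simp add: vect_def)

text \<open>The definition asks for equalities of extensional functions, including one between maps
  of hom spaces. Here they are reduced to equations between values.\<close>

lemma linear_functorI:
  fixes X :: "('k, 'u, 'a) vfunctor"
  assumes vect: "\<And>V. vect elts K V \<Longrightarrow> vect elts K (fobj X V)"
    and lin: "\<And>V W f. vect elts K V \<Longrightarrow> vect elts K W \<Longrightarrow> f \<in> lin K V W \<Longrightarrow>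
      fmap X V W f \<in> lin K (fobj X V) (fobj X W)"
    and add: "\<And>V W f g x. vect elts K V \<Longrightarrow> vect elts K W \<Longrightarrow> f \<in> lin K V W \<Longrightarrow> g \<in> lin K V W \<Longrightarrow>
      x \<in> carrier (fobj X V) \<Longrightarrow>
      fmap X V W (\<lambda>v\<in>carrier V. f v \<oplus>\<^bsub>W\<^esub> g v) x = fmap X V W f x \<oplus>\<^bsub>fobj X W\<^esub> fmap X V W g x"
    and smult: "\<And>V W a f x. vect elts K V \<Longrightarrow> vect elts K W \<Longrightarrow> a \<in> carrier K \<Longrightarrow> f \<in> lin K V W \<Longrightarrow>
      x \<in> carrier (fobj X V) \<Longrightarrow>
      fmap X V W (\<lambda>v\<in>carrier V. a \<odot>\<^bsub>W\<^esub> f v) x = a \<odot>\<^bsub>fobj X W\<^esub> fmap X V W f x"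
    and id: "\<And>V x. vect elts K V \<Longrightarrow> x \<in> carrier (fobj X V) \<Longrightarrow>
      fmap X V V (\<lambda>v\<in>carrier V. v) x = x"
    and comp: "\<And>U V W f g x. vect elts K U \<Longrightarrow> vect elts K V \<Longrightarrow> vect elts K W \<Longrightarrow>
      f \<in> lin K U V \<Longrightarrow> g \<in> lin K V W \<Longrightarrow> x \<in> carrier (fobj X U) \<Longrightarrow>
      fmap X U W (compose (carrier U) g f) x = fmap X V W g (fmap X U V f x)"
  shows "linear_functor elts K X"
  unfolding linear_functor_def
proof (intro conjI allI impI)
  fix V W :: "('k, 'u) module" assume V: "vect elts K V" and W: "vect elts K W"
  note hom = homs_module[OF vect_module[OF V] vect_module[OF W]]
  show "(\<lambda>f\<in>lin K V W. fmap X V W f) \<in> lin K (homs K V W) (homs K (fobj X V) (fobj X W))"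
  proof (rule lin_restrictI[of K "homs K V W" _ "homs K (fobj X V) (fobj X W)",
        unfolded homs_simps, OF hom])
    fix f g assume "f \<in> lin K V W" and "g \<in> lin K V W"
    note f = this(1) and g = this(2)
    then have "(\<lambda>x\<in>carrier V. f x \<oplus>\<^bsub>W\<^esub> g x) \<in> lin K V W"
      using abelian_monoid.a_closed[OF abelian_group.axioms(1)[OF module.axioms(2)[OF hom]]] by simp
    from lin[OF V W this]
    show "fmap X V W (\<lambda>x\<in>carrier V. f x \<oplus>\<^bsub>W\<^esub> g x) =
        (\<lambda>x\<in>carrier (fobj X V). fmap X V W f x \<oplus>\<^bsub>fobj X W\<^esub> fmap X V W g x)"
      using add[OF V W f g] by (intro extensionalityI[of _ "carrier (fobj X V)"])
        (auto intro: lin_extensional)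
  next
    fix a f assume a: "a \<in> carrier K" and f: "f \<in> lin K V W"
    then have "(\<lambda>x\<in>carrier V. a \<odot>\<^bsub>W\<^esub> f x) \<in> lin K V W"
      using module.smult_closed[OF hom] by simp
    from lin[OF V W this]
    show "fmap X V W (\<lambda>x\<in>carrier V. a \<odot>\<^bsub>W\<^esub> f x) =
        (\<lambda>x\<in>carrier (fobj X V). a \<odot>\<^bsub>fobj X W\<^esub> fmap X V W f x)"
      using smult[OF V W a f] by (intro extensionalityI[of _ "carrier (fobj X V)"])
        (auto intro: lin_extensional)
  qed (use lin V W in auto)
next
  fix V :: "('k, 'u) module" assume V: "vect elts K V"
  have "fmap X V V (\<lambda>x\<in>carrier V. x) \<in> lin K (fobj X V) (fobj X V)"
    using V by (intro lin lin_id) (auto simp: vect_def)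
  then show "fmap X V V (\<lambda>x\<in>carrier V. x) = (\<lambda>x\<in>carrier (fobj X V). x)"
    using id[OF V] by (intro extensionalityI[of _ "carrier (fobj X V)"])
        (auto intro: lin_extensional)
next
  fix U V W :: "('k, 'u) module" and f g
  assume *: "vect elts K U" "vect elts K V" "vect elts K W" "f \<in> lin K U V" "g \<in> lin K V W"
  then have "fmap X U W (compose (carrier U) g f) \<in> lin K (fobj X U) (fobj X W)"
    by (intro lin lin_compose) (auto simp: vect_def)
  then show "fmap X U W (compose (carrier U) g f) =
      compose (carrier (fobj X U)) (fmap X V W g) (fmap X U V f)"
    using comp[OF *] by (intro extensionalityI[of _ "carrier (fobj X U)"])
        (auto intro: lin_extensional simp: compose_eq)
qed (rule vect)

lemma linear_functor_vect: "linear_functor elts K X \<Longrightarrow> vect elts K V \<Longrightarrow> vect elts K (fobj X V)"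
  by (simp add: linear_functor_def)

lemma linear_functor_module: "linear_functor elts K X \<Longrightarrow> vect elts K V \<Longrightarrow> module K (fobj X V)"
  using linear_functor_vect by (auto simp: vect_def)

lemma linear_functor_lin:
  assumes "linear_functor elts K X" "vect elts K V" "vect elts K W" "f \<in> lin K V W"
  shows "fmap X V W f \<in> lin K (fobj X V) (fobj X W)"
proof -
  have "(\<lambda>f\<in>lin K V W. fmap X V W f) \<in> lin K (homs K V W) (homs K (fobj X V) (fobj X W))"
    using assms by (simp add: linear_functor_def)
  from lin_closed[OF this, of f] show ?thesis using assms(4) by simp
qed

lemma linear_functor_add:
  assumes X: "linear_functor elts K X" and V: "vect elts K V" and W: "vect elts K W"
    and f: "f \<in> lin K V W" and g: "g \<in> lin K V W" and x: "x \<in> carrier (fobj X V)"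
  shows "fmap X V W (\<lambda>v\<in>carrier V. f v \<oplus>\<^bsub>W\<^esub> g v) x =
    fmap X V W f x \<oplus>\<^bsub>fobj X W\<^esub> fmap X V W g x"
proof -
  interpret H: module K "homs K V W" by (rule homs_module[OF vect_module[OF V] vect_module[OF W]])
  have "(\<lambda>f\<in>lin K V W. fmap X V W f) \<in> lin K (homs K V W) (homs K (fobj X V) (fobj X W))"
    using X V W by (simp add: linear_functor_def)
  from lin_add[OF this, of f g] show ?thesis
    using f g x H.a_closed[of f g] by simp
qed

lemma linear_functor_smult:
  assumes X: "linear_functor elts K X" and V: "vect elts K V" and W: "vect elts K W"
    and a: "a \<in> carrier K" and f: "f \<in> lin K V W" and x: "x \<in> carrier (fobj X V)"
  shows "fmap X V W (\<lambda>v\<in>carrier V. a \<odot>\<^bsub>W\<^esub> f v) x = a \<odot>\<^bsub>fobj X W\<^esub> fmap X V W f x"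
proof -
  interpret H: module K "homs K V W" by (rule homs_module[OF vect_module[OF V] vect_module[OF W]])
  have "(\<lambda>f\<in>lin K V W. fmap X V W f) \<in> lin K (homs K V W) (homs K (fobj X V) (fobj X W))"
    using X V W by (simp add: linear_functor_def)
  from lin_smult[OF this a, of f] show ?thesis
    using a f x H.smult_closed[of a f] by simp
qed

lemma linear_functor_id:
  assumes "linear_functor elts K X" "vect elts K V" "x \<in> carrier (fobj X V)"
  shows "fmap X V V (\<lambda>v\<in>carrier V. v) x = x"
proof -
  have "fmap X V V (\<lambda>v\<in>carrier V. v) = (\<lambda>x\<in>carrier (fobj X V). x)"
    using assms(1,2) by (simp add: linear_functor_def)
  then show ?thesis using assms(3) by simp
qed

lemma linear_functor_compose:
  assumes "linear_functor elts K X" "vect elts K U" "vect elts K V" "vect elts K W"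
    and "f \<in> lin K U V" "g \<in> lin K V W" "x \<in> carrier (fobj X U)"
  shows "fmap X U W (compose (carrier U) g f) x = fmap X V W g (fmap X U V f x)"
proof -
  have "fmap X U W (compose (carrier U) g f) =
      compose (carrier (fobj X U)) (fmap X V W g) (fmap X U V f)"
    using assms(1-6) by (simp add: linear_functor_def)
  then show ?thesis using assms(7) by (simp add: compose_eq)
qed

lemma nat_transI:
  assumes "\<And>V. vect elts K V \<Longrightarrow> \<phi> V \<in> lin K (fobj X V) (fobj Y V)"
    and "\<And>V W f x. vect elts K V \<Longrightarrow> vect elts K W \<Longrightarrow> f \<in> lin K V W \<Longrightarrow>
      x \<in> carrier (fobj X V) \<Longrightarrow> \<phi> W (fmap X V W f x) = fmap Y V W f (\<phi> V x)"
  shows "nat_trans elts K X Y \<phi>"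
  using assms by (simp add: nat_trans_def)

lemma nat_trans_lin: "nat_trans elts K X Y \<phi> \<Longrightarrow> vect elts K V \<Longrightarrow> \<phi> V \<in> lin K (fobj X V) (fobj Y V)"
  by (simp add: nat_trans_def)

lemma nat_trans_natural:
  "nat_trans elts K X Y \<phi> \<Longrightarrow> vect elts K V \<Longrightarrow> vect elts K W \<Longrightarrow> f \<in> lin K V W \<Longrightarrow>
    x \<in> carrier (fobj X V) \<Longrightarrow> \<phi> W (fmap X V W f x) = fmap Y V W f (\<phi> V x)"
  by (simp add: nat_trans_def)

text \<open>Whatever \<open>X\<close> lacks beyond its modules and its linear action on arrows is
  pulled back along the natural bijections \<open>\<phi> V\<close>: smallness because it is
  invariant under bijection, the functor laws because \<open>\<phi>\<close> is injective and turns
  them into the laws of \<open>Y\<close>. This is how the coend becomes a linear functor. The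
  inverse isomorphism is recorded as well, since it carries a presentation of \<open>Y\<close> over
  to \<open>X\<close>.\<close>

lemma functor_transfer:
  fixes X :: "('k, 'u, 'a) vfunctor" and Y :: "('k, 'u, 'b) vfunctor"
  assumes Y: "linear_functor elts K Y"
    and X: "\<And>V. vect elts K V \<Longrightarrow> module K (fobj X V)"
    and map: "\<And>V W f. vect elts K V \<Longrightarrow> vect elts K W \<Longrightarrow> f \<in> lin K V W \<Longrightarrow>
      fmap X V W f \<in> lin K (fobj X V) (fobj X W)"
    and \<phi>: "\<And>V. vect elts K V \<Longrightarrow> \<phi> V \<in> lin K (fobj X V) (fobj Y V)"
    and bij: "\<And>V. vect elts K V \<Longrightarrow> bij_betw (\<phi> V) (carrier (fobj X V)) (carrier (fobj Y V))"
    and natural: "\<And>V W f x. vect elts K V \<Longrightarrow> vect elts K W \<Longrightarrow> f \<in> lin K V W \<Longrightarrow>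
      x \<in> carrier (fobj X V) \<Longrightarrow> \<phi> W (fmap X V W f x) = fmap Y V W f (\<phi> V x)"
  shows linear_functor_transfer: "linear_functor elts K X"
    and nat_iso_transfer: "nat_iso elts K X Y \<phi>" "nat_iso elts K Y X
      (\<lambda>V. \<lambda>y\<in>carrier (fobj Y V). inv_into (carrier (fobj X V)) (\<phi> V) y)"
proof -
  have inj: "x = y"
    if "vect elts K V" "\<phi> V x = \<phi> V y" "x \<in> carrier (fobj X V)" "y \<in> carrier (fobj X V)"
    for x y and V :: "('k, 'u) module"
    using bij[OF that(1)] that(2-) by (auto simp: bij_betw_def dest: inj_onD)
  show "linear_functor elts K X"
  proof (rule linear_functorI)
    fix V :: "('k, 'u) module" assume V: "vect elts K V"
    then have "carrier (fobj X V) \<approx> carrier (fobj Y V)"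
      using bij unfolding eqpoll_def by blast
    then show "vect elts K (fobj X V)"
      using X[OF V] linear_functor_vect[OF Y V] unfolding vect_def small_def
      by (blast intro: eqpoll_trans)
  next
    fix V W :: "('k, 'u) module" and f g x
    assume V: "vect elts K V" and W: "vect elts K W" and f: "f \<in> lin K V W" and g: "g \<in> lin K V W"
      and x: "x \<in> carrier (fobj X V)"
    interpret H: module K "homs K V W" by (rule homs_module[OF vect_module[OF V] vect_module[OF W]])
    interpret XW: module K "fobj X W" by (rule X[OF W])
    have fg: "(\<lambda>v\<in>carrier V. f v \<oplus>\<^bsub>W\<^esub> g v) \<in> lin K V W" using H.a_closed[of f g] f g by simp
    note mem = lin_closed[OF map[OF V W f] x] lin_closed[OF map[OF V W g] x]
      lin_closed[OF map[OF V W fg] x]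
    show "fmap X V W (\<lambda>v\<in>carrier V. f v \<oplus>\<^bsub>W\<^esub> g v) x =
        fmap X V W f x \<oplus>\<^bsub>fobj X W\<^esub> fmap X V W g x"
      using mem by (intro inj[OF W]) (simp_all add: natural[OF V W _ x] f g fg lin_add[OF \<phi>[OF W]]
          linear_functor_add[OF Y V W f g lin_closed[OF \<phi>[OF V] x]])
  next
    fix V W :: "('k, 'u) module" and a f x
    assume V: "vect elts K V" and W: "vect elts K W" and a: "a \<in> carrier K" and f: "f \<in> lin K V W"
      and x: "x \<in> carrier (fobj X V)"
    interpret H: module K "homs K V W" by (rule homs_module[OF vect_module[OF V] vect_module[OF W]])
    interpret XW: module K "fobj X W" by (rule X[OF W])
    have af: "(\<lambda>v\<in>carrier V. a \<odot>\<^bsub>W\<^esub> f v) \<in> lin K V W" using H.smult_closed[of a f] a f by simp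
    note mem = lin_closed[OF map[OF V W f] x] lin_closed[OF map[OF V W af] x]
    show "fmap X V W (\<lambda>v\<in>carrier V. a \<odot>\<^bsub>W\<^esub> f v) x = a \<odot>\<^bsub>fobj X W\<^esub> fmap X V W f x"
      using mem a by (intro inj[OF W]) (simp_all add: natural[OF V W _ x] f af lin_smult[OF \<phi>[OF W]]
          linear_functor_smult[OF Y V W a f lin_closed[OF \<phi>[OF V] x]])
  next
    fix V :: "('k, 'u) module" and x assume V: "vect elts K V" and x: "x \<in> carrier (fobj X V)"
    note id = lin_id[OF vect_module[OF V]]
    show "fmap X V V (\<lambda>v\<in>carrier V. v) x = x"
      using lin_closed[OF map[OF V V id] x] x
      by (intro inj[OF V]) (simp_all add: natural[OF V V id x]
          linear_functor_id[OF Y V lin_closed[OF \<phi>[OF V] x]])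
  next
    fix U V W :: "('k, 'u) module" and f g :: "'u \<Rightarrow> 'u" and x
    assume U: "vect elts K U" and V: "vect elts K V" and W: "vect elts K W"
      and f: "f \<in> lin K U V" and g: "g \<in> lin K V W" and x: "x \<in> carrier (fobj X U)"
    note gf = lin_compose[OF f g vect_module[OF U]]
    note fx = lin_closed[OF map[OF U V f] x]
    show "fmap X U W (compose (carrier U) g f) x = fmap X V W g (fmap X U V f x)"
      using lin_closed[OF map[OF U W gf] x] lin_closed[OF map[OF V W g] fx]
      by (intro inj[OF W]) (simp_all add: natural[OF U W gf x] natural[OF V W g fx]
          natural[OF U V f x] linear_functor_compose[OF Y U V W f g lin_closed[OF \<phi>[OF U] x]])
  qed (rule map)
  let ?\<psi> = "\<lambda>V. \<lambda>y\<in>carrier (fobj Y V). inv_into (carrier (fobj X V)) (\<phi> V) y"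
  have \<psi>: "?\<psi> V \<in> lin K (fobj Y V) (fobj X V)" if V: "vect elts K V" for V :: "('k, 'u) module"
    by (rule lin_inverse[OF \<phi>[OF V] X[OF V] linear_functor_module[OF Y V] bij[OF V]])
  have \<psi>\<phi>: "?\<psi> V (\<phi> V x) = x" if V: "vect elts K V" and x: "x \<in> carrier (fobj X V)"
    for x and V :: "('k, 'u) module"
    using bij[OF V] x lin_closed[OF \<phi>[OF V] x] by (simp add: bij_betw_def inv_into_f_f)
  have \<phi>\<psi>: "\<phi> V (?\<psi> V y) = y" if V: "vect elts K V" and y: "y \<in> carrier (fobj Y V)"
    for y and V :: "('k, 'u) module"
    using bij[OF V] y by (simp add: bij_betw_def f_inv_into_f)
  have nat\<phi>: "nat_trans elts K X Y \<phi>"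
    by (rule nat_transI[OF \<phi> natural])
  have nat\<psi>: "nat_trans elts K Y X ?\<psi>"
  proof (rule nat_transI[OF \<psi>])
    fix V W :: "('k, 'u) module" and f y
    assume V: "vect elts K V" and W: "vect elts K W" and f: "f \<in> lin K V W"
      and y: "y \<in> carrier (fobj Y V)"
    note \<psi>y = lin_closed[OF \<psi>[OF V] y]
    have Yf: "fmap Y V W f y \<in> carrier (fobj Y W)"
      by (rule lin_closed[OF linear_functor_lin[OF Y V W f] y])
    have "\<phi> W (?\<psi> W (fmap Y V W f y)) = \<phi> W (fmap X V W f (?\<psi> V y))"
      unfolding natural[OF V W f \<psi>y] \<phi>\<psi>[OF W Yf] \<phi>\<psi>[OF V y] ..
    then show "?\<psi> W (fmap Y V W f y) = fmap X V W f (?\<psi> V y)"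
      by (rule inj[OF W _ lin_closed[OF \<psi>[OF W] Yf] lin_closed[OF map[OF V W f] \<psi>y]])
  qed
  show "nat_iso elts K X Y \<phi>" "nat_iso elts K Y X ?\<psi>"
    unfolding nat_iso_def using nat\<phi> nat\<psi> \<psi>\<phi> \<phi>\<psi> by blast+
qed

section \<open>Representable functors\<close>

lemma yoneda_simps [simp]:
  "fobj (yoneda K H) V = homs K H V"
  "fmap (yoneda K H) V W f = (\<lambda>h\<in>lin K H V. compose (carrier H) f h)"
  by (simp_all add: yoneda_def)

lemma (in grothendieck_universe) linear_functor_yoneda:
  fixes H :: "('k, 'u) module"
  assumes H: "vect elts K H"
  shows "linear_functor elts K (yoneda K H)"
proof -
  note H' = vect_module[OF H]
  show ?thesis
  proof (rule linear_functorI)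
    fix V :: "('k, 'u) module" assume V: "vect elts K V"
    then show "vect elts K (fobj (yoneda K H) V)"
      using H homs_module[OF H' vect_module[OF V]] by (auto simp: vect_def intro: small_lin)
  next
    fix V W :: "('k, 'u) module" and f assume V: "vect elts K V" and W: "vect elts K W" and f: "f \<in> lin K V W"
    show "fmap (yoneda K H) V W f \<in> lin K (fobj (yoneda K H) V) (fobj (yoneda K H) W)"
      using homs_postcompose[OF H' vect_module[OF V] f] by simp
  next
    fix V W :: "('k, 'u) module" and f g x assume x: "x \<in> carrier (fobj (yoneda K H) V)"
      and f: "f \<in> lin K V W" and g: "g \<in> lin K V W"
      and V: "vect elts K V" and W: "vect elts K W"
    show "fmap (yoneda K H) V W (\<lambda>v\<in>carrier V. f v \<oplus>\<^bsub>W\<^esub> g v) x =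
        fmap (yoneda K H) V W f x \<oplus>\<^bsub>fobj (yoneda K H) W\<^esub> fmap (yoneda K H) V W g x"
      using x by (simp add: compose_def fun_eq_iff lin_closed)
  next
    fix V W :: "('k, 'u) module" and a f x assume x: "x \<in> carrier (fobj (yoneda K H) V)"
    then show "fmap (yoneda K H) V W (\<lambda>v\<in>carrier V. a \<odot>\<^bsub>W\<^esub> f v) x =
        a \<odot>\<^bsub>fobj (yoneda K H) W\<^esub> fmap (yoneda K H) V W f x"
      by (simp add: compose_def fun_eq_iff lin_closed)
  next
    fix V :: "('k, 'u) module" and x assume x: "x \<in> carrier (fobj (yoneda K H) V)"
    then have "compose (carrier H) (\<lambda>v\<in>carrier V. v) x = x"
      by (intro extensionalityI[of _ "carrier H"])
        (auto simp: compose_eq lin_closed lin_extensional)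
    with x show "fmap (yoneda K H) V V (\<lambda>v\<in>carrier V. v) x = x" by simp
  next
    fix U V W :: "('k, 'u) module" and f g :: "'u \<Rightarrow> 'u" and x
    assume f: "f \<in> lin K U V" and x: "x \<in> carrier (fobj (yoneda K H) U)"
    then have x': "x \<in> lin K H U" by simp
    have "compose (carrier H) (compose (carrier U) g f) x =
        compose (carrier H) g (compose (carrier H) f x)"
      using lin_closed[OF x'] by (auto simp: compose_def fun_eq_iff)
    then show "fmap (yoneda K H) U W (compose (carrier U) g f) x =
        fmap (yoneda K H) V W g (fmap (yoneda K H) U V f x)"
      using x' lin_compose[OF x' f H'] by simp
  qed
qed

section \<open>Directed unions of functors\<close>

text \<open>A colimit of the simplest kind: the components of the cocone are injective, and their
  images grow along the order and exhaust \<open>X\<close>. The universal property then amounts to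
  gluing compatible maps on these images, and the diagram itself can be recovered from the
  cocone.\<close>

locale directed_union =
  fixes elts :: "'u \<Rightarrow> 'u set" and K :: "'k ring"
    and I :: "'i set" and r :: "('i \<times> 'i) set"
    and D :: "'i \<Rightarrow> ('k, 'u, 'a) vfunctor" and X :: "('k, 'u, 'b) vfunctor"
    and c :: "'i \<Rightarrow> ('k, 'u) module \<Rightarrow> 'a \<Rightarrow> 'b"
  assumes directed: "directed_poset I r"
    and D: "\<And>i. i \<in> I \<Longrightarrow> linear_functor elts K (D i)"
    and X: "linear_functor elts K X"
    and c: "\<And>i. i \<in> I \<Longrightarrow> nat_trans elts K (D i) X (c i)"
    and inj: "\<And>i V. i \<in> I \<Longrightarrow> vect elts K V \<Longrightarrow> inj_on (c i V) (carrier (fobj (D i) V))"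
    and mono: "\<And>i j V. i \<in> I \<Longrightarrow> j \<in> I \<Longrightarrow> (i, j) \<in> r \<Longrightarrow> vect elts K V \<Longrightarrow>
      c i V ` carrier (fobj (D i) V) \<subseteq> c j V ` carrier (fobj (D j) V)"
    and union: "\<And>V. vect elts K V \<Longrightarrow>
      carrier (fobj X V) \<subseteq> (\<Union>i\<in>I. c i V ` carrier (fobj (D i) V))"
begin

text \<open>Injectivity of \<open>c j V\<close> leaves at most one element of stage \<open>j\<close>
  with the image \<open>c i V x\<close>, and the condition \<open>mono\<close> provides it whenever
  \<open>(i, j) \<in> r\<close>. So this is the only transition map compatible with the
  cocone.\<close>

definition transition :: "'i \<Rightarrow> 'i \<Rightarrow> ('k, 'u) module \<Rightarrow> 'a \<Rightarrow> 'a" where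
  "transition i j V =
    (\<lambda>x\<in>carrier (fobj (D i) V). inv_into (carrier (fobj (D j) V)) (c j V) (c i V x))"

lemma transition:
  assumes "i \<in> I" "j \<in> I" "(i, j) \<in> r" "vect elts K V" "x \<in> carrier (fobj (D i) V)"
  shows transition_closed: "transition i j V x \<in> carrier (fobj (D j) V)"
    and c_transition: "c j V (transition i j V x) = c i V x"
proof -
  have "c i V x \<in> c j V ` carrier (fobj (D j) V)" using mono assms by blast
  then show "transition i j V x \<in> carrier (fobj (D j) V)" "c j V (transition i j V x) = c i V x"
    using assms(5) by (simp_all add: transition_def inv_into_into f_inv_into_f)
qed

lemma c_inj:
  "i \<in> I \<Longrightarrow> vect elts K V \<Longrightarrow> x \<in> carrier (fobj (D i) V) \<Longrightarrow> y \<in> carrier (fobj (D i) V) \<Longrightarrow>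
    c i V x = c i V y \<Longrightarrow> x = y"
  using inj by (auto dest: inj_onD)

lemma order_refl: "i \<in> I \<Longrightarrow> (i, i) \<in> r"
  and order_trans: "(i, j) \<in> r \<Longrightarrow> (j, k) \<in> r \<Longrightarrow> (i, k) \<in> r"
  and upper_bound: "i \<in> I \<Longrightarrow> j \<in> I \<Longrightarrow> \<exists>k\<in>I. (i, k) \<in> r \<and> (j, k) \<in> r"
  using directed
  by (auto simp: directed_poset_def partial_order_on_def preorder_on_def dest: refl_onD transD)

lemma nat_trans_transition:
  assumes ij: "i \<in> I" "j \<in> I" "(i, j) \<in> r"
  shows "nat_trans elts K (D i) (D j) (transition i j)"
proof (rule nat_transI)
  fix V :: "('k, 'u) module" assume V: "vect elts K V"
  note Di = linear_functor_module[OF D[OF ij(1)] V]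
    and Dj = linear_functor_module[OF D[OF ij(2)] V]
    and ci = nat_trans_lin[OF c[OF ij(1)] V] and cj = nat_trans_lin[OF c[OF ij(2)] V]
  interpret Di: module K "fobj (D i) V" by (rule Di)
  interpret Dj: module K "fobj (D j) V" by (rule Dj)
  note t = transition[OF ij V]
  show "transition i j V \<in> lin K (fobj (D i) V) (fobj (D j) V)"
  proof (rule linI)
    show "transition i j V \<in> extensional (carrier (fobj (D i) V))" by (simp add: transition_def)
  qed (auto intro!: c_inj[OF ij(2) V] simp: t lin_add[OF ci] lin_add[OF cj]
      lin_smult[OF ci] lin_smult[OF cj])
next
  fix V W :: "('k, 'u) module" and f x
  assume V: "vect elts K V" and W: "vect elts K W" and f: "f \<in> lin K V W"
    and x: "x \<in> carrier (fobj (D i) V)"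
  note fi = linear_functor_lin[OF D[OF ij(1)] V W f]
    and fj = linear_functor_lin[OF D[OF ij(2)] V W f]
  show "transition i j W (fmap (D i) V W f x) = fmap (D j) V W f (transition i j V x)"
    by (rule c_inj[OF ij(2) W])
      (simp_all add: x transition[OF ij W] transition[OF ij V] lin_closed[OF fi] lin_closed[OF fj]
        nat_trans_natural[OF c[OF ij(1)] V W f] nat_trans_natural[OF c[OF ij(2)] V W f])
qed

lemma poset_diagram_transition: "poset_diagram elts K I r D transition"
  unfolding poset_diagram_def
proof (intro conjI ballI allI impI)
  fix i x and V :: "('k, 'u) module" assume *: "i \<in> I" "vect elts K V" "x \<in> carrier (fobj (D i) V)"
  then show "transition i i V x = x"
    using transition[OF *(1,1) order_refl *(2,3)] c_inj by blast
next
  fix i j k x and V :: "('k, 'u) module"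
  assume *: "i \<in> I" "j \<in> I" "k \<in> I" "(i, j) \<in> r" "(j, k) \<in> r" "vect elts K V"
    "x \<in> carrier (fobj (D i) V)"
  then have ik: "(i, k) \<in> r" by (blast intro: order_trans)
  note tij = transition[OF *(1,2,4,6,7)]
  show "transition j k V (transition i j V x) = transition i k V x"
    using transition[OF *(2,3,5,6) tij(1)] transition[OF *(1,3) ik *(6,7)] tij(2)
    by (intro c_inj[OF *(3,6)]) auto
qed (simp_all add: D nat_trans_transition)

lemma cocone_transition: "cocone elts K I r D transition X c"
  by (simp add: cocone_def c c_transition)

lemma colimit_cocone_transition: "colimit_cocone elts K I r D transition X c"
  unfolding colimit_cocone_def
proof (intro conjI allI impI)
  fix Z :: "('k, 'u, 'u) vfunctor" and d
  assume Z: "linear_functor elts K Z" and cocone: "cocone elts K I r D transition Z d"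
  have d: "nat_trans elts K (D i) Z (d i)" if "i \<in> I" for i
    using cocone that by (simp add: cocone_def)
  have d_transition: "d j V (transition i j V x) = d i V x"
    if "i \<in> I" "j \<in> I" "(i, j) \<in> r" "vect elts K V" "x \<in> carrier (fobj (D i) V)" for i j x and V :: "('k, 'u) module"
    using cocone that by (simp add: cocone_def)
  \<comment> \<open>Two representatives of the same element of \<open>X\<close> become equal at any
    upper bound \<open>k\<close>, because \<open>c k V\<close> is injective; compatibility of
    \<open>d\<close> then equates their values.\<close>
  have d_eq: "d i V x = d j V y"
    if ij: "i \<in> I" "j \<in> I" and V: "vect elts K V"
      and x: "x \<in> carrier (fobj (D i) V)" and y: "y \<in> carrier (fobj (D j) V)"
      and eq: "c i V x = c j V y" for i j x y and V :: "('k, 'u) module"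
  proof -
    obtain k where k: "k \<in> I" "(i, k) \<in> r" "(j, k) \<in> r" using upper_bound[OF ij] by blast
    have "transition i k V x = transition j k V y"
      using transition[OF ij(1) k(1,2) V x] transition[OF ij(2) k(1,3) V y] eq
      by (intro c_inj[OF k(1) V]) auto
    then show ?thesis
      using d_transition[OF ij(1) k(1,2) V x] d_transition[OF ij(2) k(1,3) V y] by simp
  qed
  \<comment> \<open>The value is read off from an arbitrary stage and representative;
    \<open>d_eq\<close> makes it independent of both.\<close>
  define \<phi> where "\<phi> V = (\<lambda>z\<in>carrier (fobj X V).
    SOME w. \<exists>i\<in>I. \<exists>x\<in>carrier (fobj (D i) V). c i V x = z \<and> d i V x = w)" for V
  have \<phi>: "\<phi> V (c i V x) = d i V x"
    if i: "i \<in> I" and V: "vect elts K V" and x: "x \<in> carrier (fobj (D i) V)" for i x and V :: "('k, 'u) module"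
  proof -
    let ?P = "\<lambda>w. \<exists>j\<in>I. \<exists>y\<in>carrier (fobj (D j) V). c j V y = c i V x \<and> d j V y = w"
    have "?P (d i V x)" using i x by blast
    then have "?P (SOME w. ?P w)" by (rule someI)
    then have "(SOME w. ?P w) = d i V x" using d_eq[OF _ i V _ x] by metis
    then show ?thesis using lin_closed[OF nat_trans_lin[OF c[OF i] V] x] by (simp add: \<phi>_def)
  qed
  \<comment> \<open>Additivity needs both summands at one stage, and this is where directedness
    enters a second time.\<close>
  have common: "\<exists>k\<in>I. \<exists>x\<in>carrier (fobj (D k) V). \<exists>y\<in>carrier (fobj (D k) V). z = c k V x \<and> w = c k V y"
    if V: "vect elts K V" and z: "z \<in> carrier (fobj X V)" and w: "w \<in> carrier (fobj X V)" for z w and V :: "('k, 'u) module"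
  proof -
    obtain i x where i: "i \<in> I" "x \<in> carrier (fobj (D i) V)" "z = c i V x" using union[OF V] z by blast
    obtain j y where j: "j \<in> I" "y \<in> carrier (fobj (D j) V)" "w = c j V y" using union[OF V] w by blast
    obtain k where k: "k \<in> I" "(i, k) \<in> r" "(j, k) \<in> r" using upper_bound[OF i(1) j(1)] by blast
    show ?thesis
      using transition[OF i(1) k(1,2) V i(2)] transition[OF j(1) k(1,3) V j(2)] i(3) j(3) k(1)
      by metis
  qed
  have "nat_trans elts K X Z \<phi>"
  proof (rule nat_transI)
    fix V :: "('k, 'u) module" assume V: "vect elts K V"
    note XV = linear_functor_module[OF X V]
    show "\<phi> V \<in> lin K (fobj X V) (fobj Z V)"
    proof (rule linI)
      show "\<phi> V \<in> extensional (carrier (fobj X V))" by (simp add: \<phi>_def)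
      fix z assume z: "z \<in> carrier (fobj X V)"
      obtain i x where i: "i \<in> I" and x: "x \<in> carrier (fobj (D i) V)" and zx: "z = c i V x"
        using union[OF V] z by blast
      interpret Di: module K "fobj (D i) V" by (rule linear_functor_module[OF D[OF i] V])
      note di = nat_trans_lin[OF d[OF i] V] and ci = nat_trans_lin[OF c[OF i] V]
      show "\<phi> V z \<in> carrier (fobj Z V)" by (simp add: zx \<phi>[OF i V x] lin_closed[OF di x])
      show "\<phi> V (a \<odot>\<^bsub>fobj X V\<^esub> z) = a \<odot>\<^bsub>fobj Z V\<^esub> \<phi> V z" if a: "a \<in> carrier K" for a
        using \<phi>[OF i V Di.smult_closed[OF a x]]
        by (simp add: zx \<phi>[OF i V x] lin_smult[OF di a x] lin_smult[OF ci a x])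
    next
      fix z w assume "z \<in> carrier (fobj X V)" "w \<in> carrier (fobj X V)"
      then obtain k x y where k: "k \<in> I" and x: "x \<in> carrier (fobj (D k) V)"
        and y: "y \<in> carrier (fobj (D k) V)" and zw: "z = c k V x" "w = c k V y"
        using common[OF V] by metis
      interpret Dk: module K "fobj (D k) V" by (rule linear_functor_module[OF D[OF k] V])
      note dk = nat_trans_lin[OF d[OF k] V] and ck = nat_trans_lin[OF c[OF k] V]
      show "\<phi> V (z \<oplus>\<^bsub>fobj X V\<^esub> w) = \<phi> V z \<oplus>\<^bsub>fobj Z V\<^esub> \<phi> V w"
        using \<phi>[OF k V Dk.a_closed[OF x y]]
        by (simp add: zw \<phi>[OF k V x] \<phi>[OF k V y] lin_add[OF dk x y] lin_add[OF ck x y])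
    qed
  next
    fix V W :: "('k, 'u) module" and f z
    assume V: "vect elts K V" and W: "vect elts K W" and f: "f \<in> lin K V W"
      and z: "z \<in> carrier (fobj X V)"
    obtain i x where i: "i \<in> I" and x: "x \<in> carrier (fobj (D i) V)" and zx: "z = c i V x"
      using union[OF V] z by blast
    note fi = linear_functor_lin[OF D[OF i] V W f]
    show "\<phi> W (fmap X V W f z) = fmap Z V W f (\<phi> V z)"
      using \<phi>[OF i W lin_closed[OF fi x]]
      by (simp add: zx \<phi>[OF i V x] nat_trans_natural[OF c[OF i] V W f x]
          nat_trans_natural[OF d[OF i] V W f x])
  qed
  moreover have "\<phi>' V = \<phi> V"
    if \<phi>': "nat_trans elts K X Z \<phi>'" and V: "vect elts K V"
      and eq: "\<forall>i\<in>I. \<forall>V. vect elts K V \<longrightarrow> (\<forall>x\<in>carrier (fobj (D i) V). \<phi>' V (c i V x) = d i V x)"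
    for \<phi>' and V :: "('k, 'u) module"
  proof (rule extensionalityI)
    show "\<phi>' V \<in> extensional (carrier (fobj X V))"
      using nat_trans_lin[OF \<phi>' V] by (rule lin_extensional)
    show "\<phi> V \<in> extensional (carrier (fobj X V))" by (simp add: \<phi>_def)
    fix z assume "z \<in> carrier (fobj X V)"
    then obtain i x where "i \<in> I" "x \<in> carrier (fobj (D i) V)" "z = c i V x"
      using union[OF V] by blast
    then show "\<phi>' V z = \<phi> V z" using eq V \<phi> by simp
  qed
  ultimately show "\<exists>\<phi>. nat_trans elts K X Z \<phi> \<and>
      (\<forall>i\<in>I. \<forall>V. vect elts K V \<longrightarrow> (\<forall>x\<in>carrier (fobj (D i) V). \<phi> V (c i V x) = d i V x)) \<and>
      (\<forall>\<phi>'. nat_trans elts K X Z \<phi>' \<longrightarrow>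
        (\<forall>i\<in>I. \<forall>V. vect elts K V \<longrightarrow> (\<forall>x\<in>carrier (fobj (D i) V). \<phi>' V (c i V x) = d i V x)) \<longrightarrow>
        (\<forall>V. vect elts K V \<longrightarrow> \<phi>' V = \<phi> V))"
    using \<phi> by (intro exI[of _ \<phi>] conjI allI impI ballI)
qed (rule cocone_transition)

end

lemma nat_trans_compose:
  fixes X :: "('k, 'u, 'a) vfunctor" and Y :: "('k, 'u, 'b) vfunctor" and Z :: "('k, 'u, 'c) vfunctor"
  assumes X: "linear_functor elts K X"
    and \<phi>: "nat_trans elts K X Y \<phi>" and \<psi>: "nat_trans elts K Y Z \<psi>"
  shows "nat_trans elts K X Z (\<lambda>V. compose (carrier (fobj X V)) (\<psi> V) (\<phi> V))"
proof (rule nat_transI)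
  fix V :: "('k, 'u) module" assume V: "vect elts K V"
  show "compose (carrier (fobj X V)) (\<psi> V) (\<phi> V) \<in> lin K (fobj X V) (fobj Z V)"
    by (rule lin_compose[OF nat_trans_lin[OF \<phi> V] nat_trans_lin[OF \<psi> V]
          linear_functor_module[OF X V]])
next
  fix V W :: "('k, 'u) module" and f x
  assume V: "vect elts K V" and W: "vect elts K W" and f: "f \<in> lin K V W"
    and x: "x \<in> carrier (fobj X V)"
  show "compose (carrier (fobj X W)) (\<psi> W) (\<phi> W) (fmap X V W f x) =
      fmap Z V W f (compose (carrier (fobj X V)) (\<psi> V) (\<phi> V) x)"
    using x lin_closed[OF linear_functor_lin[OF X V W f] x] lin_closed[OF nat_trans_lin[OF \<phi> V] x]
    by (simp add: compose_eq nat_trans_natural[OF \<phi> V W f] nat_trans_natural[OF \<psi> V W f])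
qed

text \<open>Only the tip of the cocone is replaced, while the diagram and its index set stay.
  Injectivity of the new components holds because \<open>\<psi>\<close> undoes
  \<open>\<phi>\<close>, and exhaustion because \<open>\<phi>\<close> is onto.\<close>

lemma directed_union_iso:
  fixes X :: "('k, 'u, 'a) vfunctor" and Y :: "('k, 'u, 'b) vfunctor"
  assumes "directed_union elts K I r D X c" and Y: "linear_functor elts K Y"
    and iso: "nat_iso elts K X Y \<phi>"
  shows "directed_union elts K I r D Y (\<lambda>i V. compose (carrier (fobj (D i) V)) (\<phi> V) (c i V))"
proof -
  interpret directed_union elts K I r D X c by (rule assms(1))
  obtain \<psi> where \<phi>: "nat_trans elts K X Y \<phi>" and \<psi>: "nat_trans elts K Y X \<psi>"
    and \<psi>\<phi>: "\<And>(V :: ('k, 'u) module) x. vect elts K V \<Longrightarrow> x \<in> carrier (fobj X V) \<Longrightarrow> \<psi> V (\<phi> V x) = x"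
    and \<phi>\<psi>: "\<And>(V :: ('k, 'u) module) y. vect elts K V \<Longrightarrow> y \<in> carrier (fobj Y V) \<Longrightarrow> \<phi> V (\<psi> V y) = y"
    using iso unfolding nat_iso_def by blast
  have cX: "c i V ` carrier (fobj (D i) V) \<subseteq> carrier (fobj X V)"
    if "i \<in> I" "vect elts K V" for i and V :: "('k, 'u) module"
    using lin_closed[OF nat_trans_lin[OF c[OF that(1)] that(2)]] by blast
  have image: "compose A (\<phi> V) (c i V) ` A = \<phi> V ` c i V ` A" for A i and V :: "('k, 'u) module"
    by (auto simp: compose_eq image_image cong: image_cong_simp)
  show ?thesis
  proof unfold_locales
    fix i and V :: "('k, 'u) module" assume i: "i \<in> I" and V: "vect elts K V"
    show "inj_on (compose (carrier (fobj (D i) V)) (\<phi> V) (c i V)) (carrier (fobj (D i) V))"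
    proof (rule inj_onI)
      fix x y assume x: "x \<in> carrier (fobj (D i) V)" and y: "y \<in> carrier (fobj (D i) V)"
        and "compose (carrier (fobj (D i) V)) (\<phi> V) (c i V) x =
          compose (carrier (fobj (D i) V)) (\<phi> V) (c i V) y"
      then have "\<psi> V (\<phi> V (c i V x)) = \<psi> V (\<phi> V (c i V y))" by (simp add: compose_eq)
      then have "c i V x = c i V y" using \<psi>\<phi>[OF V] cX[OF i V] x y by (simp add: image_subset_iff)
      then show "x = y" by (rule c_inj[OF i V x y])
    qed
  next
    fix V :: "('k, 'u) module" assume V: "vect elts K V"
    show "carrier (fobj Y V) \<subseteq>
        (\<Union>i\<in>I. compose (carrier (fobj (D i) V)) (\<phi> V) (c i V) ` carrier (fobj (D i) V))"
      unfolding image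
    proof
      fix y assume y: "y \<in> carrier (fobj Y V)"
      then have "\<psi> V y \<in> (\<Union>i\<in>I. c i V ` carrier (fobj (D i) V))"
        using union[OF V] lin_closed[OF nat_trans_lin[OF \<psi> V] y] by blast
      moreover have "y = \<phi> V (\<psi> V y)" using \<phi>\<psi>[OF V y] by simp
      ultimately show "y \<in> (\<Union>i\<in>I. \<phi> V ` c i V ` carrier (fobj (D i) V))" by blast
    qed
  qed (simp_all only: image image_mono mono directed D Y nat_trans_compose[OF D c \<phi>])
qed

lemma ind_vect_op_directed_union:
  fixes X :: "('k, 'u, 'a) vfunctor"
  assumes "directed_union elts K (elts I) r (\<lambda>i. yoneda K (G i)) X c"
    and "\<forall>i\<in>elts I. vect elts K (G i)"
  shows "ind_vect_op elts K X"
proof -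
  interpret directed_union elts K "elts I" r "\<lambda>i. yoneda K (G i)" X c by (rule assms(1))
  show ?thesis
    unfolding ind_vect_op_def
    using X directed assms(2) poset_diagram_transition colimit_cocone_transition by blast
qed

section \<open>Bornologies\<close>

lemma bornology_subset: "bornology \<Gamma> \<F> \<Longrightarrow> A \<in> \<F> \<Longrightarrow> A \<subseteq> \<Gamma>"
  and bornology_mono: "bornology \<Gamma> \<F> \<Longrightarrow> A \<in> \<F> \<Longrightarrow> B \<subseteq> A \<Longrightarrow> B \<in> \<F>"
  and bornology_Un: "bornology \<Gamma> \<F> \<Longrightarrow> A \<in> \<F> \<Longrightarrow> B \<in> \<F> \<Longrightarrow> A \<union> B \<in> \<F>"
  and bornology_finite: "bornology \<Gamma> \<F> \<Longrightarrow> A \<subseteq> \<Gamma> \<Longrightarrow> finite A \<Longrightarrow> A \<in> \<F>"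
  and bornology_empty: "bornology \<Gamma> \<F> \<Longrightarrow> {} \<in> \<F>"
  by (auto simp: bornology_def)

text \<open>The union of two rectangles lies in the rectangle of the unions of their sides, and a
  finite set lies in the product of its two projections, which are finite and hence bounded.\<close>

lemma bornology_rectangles:
  assumes F: "bornology \<Gamma> \<F>" and G: "bornology \<Delta> \<G>"
  shows "bornology (\<Gamma> \<times> \<Delta>) {A. \<exists>F\<in>\<F>. \<exists>G\<in>\<G>. A \<subseteq> F \<times> G}" (is "bornology _ ?B")
  unfolding bornology_def
proof (intro conjI ballI allI impI)
  show "?B \<subseteq> Pow (\<Gamma> \<times> \<Delta>)"
    using bornology_subset[OF F] bornology_subset[OF G] by blast
next
  fix A B assume "A \<in> ?B" "B \<subseteq> A" then show "B \<in> ?B" by blast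
next
  fix A B assume "A \<in> ?B" "B \<in> ?B"
  then obtain F1 G1 F2 G2 where *: "F1 \<in> \<F>" "G1 \<in> \<G>" "F2 \<in> \<F>" "G2 \<in> \<G>"
    and "A \<subseteq> F1 \<times> G1" "B \<subseteq> F2 \<times> G2" by blast
  then have "A \<union> B \<subseteq> (F1 \<union> F2) \<times> (G1 \<union> G2)" by blast
  then show "A \<union> B \<in> ?B"
    using bornology_Un[OF F *(1,3)] bornology_Un[OF G *(2,4)] by blast
next
  fix A assume A: "A \<subseteq> \<Gamma> \<times> \<Delta>" "finite A"
  then have "fst ` A \<in> \<F>" "snd ` A \<in> \<G>"
    by (auto intro!: bornology_finite[OF F] bornology_finite[OF G])
  moreover have "A \<subseteq> fst ` A \<times> snd ` A" by force
  ultimately show "A \<in> ?B" by blast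
qed

text \<open>The subsets of rectangles already form a bornology, and every bornology containing the
  rectangles contains their subsets. With this description a bounded set of the product always comes
  with bounded sides \<open>F\<close> and \<open>G\<close>.\<close>

lemma born_tensor_eq:
  assumes F: "bornology \<Gamma> \<F>" and G: "bornology \<Delta> \<G>"
  shows "born_tensor \<Gamma> \<F> \<Delta> \<G> = {A. \<exists>F\<in>\<F>. \<exists>G\<in>\<G>. A \<subseteq> F \<times> G}"
proof (rule equalityI)
  show "born_tensor \<Gamma> \<F> \<Delta> \<G> \<subseteq> {A. \<exists>F\<in>\<F>. \<exists>G\<in>\<G>. A \<subseteq> F \<times> G}"
    unfolding born_tensor_def using bornology_rectangles[OF assms] by blast
  show "{A. \<exists>F\<in>\<F>. \<exists>G\<in>\<G>. A \<subseteq> F \<times> G} \<subseteq> born_tensor \<Gamma> \<F> \<Delta> \<G>"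
    unfolding born_tensor_def using bornology_mono by blast
qed

lemma bornology_born_tensor:
  "bornology \<Gamma> \<F> \<Longrightarrow> bornology \<Delta> \<G> \<Longrightarrow> bornology (\<Gamma> \<times> \<Delta>) (born_tensor \<Gamma> \<F> \<Delta> \<G>)"
  by (simp add: born_tensor_eq bornology_rectangles)

section \<open>The functor of functions with bounded support\<close>

lemma born_space_simps [simp]:
  "carrier (born_space \<Gamma> \<F> V) = {s \<in> \<Gamma> \<rightarrow>\<^sub>E carrier V. {\<gamma> \<in> \<Gamma>. s \<gamma> \<noteq> \<zero>\<^bsub>V\<^esub>} \<in> \<F>}"
  "\<zero>\<^bsub>born_space \<Gamma> \<F> V\<^esub> = (\<lambda>\<gamma>\<in>\<Gamma>. \<zero>\<^bsub>V\<^esub>)"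
  "s \<oplus>\<^bsub>born_space \<Gamma> \<F> V\<^esub> t = (\<lambda>\<gamma>\<in>\<Gamma>. s \<gamma> \<oplus>\<^bsub>V\<^esub> t \<gamma>)"
  "a \<odot>\<^bsub>born_space \<Gamma> \<F> V\<^esub> s = (\<lambda>\<gamma>\<in>\<Gamma>. a \<odot>\<^bsub>V\<^esub> s \<gamma>)"
  by (simp_all add: born_space_def)

text \<open>Any bounded set outside of which \<open>s\<close> vanishes will do, so that supports of
  sums, multiples and images only have to be estimated.\<close>

lemma born_spaceI:
  assumes "bornology \<Gamma> \<F>" "F \<in> \<F>" "s \<in> extensional \<Gamma>"
    and "\<And>\<gamma>. \<gamma> \<in> \<Gamma> \<Longrightarrow> s \<gamma> \<in> carrier V"
    and "\<And>\<gamma>. \<gamma> \<in> \<Gamma> \<Longrightarrow> \<gamma> \<notin> F \<Longrightarrow> s \<gamma> = \<zero>\<^bsub>V\<^esub>"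
  shows "s \<in> carrier (born_space \<Gamma> \<F> V)"
  using assms by (auto simp: PiE_def intro: bornology_mono)

lemma born_space_closed: "s \<in> carrier (born_space \<Gamma> \<F> V) \<Longrightarrow> \<gamma> \<in> \<Gamma> \<Longrightarrow> s \<gamma> \<in> carrier V"
  and born_space_extensional: "s \<in> carrier (born_space \<Gamma> \<F> V) \<Longrightarrow> s \<in> extensional \<Gamma>"
  and born_space_support: "s \<in> carrier (born_space \<Gamma> \<F> V) \<Longrightarrow> {\<gamma> \<in> \<Gamma>. s \<gamma> \<noteq> \<zero>\<^bsub>V\<^esub>} \<in> \<F>"
  by (auto simp: PiE_def)

lemma born_space_module:
  assumes b: "bornology \<Gamma> \<F>" and V: "module K V"
  shows "module K (born_space \<Gamma> \<F> V)"
proof -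
  interpret V: module K V by (rule V)
  note mem = born_space_closed[of _ \<Gamma> \<F> V]
  have "module K (mk_space (carrier (born_space \<Gamma> \<F> V)) (\<lambda>\<gamma>\<in>\<Gamma>. \<zero>\<^bsub>V\<^esub>)
      (\<lambda>s t. \<lambda>\<gamma>\<in>\<Gamma>. s \<gamma> \<oplus>\<^bsub>V\<^esub> t \<gamma>) (\<lambda>a s. \<lambda>\<gamma>\<in>\<Gamma>. a \<odot>\<^bsub>V\<^esub> s \<gamma>))"
  proof (rule module_pointwise)
    show "(\<lambda>\<gamma>\<in>\<Gamma>. \<zero>\<^bsub>V\<^esub>) \<in> carrier (born_space \<Gamma> \<F> V)"
      by (rule born_spaceI[OF b bornology_empty[OF b]]) auto
  next
    fix s t assume s: "s \<in> carrier (born_space \<Gamma> \<F> V)" and t: "t \<in> carrier (born_space \<Gamma> \<F> V)"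
    show "(\<lambda>\<gamma>\<in>\<Gamma>. s \<gamma> \<oplus>\<^bsub>V\<^esub> t \<gamma>) \<in> carrier (born_space \<Gamma> \<F> V)"
      by (rule born_spaceI[OF b bornology_Un[OF b born_space_support[OF s] born_space_support[OF t]]])
        (auto simp: mem[OF s] mem[OF t])
  next
    fix a s assume a: "a \<in> carrier K" and s: "s \<in> carrier (born_space \<Gamma> \<F> V)"
    show "(\<lambda>\<gamma>\<in>\<Gamma>. a \<odot>\<^bsub>V\<^esub> s \<gamma>) \<in> carrier (born_space \<Gamma> \<F> V)"
      by (rule born_spaceI[OF b born_space_support[OF s]]) (auto simp: a mem[OF s])
  qed (auto simp: V V.R.is_cring)
  then show ?thesis by (simp add: born_space_def)
qed

lemma born_functor_simps [simp]:
  "fobj (born_functor \<Gamma> \<F>) V = born_space \<Gamma> \<F> V"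
  "fmap (born_functor \<Gamma> \<F>) V W f = (\<lambda>s\<in>carrier (born_space \<Gamma> \<F> V). compose \<Gamma> f s)"
  by (simp_all add: born_functor_def)

lemma born_functor_map_closed:
  assumes b: "bornology \<Gamma> \<F>" and V: "module K V" and W: "module K W" and f: "f \<in> lin K V W"
    and s: "s \<in> carrier (born_space \<Gamma> \<F> V)"
  shows "compose \<Gamma> f s \<in> carrier (born_space \<Gamma> \<F> W)"
proof (rule born_spaceI[OF b born_space_support[OF s]])
  show "compose \<Gamma> f s \<in> extensional \<Gamma>" by (simp add: compose_def)
  show "compose \<Gamma> f s \<gamma> \<in> carrier W" if "\<gamma> \<in> \<Gamma>" for \<gamma>
    using lin_closed[OF f born_space_closed[OF s that]] that by (simp add: compose_eq)
qed (simp add: compose_eq lin_zero[OF f V W])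

lemma (in grothendieck_universe) linear_functor_born:
  fixes \<Gamma> :: "'g set" and K :: "'k ring"
  assumes b: "bornology \<Gamma> \<F>" and small: "small elts \<Gamma>"
  shows "linear_functor elts K (born_functor \<Gamma> \<F> :: ('k, 'u, 'g \<Rightarrow> 'u) vfunctor)"
proof (rule linear_functorI)
  fix V :: "('k, 'u) module" assume V: "vect elts K V"
  then have "small elts (\<Gamma> \<rightarrow>\<^sub>E carrier V)"
    using small by (intro small_PiE) (auto simp: vect_def)
  then have "small elts (carrier (born_space \<Gamma> \<F> V))"
    by (rule small_subset[rotated]) auto
  then show "vect elts K (fobj (born_functor \<Gamma> \<F>) V)"
    using born_space_module[OF b vect_module[OF V]] by (simp add: vect_def)
next
  fix V W :: "('k, 'u) module" and f
  assume V: "vect elts K V" and W: "vect elts K W" and f: "f \<in> lin K V W"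
  note map = born_functor_map_closed[OF b vect_module[OF V] vect_module[OF W] f]
  interpret B: module K "born_space \<Gamma> \<F> V" by (rule born_space_module[OF b vect_module[OF V]])
  have "(\<lambda>s\<in>carrier (born_space \<Gamma> \<F> V). compose \<Gamma> f s) \<in>
      lin K (born_space \<Gamma> \<F> V) (born_space \<Gamma> \<F> W)"
  proof (rule lin_restrictI[OF B.module_axioms map])
    fix s t assume s: "s \<in> carrier (born_space \<Gamma> \<F> V)" and t: "t \<in> carrier (born_space \<Gamma> \<F> V)"
    show "compose \<Gamma> f (s \<oplus>\<^bsub>born_space \<Gamma> \<F> V\<^esub> t) =
        compose \<Gamma> f s \<oplus>\<^bsub>born_space \<Gamma> \<F> W\<^esub> compose \<Gamma> f t"
      using born_space_closed[OF s] born_space_closed[OF t]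
      by (auto simp: compose_def fun_eq_iff lin_add[OF f])
  next
    fix a s assume a: "a \<in> carrier K" and s: "s \<in> carrier (born_space \<Gamma> \<F> V)"
    show "compose \<Gamma> f (a \<odot>\<^bsub>born_space \<Gamma> \<F> V\<^esub> s) =
        a \<odot>\<^bsub>born_space \<Gamma> \<F> W\<^esub> compose \<Gamma> f s"
      using a born_space_closed[OF s] by (auto simp: compose_def fun_eq_iff lin_smult[OF f])
  qed
  then show "fmap (born_functor \<Gamma> \<F>) V W f \<in>
      lin K (fobj (born_functor \<Gamma> \<F>) V) (fobj (born_functor \<Gamma> \<F>) W)" by simp
next
  fix V W :: "('k, 'u) module" and f g s
  assume "s \<in> carrier (fobj (born_functor \<Gamma> \<F>) V)"
  then have s: "s \<in> carrier (born_space \<Gamma> \<F> V)" by simp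
  show "fmap (born_functor \<Gamma> \<F>) V W (\<lambda>v\<in>carrier V. f v \<oplus>\<^bsub>W\<^esub> g v) s =
      fmap (born_functor \<Gamma> \<F>) V W f s \<oplus>\<^bsub>fobj (born_functor \<Gamma> \<F>) W\<^esub>
      fmap (born_functor \<Gamma> \<F>) V W g s"
    using s born_space_closed[OF s]
    by (simp del: born_space_simps(1)) (simp add: compose_def fun_eq_iff del: born_space_simps(1))
next
  fix V W :: "('k, 'u) module" and a f s
  assume "s \<in> carrier (fobj (born_functor \<Gamma> \<F>) V)"
  then have s: "s \<in> carrier (born_space \<Gamma> \<F> V)" by simp
  show "fmap (born_functor \<Gamma> \<F>) V W (\<lambda>v\<in>carrier V. a \<odot>\<^bsub>W\<^esub> f v) s =
      a \<odot>\<^bsub>fobj (born_functor \<Gamma> \<F>) W\<^esub> fmap (born_functor \<Gamma> \<F>) V W f s"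
    using s born_space_closed[OF s]
    by (simp del: born_space_simps(1)) (simp add: compose_def fun_eq_iff del: born_space_simps(1))
next
  fix V :: "('k, 'u) module" and s
  assume "s \<in> carrier (fobj (born_functor \<Gamma> \<F>) V)"
  then have s: "s \<in> carrier (born_space \<Gamma> \<F> V)" by simp
  then have "compose \<Gamma> (\<lambda>v\<in>carrier V. v) s = s"
    using born_space_closed[OF s] born_space_extensional[OF s]
    by (intro extensionalityI[of _ \<Gamma>]) (auto simp: compose_eq simp del: born_space_simps(1))
  then show "fmap (born_functor \<Gamma> \<F>) V V (\<lambda>v\<in>carrier V. v) s = s"
    using s by (simp del: born_space_simps(1))
next
  fix U V W :: "('k, 'u) module" and f g :: "'u \<Rightarrow> 'u" and s
  assume U: "vect elts K U" and V: "vect elts K V" and f: "f \<in> lin K U V"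
    and "s \<in> carrier (fobj (born_functor \<Gamma> \<F>) U)"
  then have s: "s \<in> carrier (born_space \<Gamma> \<F> U)" by simp
  have "compose \<Gamma> (compose (carrier U) g f) s = compose \<Gamma> g (compose \<Gamma> f s)"
    using born_space_closed[OF s] by (auto simp: compose_def fun_eq_iff)
  then show "fmap (born_functor \<Gamma> \<F>) U W (compose (carrier U) g f) s =
      fmap (born_functor \<Gamma> \<F>) V W g (fmap (born_functor \<Gamma> \<F>) U V f s)"
    using s born_functor_map_closed[OF b vect_module[OF U] vect_module[OF V] f s]
    by (simp del: born_space_simps(1))
qed

text \<open>For a basis \<open>e\<close> of \<open>H\<close> indexed by \<open>F\<close>, this is
  the natural transformation that the Yoneda lemma attaches to the function sending \<gamma> \<in> F
  to \<open>e \<gamma>\<close> and all other points to zero.\<close>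

definition coordinates ::
    "'k ring \<Rightarrow> ('k, 'b) module \<Rightarrow> 'g set \<Rightarrow> 'g set \<Rightarrow> ('g \<Rightarrow> 'b) \<Rightarrow>
     ('k, 'a) module \<Rightarrow> ('b \<Rightarrow> 'a) \<Rightarrow> 'g \<Rightarrow> 'a" where
  "coordinates K H \<Gamma> F e V =
     (\<lambda>h\<in>lin K H V. \<lambda>\<gamma>\<in>\<Gamma>. if \<gamma> \<in> F then h (e \<gamma>) else \<zero>\<^bsub>V\<^esub>)"

context
  fixes K :: "'k ring" and H :: "('k, 'b) module" and \<Gamma> F :: "'g set" and \<F> e
  assumes b: "bornology \<Gamma> \<F>" and F: "F \<in> \<F>" and H: "basis K F H e"
begin

lemma coordinates_closed:
  assumes V: "module K V" and h: "h \<in> lin K H V"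
  shows "coordinates K H \<Gamma> F e V h \<in> carrier (born_space \<Gamma> \<F> V)"
proof -
  interpret V: module K V by (rule V)
  show ?thesis
    by (rule born_spaceI[OF b F])
      (use h basis_closed[OF H] in \<open>auto simp: coordinates_def lin_closed[OF h]\<close>)
qed

lemma coordinates_lin:
  assumes V: "module K V"
  shows "coordinates K H \<Gamma> F e V \<in> lin K (homs K H V) (born_space \<Gamma> \<F> V)"
proof -
  interpret V: module K V by (rule V)
  interpret hom: module K "homs K H V" by (rule homs_module[OF basis_module[OF H] V])
  have *: "f \<oplus>\<^bsub>homs K H V\<^esub> g \<in> lin K H V" if "f \<in> lin K H V" "g \<in> lin K H V" for f g
    using hom.a_closed that by simp
  have **: "a \<odot>\<^bsub>homs K H V\<^esub> f \<in> lin K H V" if "a \<in> carrier K" "f \<in> lin K H V" for a f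
    using hom.smult_closed that by simp
  show ?thesis
  proof (rule linI)
    show "coordinates K H \<Gamma> F e V \<in> extensional (carrier (homs K H V))"
      by (simp add: coordinates_def)
  qed (use * ** coordinates_closed[OF V] basis_closed[OF H] in
      \<open>auto simp: coordinates_def fun_eq_iff simp del: born_space_simps(1)\<close>)
qed

lemma coordinates_inj:
  assumes V: "module K V"
  shows "inj_on (coordinates K H \<Gamma> F e V) (lin K H V)"
proof (rule inj_onI)
  fix f g assume f: "f \<in> lin K H V" and g: "g \<in> lin K H V"
    and eq: "coordinates K H \<Gamma> F e V f = coordinates K H \<Gamma> F e V g"
  show "f = g"
  proof (rule basis_eqI[OF H V f g])
    fix \<gamma> assume \<gamma>: "\<gamma> \<in> F"
    then have "\<gamma> \<in> \<Gamma>" using bornology_subset[OF b F] by blast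
    then show "f (e \<gamma>) = g (e \<gamma>)"
      using fun_cong[OF eq, of \<gamma>] \<gamma> f g by (simp add: coordinates_def)
  qed
qed

text \<open>A linear map may be prescribed freely on the basis, so every function supported in
  \<open>F\<close> occurs. The image thus depends on \<open>F\<close> alone and not on the copy
  \<open>H\<close>, which makes the images for different bounded sets comparable.\<close>

lemma coordinates_image:
  assumes V: "module K V"
  shows "coordinates K H \<Gamma> F e V ` lin K H V =
    {s \<in> carrier (born_space \<Gamma> \<F> V). {\<gamma> \<in> \<Gamma>. s \<gamma> \<noteq> \<zero>\<^bsub>V\<^esub>} \<subseteq> F}"
proof (intro equalityI subsetI)
  fix s assume "s \<in> coordinates K H \<Gamma> F e V ` lin K H V"
  then show "s \<in> {s \<in> carrier (born_space \<Gamma> \<F> V). {\<gamma> \<in> \<Gamma>. s \<gamma> \<noteq> \<zero>\<^bsub>V\<^esub>} \<subseteq> F}"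
    using coordinates_closed[OF V]
    by (auto simp: coordinates_def simp del: born_space_simps(1) split: if_splits)
next
  fix s assume "s \<in> {s \<in> carrier (born_space \<Gamma> \<F> V). {\<gamma> \<in> \<Gamma>. s \<gamma> \<noteq> \<zero>\<^bsub>V\<^esub>} \<subseteq> F}"
  then have s: "s \<in> carrier (born_space \<Gamma> \<F> V)"
    and supp: "\<And>\<gamma>. \<gamma> \<in> \<Gamma> \<Longrightarrow> \<gamma> \<notin> F \<Longrightarrow> s \<gamma> = \<zero>\<^bsub>V\<^esub>" by blast+
  have "s \<gamma> \<in> carrier V" if "\<gamma> \<in> F" for \<gamma>
    using born_space_closed[OF s] bornology_subset[OF b F] that by blast
  then obtain h where h: "h \<in> lin K H V" and he: "\<And>\<gamma>. \<gamma> \<in> F \<Longrightarrow> h (e \<gamma>) = s \<gamma>"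
    using basis_lift[OF H V, of s] by blast
  have "s = coordinates K H \<Gamma> F e V h"
    using born_space_extensional[OF s] h he supp
    by (intro extensionalityI[of _ \<Gamma>]) (auto simp: coordinates_def)
  then show "s \<in> coordinates K H \<Gamma> F e V ` lin K H V" using h by blast
qed

end

lemma nat_trans_coordinates:
  fixes H :: "('k, 'u) module" and \<Gamma> :: "'g set" and K :: "'k ring"
  assumes b: "bornology \<Gamma> \<F>" and F: "F \<in> \<F>" and H: "basis K F H e"
  shows "nat_trans elts K (yoneda K H) (born_functor \<Gamma> \<F> :: ('k, 'u, 'g \<Rightarrow> 'u) vfunctor)
    (coordinates K H \<Gamma> F e)"
proof (rule nat_transI)
  fix V :: "('k, 'u) module" assume "vect elts K V"
  then show "coordinates K H \<Gamma> F e V \<in> lin K (fobj (yoneda K H) V) (fobj (born_functor \<Gamma> \<F>) V)"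
    using coordinates_lin[OF b F H vect_module] by simp
next
  fix V W :: "('k, 'u) module" and f h
  assume V: "vect elts K V" and W: "vect elts K W" and f: "f \<in> lin K V W"
    and "h \<in> carrier (fobj (yoneda K H) V)"
  then have h: "h \<in> lin K H V" by simp
  show "coordinates K H \<Gamma> F e W (fmap (yoneda K H) V W f h) =
      fmap (born_functor \<Gamma> \<F>) V W f (coordinates K H \<Gamma> F e V h)"
    using coordinates_closed[OF b F H vect_module[OF V] h] h
      lin_compose[OF h f basis_module[OF H]] basis_closed[OF H]
      lin_zero[OF f vect_module[OF V] vect_module[OF W]]
    by (simp del: born_space_simps(1))
      (auto simp: coordinates_def compose_def fun_eq_iff simp del: born_space_simps(1))
qed

text \<open>A bornology on a small set is small, being contained in the power set. It is enumerated
  bijectively by some \<open>elts I\<close>, because index sets of this form are the ones allowed in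
  \<open>ind_vect_op\<close>.\<close>

lemma (in grothendieck_universe) directed_union_born:
  fixes \<Gamma> :: "'g set" and K :: "'k ring"
  assumes K: "cring K" and sK: "small elts (carrier K)"
    and b: "bornology \<Gamma> \<F>" and small: "small elts \<Gamma>"
  shows "\<exists>I r G c. (\<forall>i\<in>elts I. vect elts K (G i)) \<and>
    directed_union elts K (elts I) r (\<lambda>i. yoneda K (G i))
      (born_functor \<Gamma> \<F> :: ('k, 'u, 'g \<Rightarrow> 'u) vfunctor) c"
proof -
  have "\<F> \<subseteq> Pow \<Gamma>" using b by (simp add: bornology_def)
  then have "small elts \<F>" using small_subset small_Pow[OF small] by blast
  then obtain I j where "bij_betw j \<F> (elts I)" by (auto simp: small_def eqpoll_def)
  then obtain F where F: "bij_betw F (elts I) \<F>" using bij_betw_inv by blast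
  then have F_mem: "F i \<in> \<F>" if "i \<in> elts I" for i using that by (auto dest: bij_betwE)
  have F_surj: "\<exists>i\<in>elts I. F i = A" if "A \<in> \<F>" for A using that F by (auto simp: bij_betw_def)
  \<comment> \<open>Inclusion of bounded sets, pulled back to the indices; it is antisymmetric
    because \<open>F\<close> is injective, and directed because bounded sets are closed under
    unions.\<close>
  define r where "r = {(i, k). i \<in> elts I \<and> k \<in> elts I \<and> F i \<subseteq> F k}"
  have dir: "directed_poset (elts I) r"
    unfolding directed_poset_def
  proof (intro conjI ballI)
    show "elts I \<noteq> {}" using F_surj[OF bornology_empty[OF b]] by auto
    show "partial_order_on (elts I) r"
      using F by (auto simp: r_def partial_order_on_def preorder_on_def refl_on_def trans_def
          antisym_def bij_betw_def inj_on_def)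
    show "\<exists>m\<in>elts I. (i, m) \<in> r \<and> (k, m) \<in> r" if "i \<in> elts I" "k \<in> elts I" for i k
      using F_surj[OF bornology_Un[OF b F_mem[OF that(1)] F_mem[OF that(2)]]] that
      by (auto simp: r_def)
  qed
  have "\<exists>He. vect elts K (fst He :: ('k, 'u) module) \<and> basis K (F i) (fst He) (snd He)"
    if "i \<in> elts I" for i
  proof -
    have "small elts (F i)"
      using bornology_subset[OF b F_mem[OF that]] small by (rule small_subset)
    from small_basis[OF K sK this] show ?thesis by auto
  qed
  then obtain He where He: "\<And>i. i \<in> elts I \<Longrightarrow> vect elts K (fst (He i) :: ('k, 'u) module)"
    "\<And>i. i \<in> elts I \<Longrightarrow> basis K (F i) (fst (He i)) (snd (He i))"
    by metis
  define G where "G i = fst (He i)" for i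
  define e where "e i = snd (He i)" for i
  have G: "vect elts K (G i)" "basis K (F i) (G i) (e i)" if "i \<in> elts I" for i
    using He that by (simp_all add: G_def e_def)
  note image = coordinates_image[OF b F_mem G(2) vect_module]
  have "directed_union elts K (elts I) r (\<lambda>i. yoneda K (G i))
    (born_functor \<Gamma> \<F>) (\<lambda>i. coordinates K (G i) \<Gamma> (F i) (e i))"
  proof (unfold_locales)
    show "inj_on (coordinates K (G i) \<Gamma> (F i) (e i) V) (carrier (fobj (yoneda K (G i)) V))"
      if "i \<in> elts I" "vect elts K V" for i and V :: "('k, 'u) module"
      using coordinates_inj[OF b F_mem[OF that(1)] G(2)[OF that(1)] vect_module[OF that(2)]] by simp
    show "coordinates K (G i) \<Gamma> (F i) (e i) V ` carrier (fobj (yoneda K (G i)) V)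
        \<subseteq> coordinates K (G k) \<Gamma> (F k) (e k) V ` carrier (fobj (yoneda K (G k)) V)"
      if "i \<in> elts I" "k \<in> elts I" "(i, k) \<in> r" "vect elts K V" for i k and V :: "('k, 'u) module"
      using that image[OF that(1,1,4)] image[OF that(2,2,4)] by (auto simp: r_def)
    show "carrier (fobj (born_functor \<Gamma> \<F>) V)
        \<subseteq> (\<Union>i\<in>elts I. coordinates K (G i) \<Gamma> (F i) (e i) V ` carrier (fobj (yoneda K (G i)) V))"
      if "vect elts K V" for V :: "('k, 'u) module"
    proof
      fix s assume "s \<in> carrier (fobj (born_functor \<Gamma> \<F>) V)"
      then have s: "s \<in> carrier (born_space \<Gamma> \<F> V)" by simp
      obtain i where i: "i \<in> elts I" "F i = {\<gamma> \<in> \<Gamma>. s \<gamma> \<noteq> \<zero>\<^bsub>V\<^esub>}"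
        using F_surj[OF born_space_support[OF s]] by blast
      then have "s \<in> coordinates K (G i) \<Gamma> (F i) (e i) V ` lin K (G i) V"
        using s image[OF i(1,1) that] by auto
      then show "s \<in> (\<Union>i\<in>elts I.
          coordinates K (G i) \<Gamma> (F i) (e i) V ` carrier (fobj (yoneda K (G i)) V))"
        using i(1) by auto
    qed
  qed (auto intro: dir linear_functor_yoneda G linear_functor_born[OF b small]
      nat_trans_coordinates[OF b F_mem G(2)])
  with G show ?thesis by blast
qed

section \<open>Coends\<close>

context
  fixes K :: "'k ring" and Ob :: "'i set" and Hom :: "'i \<Rightarrow> 'i \<Rightarrow> 'h set"
    and T :: "'i \<Rightarrow> 'i \<Rightarrow> ('k, 'a) module" and L R :: "'i \<Rightarrow> 'i \<Rightarrow> 'h \<Rightarrow> 'a \<Rightarrow> 'a"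
  assumes K: "cring K" and T: "\<And>c. c \<in> Ob \<Longrightarrow> module K (T c c)"
    and L: "\<And>c d f t. c \<in> Ob \<Longrightarrow> d \<in> Ob \<Longrightarrow> f \<in> Hom c d \<Longrightarrow> t \<in> carrier (T d c) \<Longrightarrow>
      L c d f t \<in> carrier (T c c)"
    and R: "\<And>c d f t. c \<in> Ob \<Longrightarrow> d \<in> Ob \<Longrightarrow> f \<in> Hom c d \<Longrightarrow> t \<in> carrier (T d c) \<Longrightarrow>
      R c d f t \<in> carrier (T d d)"
begin

private abbreviation "S \<equiv> direct_sum Ob (\<lambda>c. T c c)"
private abbreviation "N \<equiv> coend_ker K Ob Hom T L R"
private abbreviation "C \<equiv> coend K Ob Hom T L R"
private abbreviation "\<kappa> \<equiv> coend_inject K Ob Hom T L R"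
private abbreviation "\<iota> \<equiv> inject Ob (\<lambda>c. T c c)"
private abbreviation "rels \<equiv> {\<iota> c (L c d f t) \<ominus>\<^bsub>S\<^esub> \<iota> d (R c d f t) | c d f t.
          c \<in> Ob \<and> d \<in> Ob \<and> f \<in> Hom c d \<and> t \<in> carrier (T d c)}"

interpretation S: module K S
  by (rule direct_sum_module[OF K T])

private lemma \<iota>_closed: "c \<in> Ob \<Longrightarrow> t \<in> carrier (T c c) \<Longrightarrow> \<iota> c t \<in> carrier S"
  by (rule inject_closed[where K = K and M = "\<lambda>c. T c c", OF K T])

private lemma ker_eq: "N = span_of K S rels"
  by (simp add: coend_ker_def Let_def)

private lemma rels_closed: "rels \<subseteq> carrier S"
proof
  fix x assume "x \<in> rels"
  then obtain c d f t where x: "x = \<iota> c (L c d f t) \<ominus>\<^bsub>S\<^esub> \<iota> d (R c d f t)"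
    and *: "c \<in> Ob" "d \<in> Ob" "f \<in> Hom c d" "t \<in> carrier (T d c)" by blast
  show "x \<in> carrier S"
    unfolding x by (intro S.minus_closed \<iota>_closed L R *)
qed

interpretation Q: quotient_module K S N
  by (intro quotient_module.intro quotient_module_axioms.intro S.module_axioms)
    (simp only: ker_eq submodule_span_of[OF S.module_axioms rels_closed])

private lemma coend_eq: "C = quotient_space S N"
  by (simp add: coend_def)

private lemma coend_inject_eq:
  "\<kappa> c t = N +>\<^bsub>S\<^esub> \<iota> c t"
  by (simp add: coend_inject_def)

lemma coend_module: "module K (C)"
  unfolding coend_eq by (rule Q.quotient_module)

lemma coend_inject_lin:
  assumes c: "c \<in> Ob"
  shows "(\<lambda>t\<in>carrier (T c c). \<kappa> c t) \<in>
    lin K (T c c) (C)"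
proof (rule lin_restrictI[OF T[OF c]]; unfold coend_eq coend_inject_eq)
  fix t assume t: "t \<in> carrier (T c c)"
  show "N +>\<^bsub>S\<^esub> \<iota> c t \<in>
      carrier (quotient_space S (N))"
    unfolding Q.quotient_carrier by (intro imageI \<iota>_closed c t)
next
  fix s t assume s: "s \<in> carrier (T c c)" and t: "t \<in> carrier (T c c)"
  show "N +>\<^bsub>S\<^esub> \<iota> c (s \<oplus>\<^bsub>T c c\<^esub> t) =
      (N +>\<^bsub>S\<^esub> \<iota> c s)
      \<oplus>\<^bsub>quotient_space S (N)\<^esub> (N +>\<^bsub>S\<^esub> \<iota> c t)"
    unfolding Q.coset_add[OF \<iota>_closed[OF c s] \<iota>_closed[OF c t]]
    using inject_add[where K = K and M = "\<lambda>c. T c c", OF K T c s t] by simp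
next
  fix a t assume a: "a \<in> carrier K" and t: "t \<in> carrier (T c c)"
  show "N +>\<^bsub>S\<^esub> \<iota> c (a \<odot>\<^bsub>T c c\<^esub> t) =
      a \<odot>\<^bsub>quotient_space S (N)\<^esub> (N +>\<^bsub>S\<^esub> \<iota> c t)"
    unfolding Q.coset_smult[OF a \<iota>_closed[OF c t]]
    using inject_smult[where K = K and M = "\<lambda>c. T c c", OF K T c a t] by simp
qed

lemma coend_relation:
  assumes "c \<in> Ob" "d \<in> Ob" "f \<in> Hom c d" "t \<in> carrier (T d c)"
  shows "\<kappa> c (L c d f t) = \<kappa> d (R c d f t)"
  unfolding coend_inject_eq
proof (rule Q.coset_eqI)
  have "\<iota> c (L c d f t) \<ominus>\<^bsub>S\<^esub> \<iota> d (R c d f t) \<in> rels"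
    by (intro CollectI exI[of _ c] exI[of _ d] exI[of _ f] exI[of _ t]) (simp add: assms)
  then show "\<iota> c (L c d f t) \<ominus>\<^bsub>S\<^esub> \<iota> d (R c d f t) \<in> N"
    unfolding ker_eq by (rule subsetD[OF span_of_superset])
qed (intro \<iota>_closed L R assms)+

text \<open>Zero is a case of its own because \<open>Ob\<close> may be empty, in which case nothing
  is injected.\<close>

lemma coend_induct [consumes 1, case_names zero inject add]:
  assumes z: "z \<in> carrier (C)"
    and zero: "P \<zero>\<^bsub>C\<^esub>"
    and inject: "\<And>c t. c \<in> Ob \<Longrightarrow> t \<in> carrier (T c c) \<Longrightarrow> P (\<kappa> c t)"
    and add: "\<And>z w. z \<in> carrier (C) \<Longrightarrow> w \<in> carrier (C) \<Longrightarrow>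
      P z \<Longrightarrow> P w \<Longrightarrow> P (z \<oplus>\<^bsub>C\<^esub> w)"
  shows "P z"
proof -
  have "P (N +>\<^bsub>S\<^esub> s)" if "s \<in> carrier S" for s
  proof (rule direct_sum_induct[where K = K and S = Ob and M = "\<lambda>c. T c c", OF K T that])
    show "P (N +>\<^bsub>S\<^esub> \<zero>\<^bsub>S\<^esub>)"
      using zero by (simp only: coend_eq Q.quotient_zero)
    show "P (N +>\<^bsub>S\<^esub> \<iota> c t)" if "c \<in> Ob" "t \<in> carrier (T c c)" for c t
      using inject[OF that] by (simp only: coend_inject_eq)
    show "P (N +>\<^bsub>S\<^esub> (s \<oplus>\<^bsub>S\<^esub> t))"
      if "s \<in> carrier S" "t \<in> carrier S" "P (N +>\<^bsub>S\<^esub> s)"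
        "P (N +>\<^bsub>S\<^esub> t)" for s t
      using add[OF _ _ that(3,4)] that(1,2)
      by (simp only: coend_eq Q.quotient_carrier Q.coset_add imageI)
  qed
  then show ?thesis
    using z unfolding coend_eq Q.quotient_carrier by blast
qed

text \<open>Dinaturality says precisely that the map induced on the direct sum vanishes on the
  relations, so it descends to the quotient.\<close>

lemma coend_lift:
  assumes P: "module K P" and g: "\<And>c. c \<in> Ob \<Longrightarrow> g c \<in> lin K (T c c) P"
    and dinatural: "\<And>c d f t. c \<in> Ob \<Longrightarrow> d \<in> Ob \<Longrightarrow> f \<in> Hom c d \<Longrightarrow> t \<in> carrier (T d c) \<Longrightarrow>
      g c (L c d f t) = g d (R c d f t)"
  shows "\<exists>m\<in>lin K (C) P.
    \<forall>c\<in>Ob. \<forall>t\<in>carrier (T c c). m (\<kappa> c t) = g c t"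
proof -
  have "\<exists>k\<in>lin K S P. \<forall>c\<in>Ob. \<forall>t\<in>carrier (T c c). k (\<iota> c t) = g c t"
    by (rule direct_sum_lift[where M = "\<lambda>c. T c c", OF K T P g])
  then obtain k where k: "k \<in> lin K S P"
    and k_\<iota>: "\<forall>c\<in>Ob. \<forall>t\<in>carrier (T c c). k (\<iota> c t) = g c t" ..
  have "k x = \<zero>\<^bsub>P\<^esub>" if "x \<in> rels" for x
  proof -
    obtain c d f t where x: "x = \<iota> c (L c d f t) \<ominus>\<^bsub>S\<^esub> \<iota> d (R c d f t)"
      and *: "c \<in> Ob" "d \<in> Ob" "f \<in> Hom c d" "t \<in> carrier (T d c)" using \<open>x \<in> rels\<close> by blast
    have "k (\<iota> c (L c d f t)) = k (\<iota> d (R c d f t))"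
      using k_\<iota> * L[OF *] R[OF *] dinatural[OF *] by simp
    then show ?thesis
      unfolding x using * L[OF *] R[OF *]
      by (subst lin_minus_eq_zero_iff[OF k S.module_axioms P]) (auto intro!: \<iota>_closed simp del: direct_sum_simps)
  qed
  then have "k x = \<zero>\<^bsub>P\<^esub>" if "x \<in> N" for x
    using span_of_kernel[OF S.module_axioms P k rels_closed] that unfolding ker_eq by blast
  then have "\<exists>m\<in>lin K (C) P.
      \<forall>x\<in>carrier S. m (N +>\<^bsub>S\<^esub> x) = k x"
    unfolding coend_eq by (rule Q.quotient_lift[OF P k])
  then obtain m where m: "m \<in> lin K (C) P"
    and m_eq: "\<forall>x\<in>carrier S. m (N +>\<^bsub>S\<^esub> x) = k x" ..
  show ?thesis
  proof (intro bexI[OF _ m] ballI)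
    fix c t assume "c \<in> Ob" "t \<in> carrier (T c c)"
    then show "m (\<kappa> c t) = g c t"
      unfolding coend_inject_eq using m_eq \<iota>_closed k_\<iota> by (simp del: direct_sum_simps)
  qed
qed

end

section \<open>Day convolution\<close>

locale day_convolution =
  fixes elts :: "'u \<Rightarrow> 'u set" and K :: "'k ring"
    and X :: "('k, 'u, 'a) vfunctor" and Y :: "('k, 'u, 'b) vfunctor"
  assumes X: "linear_functor elts K X" and Y: "linear_functor elts K Y"
begin

abbreviation XY :: "('k, 'u) vpair \<Rightarrow> ('k, ('a \<times> 'b \<Rightarrow> 'k) set) module" where
  "XY c \<equiv> tensor K (fobj X (fst c)) (fobj Y (snd c))"

abbreviation homV :: "('k, 'u) module \<Rightarrow> ('k, 'u) vpair \<Rightarrow>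
    ('k, ('u \<times> 'u \<Rightarrow> 'k) set \<Rightarrow> 'u) module" where
  "homV V c \<equiv> homs K (tensor K (fst c) (snd c)) V"

abbreviation gen where "gen \<equiv> day_gen elts K X Y"

abbreviation "Ob \<equiv> pair_objs elts K"
abbreviation "T \<equiv> day_integrand K X Y"
abbreviation "Day \<equiv> day_space elts K X Y"
abbreviation "Day_map \<equiv> day_map elts K X Y"

abbreviation "triple V c x y h \<equiv>
  pure K (XY c) (homV V c) (pure K (fobj X (fst c)) (fobj Y (snd c)) x y) h"

lemma pair_objsD:
  assumes "c \<in> Ob"
  shows "vect elts K (fst c)" "vect elts K (snd c)" "module K (fst c)" "module K (snd c)"
    "module K (fobj X (fst c))" "module K (fobj Y (snd c))" "module K (XY c)"
    "module K (tensor K (fst c) (snd c))"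
proof -
  show v: "vect elts K (fst c)" "vect elts K (snd c)"
    using assms by (auto simp: pair_objs_def)
  then show m: "module K (fst c)" "module K (snd c)" by (simp_all add: vect_module)
  show x: "module K (fobj X (fst c))" "module K (fobj Y (snd c))"
    using X Y v by (auto intro: linear_functor_module)
  show "module K (XY c)" "module K (tensor K (fst c) (snd c))"
    using m x by (simp_all add: tensor_module)
qed

lemma homV_module: "module K V \<Longrightarrow> c \<in> Ob \<Longrightarrow> module K (homV V c)"
  by (intro homs_module pair_objsD)

lemma integrand_module:
  assumes "module K V" "c \<in> Ob" "d \<in> Ob"
  shows "module K (T V d c)"
  unfolding day_integrand_def
  using assms by (intro tensor_module homs_module pair_objsD)

context
  fixes V :: "('k, 'u) module" and c d :: "('k, 'u) vpair" and fg :: "('u \<Rightarrow> 'u) \<times> ('u \<Rightarrow> 'u)"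
  assumes V: "module K V" and c: "c \<in> Ob" and d: "d \<in> Ob"
    and fg: "fg \<in> pair_homs K c d"
begin

private lemma f: "fst fg \<in> lin K (fst c) (fst d)" and g: "snd fg \<in> lin K (snd c) (snd d)"
  using fg by (auto simp: pair_homs_def)

private abbreviation "q \<equiv> tensor_map K (fst c) (snd c) (fst d) (snd d) (fst fg) (snd fg)"

private lemma q: "q \<in> lin K (tensor K (fst c) (snd c)) (tensor K (fst d) (snd d))"
  by (rule tensor_map_lin) (intro pair_objsD c d f g)+

private lemma Xf: "fmap X (fst c) (fst d) (fst fg) \<in> lin K (fobj X (fst c)) (fobj X (fst d))"
  and Yg: "fmap Y (snd c) (snd d) (snd fg) \<in> lin K (fobj Y (snd c)) (fobj Y (snd d))"
  using linear_functor_lin[OF X _ _ f] linear_functor_lin[OF Y _ _ g] pair_objsD[OF c] pair_objsD[OF d]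
  by auto

private lemma precompose:
  "(\<lambda>h\<in>lin K (tensor K (fst d) (snd d)) V. compose (carrier (tensor K (fst c) (snd c))) h q)
    \<in> lin K (homV V d) (homV V c)"
  by (rule homs_precompose[OF pair_objsD(8)[OF c] pair_objsD(8)[OF d] V q])

lemma day_left_lin:
  "day_left K X Y V c d fg \<in> lin K (T V d c) (T V c c)"
  unfolding day_left_def Let_def day_integrand_def
  by (rule tensor_map_lin[OF pair_objsD(7)[OF c] homV_module[OF V d] pair_objsD(7)[OF c]
        homV_module[OF V c] lin_id[OF pair_objsD(7)[OF c]] precompose])

lemma day_left_pure:
  assumes "t \<in> carrier (XY c)" "h \<in> lin K (tensor K (fst d) (snd d)) V"
  shows "day_left K X Y V c d fg (pure K (XY c) (homV V d) t h) =
    pure K (XY c) (homV V c) t (compose (carrier (tensor K (fst c) (snd c))) h q)"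
  unfolding day_left_def Let_def
  using tensor_map_pure[OF pair_objsD(7)[OF c] homV_module[OF V d] pair_objsD(7)[OF c]
        homV_module[OF V c] lin_id[OF pair_objsD(7)[OF c]] precompose, of t h] assms
  by simp

lemma day_right_lin:
  "day_right K X Y V c d fg \<in> lin K (T V d c) (T V d d)"
  unfolding day_right_def Let_def day_integrand_def
  using lin_id[OF homV_module[OF V d]]
  by (intro tensor_map_lin[OF pair_objsD(7)[OF c] homV_module[OF V d] pair_objsD(7)[OF d]
        homV_module[OF V d]] tensor_map_lin[OF pair_objsD(5,6)[OF c] pair_objsD(5,6)[OF d] Xf Yg])
    simp

lemma day_right_pure:
  assumes x: "x \<in> carrier (fobj X (fst c))" and y: "y \<in> carrier (fobj Y (snd c))"
    and h: "h \<in> lin K (tensor K (fst d) (snd d)) V"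
  shows "day_right K X Y V c d fg (pure K (XY c) (homV V d)
      (pure K (fobj X (fst c)) (fobj Y (snd c)) x y) h) =
    pure K (XY d) (homV V d) (pure K (fobj X (fst d)) (fobj Y (snd d))
      (fmap X (fst c) (fst d) (fst fg) x) (fmap Y (snd c) (snd d) (snd fg) y)) h"
proof -
  note p = tensor_map_lin[OF pair_objsD(5,6)[OF c] pair_objsD(5,6)[OF d] Xf Yg]
    tensor_map_pure[OF pair_objsD(5,6)[OF c] pair_objsD(5,6)[OF d] Xf Yg x y]
  have id: "(\<lambda>h\<in>lin K (tensor K (fst d) (snd d)) V. h) \<in> lin K (homV V d) (homV V d)"
    using lin_id[OF homV_module[OF V d]] by simp
  show ?thesis
    unfolding day_right_def Let_def
    using tensor_map_pure[OF pair_objsD(7)[OF c] homV_module[OF V d] pair_objsD(7)[OF d]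
        homV_module[OF V d] p(1) id pure_closed[OF pair_objsD(5,6)[OF c] x y], of h] h p(2)
    by simp
qed

end

section \<open>The values of the tensor product: generators, relation and universal property\<close>

context
  fixes V :: "('k, 'u) module"
  assumes V: "vect elts K V"
begin

private lemma V': "module K V"
  using V by (rule vect_module)

private lemma K: "cring K"
  using V' by (rule module.axioms)

text \<open>The standing assumptions of the coend lemmas, instantiated to the integrand at
  \<open>V\<close>.\<close>

private lemmas coend_facts = K integrand_module[OF V']
  lin_closed[OF day_left_lin[OF V']] lin_closed[OF day_right_lin[OF V']]

lemma day_space_module: "module K (Day V)"
  unfolding day_space_def by (rule coend_module) (rule coend_facts; assumption)+

private abbreviation "cinj c t \<equiv> coend_inject K Ob (pair_homs K)
  (T V) (day_left K X Y V) (day_right K X Y V) c t"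

private lemma cinj_lin:
  assumes "c \<in> Ob"
  shows "(\<lambda>t\<in>carrier (T V c c). cinj c t) \<in>
    lin K (T V c c) (Day V)"
  unfolding day_space_def
  by (rule coend_inject_lin[OF _ _ _ _ assms]) (rule coend_facts; assumption)+

private lemma cinj_add:
  "c \<in> Ob \<Longrightarrow> s \<in> carrier (T V c c) \<Longrightarrow>
    t \<in> carrier (T V c c) \<Longrightarrow>
    cinj c (s \<oplus>\<^bsub>T V c c\<^esub> t) = cinj c s \<oplus>\<^bsub>Day V\<^esub> cinj c t"
  using lin_add[OF cinj_lin, of c s t]
    abelian_monoid.a_closed[OF abelian_group.axioms(1)[OF module.axioms(2)[OF integrand_module[OF V']]]]
  by simp

private lemma cinj_smult:
  "c \<in> Ob \<Longrightarrow> a \<in> carrier K \<Longrightarrow> t \<in> carrier (T V c c) \<Longrightarrow>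
    cinj c (a \<odot>\<^bsub>T V c c\<^esub> t) = a \<odot>\<^bsub>Day V\<^esub> cinj c t"
  using lin_smult[OF cinj_lin, of c a t] module.smult_closed[OF integrand_module[OF V']]
  by simp

private lemma cinj_closed:
  "c \<in> Ob \<Longrightarrow> t \<in> carrier (T V c c) \<Longrightarrow>
    cinj c t \<in> carrier (Day V)"
  using lin_closed[OF cinj_lin, of c t] by simp

context
  fixes H0 H1 :: "('k, 'u) module"
  assumes H0: "vect elts K H0" and H1: "vect elts K H1"
begin

private lemma c: "(H0, H1) \<in> Ob"
  using H0 H1 by (simp add: pair_objs_def)

private lemmas mods = pair_objsD(5-8)[OF c, simplified] homV_module[OF V' c, simplified]

private lemmas pure_XY = bilinear_pure[OF mods(1,2)] pure_closed[OF mods(1,2)]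

private lemmas pure_T = bilinear_pure[OF mods(3,5)] pure_closed[OF mods(3,5)]

private lemma gen_eq: "gen V H0 H1 x y h = cinj (H0, H1)
    (pure K (tensor K (fobj X H0) (fobj Y H1)) (homs K (tensor K H0 H1) V)
      (pure K (fobj X H0) (fobj Y H1) x y) h)"
  by (simp add: day_gen_def)

private lemma T_eq: "T V (H0, H1) (H0, H1) =
    tensor K (tensor K (fobj X H0) (fobj Y H1)) (homs K (tensor K H0 H1) V)"
  by (simp add: day_integrand_def)

lemma gen_closed:
  "x \<in> carrier (fobj X H0) \<Longrightarrow> y \<in> carrier (fobj Y H1) \<Longrightarrow> h \<in> lin K (tensor K H0 H1) V \<Longrightarrow>
    gen V H0 H1 x y h \<in> carrier (Day V)"
  unfolding gen_eq by (rule cinj_closed[OF c]) (simp add: T_eq pure_XY pure_T)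

text \<open>Together with \<open>gen_lin\<close> this says that a generator is trilinear, as a
  composite of two pure tensors and the injection into the coend. The variables are grouped in the
  way in which \<open>day_lift\<close> expects them.\<close>

lemma gen_bilinear:
  assumes h: "h \<in> lin K (tensor K H0 H1) V"
  shows "bilinear K (fobj X H0) (fobj Y H1) (Day V) (\<lambda>x y. gen V H0 H1 x y h)"
proof -
  note cl = pure_XY(2) pure_T(2)[of _ h] h
  note b = bilinear_add_left[OF mods(1,2) pure_XY(1)] bilinear_add_right[OF mods(1,2) pure_XY(1)]
    bilinear_smult_left[OF mods(1,2) pure_XY(1)] bilinear_smult_right[OF mods(1,2) pure_XY(1)]
    bilinear_add_left[OF mods(3,5) pure_T(1)] bilinear_smult_left[OF mods(3,5) pure_T(1)]
  note j = cinj_add[OF c, unfolded T_eq] cinj_smult[OF c, unfolded T_eq]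
  show ?thesis
    by (rule bilinearI[OF mods(1,2) gen_closed[OF _ _ h]]; assumption?)
      (simp_all add: gen_eq b[simplified] j[simplified] cl)
qed

lemma gen_lin:
  assumes x: "x \<in> carrier (fobj X H0)" and y: "y \<in> carrier (fobj Y H1)"
  shows "(\<lambda>h\<in>lin K (tensor K H0 H1) V. gen V H0 H1 x y h) \<in>
    lin K (homs K (tensor K H0 H1) V) (Day V)"
proof -
  note cl = pure_XY(2)[OF x y] pure_T(2)[OF pure_XY(2)[OF x y]]
  note b = bilinear_add_right[OF mods(3,5) pure_T(1) cl(1)]
    bilinear_smult_right[OF mods(3,5) pure_T(1) _ cl(1)]
  note j = cinj_add[OF c, unfolded T_eq] cinj_smult[OF c, unfolded T_eq]
  have "(\<lambda>h\<in>carrier (homs K (tensor K H0 H1) V). gen V H0 H1 x y h) \<in>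
    lin K (homs K (tensor K H0 H1) V) (Day V)"
  proof (rule lin_restrictI[OF mods(5)])
    show "gen V H0 H1 x y h \<in> carrier (Day V)"
      if "h \<in> carrier (homs K (tensor K H0 H1) V)" for h
      using gen_closed[OF x y] that by simp
    show "gen V H0 H1 x y (h \<oplus>\<^bsub>homs K (tensor K H0 H1) V\<^esub> k) =
        gen V H0 H1 x y h \<oplus>\<^bsub>Day V\<^esub> gen V H0 H1 x y k"
      if "h \<in> carrier (homs K (tensor K H0 H1) V)" "k \<in> carrier (homs K (tensor K H0 H1) V)" for h k
      using b(1)[OF that] j(1)[OF cl(2)[OF that(1)] cl(2)[OF that(2)]]
      by (simp add: gen_eq del: homs_simps)
    show "gen V H0 H1 x y (a \<odot>\<^bsub>homs K (tensor K H0 H1) V\<^esub> h) =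
        a \<odot>\<^bsub>Day V\<^esub> gen V H0 H1 x y h"
      if "a \<in> carrier K" "h \<in> carrier (homs K (tensor K H0 H1) V)" for a h
      using b(2)[OF that] j(2)[OF that(1) cl(2)[OF that(2)]]
      by (simp add: gen_eq del: homs_simps)
  qed
  then show ?thesis by simp
qed

end

text \<open>The coend relation for the arrow \<open>(f, g)\<close>, read on the triple
  \<open>(x \<otimes> y) \<otimes> h\<close>: maps applied to the vectors may be moved into
  \<open>h\<close> by precomposition with \<open>f \<otimes> g\<close>. The passage to normal forms
  rests on this identity.\<close>

lemma gen_relation:
  assumes H0: "vect elts K H0" and H1: "vect elts K H1"
    and H0': "vect elts K H0'" and H1': "vect elts K H1'"
    and f: "f \<in> lin K H0 H0'" and g: "g \<in> lin K H1 H1'"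
    and x: "x \<in> carrier (fobj X H0)" and y: "y \<in> carrier (fobj Y H1)"
    and h: "h \<in> lin K (tensor K H0' H1') V"
  shows "gen V H0' H1' (fmap X H0 H0' f x) (fmap Y H1 H1' g y) h =
    gen V H0 H1 x y (compose (carrier (tensor K H0 H1)) h (tensor_map K H0 H1 H0' H1' f g))"
proof -
  let ?c = "(H0, H1)" and ?d = "(H0', H1')"
  let ?p = "pure K (fobj X H0) (fobj Y H1) x y"
  let ?t = "pure K (XY ?c) (homV V ?d) ?p h"
  have c: "?c \<in> Ob" and d: "?d \<in> Ob"
    using H0 H1 H0' H1' by (simp_all add: pair_objs_def)
  have fg: "(f, g) \<in> pair_homs K ?c ?d" using f g by (simp add: pair_homs_def)
  have p: "?p \<in> carrier (XY ?c)"
    using pure_closed[OF pair_objsD(5,6)[OF c]] x y by simp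
  have t: "?t \<in> carrier (T V ?d ?c)"
    unfolding day_integrand_def
    using pure_closed[OF pair_objsD(7)[OF c] homV_module[OF V' d] p] h by simp
  have "cinj ?c (day_left K X Y V ?c ?d (f, g) ?t) = cinj ?d (day_right K X Y V ?c ?d (f, g) ?t)"
    using c d fg t
    by (intro coend_relation[where K = K and Ob = Ob and Hom = "pair_homs K"
          and T = "T V" and L = "day_left K X Y V"
          and R = "day_right K X Y V" and c = ?c and d = ?d and f = "(f, g)"]; assumption?) (rule coend_facts; assumption)+
  then show ?thesis
    using day_left_pure[OF V' c d fg p, of h] day_right_pure[OF V' c d fg, of x y h] x y h
    by (simp add: day_gen_def)
qed

text \<open>The layers of the construction are removed in turn: the coend reduces to single
  integrands, and these are generated additively by triples.\<close>

lemma day_induct [consumes 1, case_names gen add]: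
  assumes z: "z \<in> carrier (Day V)"
    and gen: "\<And>H0 H1 x y h. vect elts K H0 \<Longrightarrow> vect elts K H1 \<Longrightarrow> x \<in> carrier (fobj X H0) \<Longrightarrow>
      y \<in> carrier (fobj Y H1) \<Longrightarrow> h \<in> lin K (tensor K H0 H1) V \<Longrightarrow> P (gen V H0 H1 x y h)"
    and add: "\<And>z w. z \<in> carrier (Day V) \<Longrightarrow>
      w \<in> carrier (Day V) \<Longrightarrow> P z \<Longrightarrow> P w \<Longrightarrow> P (z \<oplus>\<^bsub>Day V\<^esub> w)"
  shows "P z"
proof -
  have inject: "P (cinj c t)"
    if c: "c \<in> Ob" and t: "t \<in> carrier (T V c c)" for c t
  proof -
    obtain H0 H1 where c_eq: "c = (H0, H1)" by fastforce
    from t have t': "t \<in> carrier (tensor K (XY c) (homV V c))" by (simp add: day_integrand_def)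
    show ?thesis
    proof (rule tensor3_induct[OF pair_objsD(5,6)[OF c] homV_module[OF V' c] t'])
      show "P (cinj c (triple V c x y h))"
        if "x \<in> carrier (fobj X (fst c))" "y \<in> carrier (fobj Y (snd c))" "h \<in> carrier (homV V c)"
        for x y h
        using gen[of H0 H1 x y h] that pair_objsD(1,2)[OF c] by (simp add: day_gen_def c_eq)
      show "P (cinj c (s \<oplus>\<^bsub>tensor K (XY c) (homV V c)\<^esub> t))"
        if "s \<in> carrier (tensor K (XY c) (homV V c))" "t \<in> carrier (tensor K (XY c) (homV V c))"
          "P (cinj c s)" "P (cinj c t)" for s t
        using add[OF cinj_closed[OF c] cinj_closed[OF c] that(3,4)] cinj_add[OF c, of s t] that(1,2)
        by (simp add: day_integrand_def)
    qed
  qed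
  have "P \<zero>\<^bsub>Day V\<^esub>"
  proof -
    \<comment> \<open>Zero is obtained as the image of the zero of one integrand, and
      \<open>V\<close> is a space at hand to provide an object.\<close>
    have c: "(V, V) \<in> Ob" using V by (simp add: pair_objs_def)
    interpret Tm: module K "T V (V, V) (V, V)" by (rule integrand_module[OF V' c c])
    have "cinj (V, V) \<zero>\<^bsub>T V (V, V) (V, V)\<^esub> = \<zero>\<^bsub>Day V\<^esub>"
      using lin_zero[OF cinj_lin[OF c] Tm.module_axioms day_space_module] by simp
    then show ?thesis using inject[OF c Tm.zero_closed] by simp
  qed
  with z inject add show ?thesis
    unfolding day_space_def
    by (intro coend_induct[where P = P and z = z and K = K and Ob = Ob
        and Hom = "pair_homs K" and T = "T V" and L = "day_left K X Y V"
        and R = "day_right K X Y V"]) (blast intro: coend_facts)+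
qed

lemma day_eqI:
  assumes f: "f \<in> lin K (Day V) P" and g: "g \<in> lin K (Day V) P"
    and eq: "\<And>H0 H1 x y h. vect elts K H0 \<Longrightarrow> vect elts K H1 \<Longrightarrow> x \<in> carrier (fobj X H0) \<Longrightarrow>
      y \<in> carrier (fobj Y H1) \<Longrightarrow> h \<in> lin K (tensor K H0 H1) V \<Longrightarrow>
      f (gen V H0 H1 x y h) = g (gen V H0 H1 x y h)"
  shows "f = g"
proof (rule lin_eqI[OF f g])
  fix z assume "z \<in> carrier (Day V)"
  then show "f z = g z"
    by (induction z rule: day_induct) (auto simp: eq lin_add[OF f] lin_add[OF g])
qed

text \<open>The universal property of the coend in terms of triples: \<open>\<beta>\<close> has to
  be linear in each of the three arguments, and its compatibility with arrows is demanded on triples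
  only. The component at each pair of spaces comes from \<open>tensor3_lift\<close>.\<close>

lemma day_lift:
  assumes P: "module K P"
    and xy: "\<And>H0 H1 h. vect elts K H0 \<Longrightarrow> vect elts K H1 \<Longrightarrow> h \<in> lin K (tensor K H0 H1) V \<Longrightarrow>
      bilinear K (fobj X H0) (fobj Y H1) P (\<lambda>x y. \<beta> H0 H1 x y h)"
    and h: "\<And>H0 H1 x y. vect elts K H0 \<Longrightarrow> vect elts K H1 \<Longrightarrow>
      x \<in> carrier (fobj X H0) \<Longrightarrow> y \<in> carrier (fobj Y H1) \<Longrightarrow>
      (\<lambda>h\<in>lin K (tensor K H0 H1) V. \<beta> H0 H1 x y h) \<in> lin K (homs K (tensor K H0 H1) V) P"
    and dinatural: "\<And>H0 H1 H0' H1' f g x y h. vect elts K H0 \<Longrightarrow> vect elts K H1 \<Longrightarrow>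
      vect elts K H0' \<Longrightarrow> vect elts K H1' \<Longrightarrow> f \<in> lin K H0 H0' \<Longrightarrow> g \<in> lin K H1 H1' \<Longrightarrow>
      x \<in> carrier (fobj X H0) \<Longrightarrow> y \<in> carrier (fobj Y H1) \<Longrightarrow> h \<in> lin K (tensor K H0' H1') V \<Longrightarrow>
      \<beta> H0' H1' (fmap X H0 H0' f x) (fmap Y H1 H1' g y) h =
      \<beta> H0 H1 x y (compose (carrier (tensor K H0 H1)) h (tensor_map K H0 H1 H0' H1' f g))"
  shows "\<exists>m\<in>lin K (Day V) P. \<forall>H0 H1. vect elts K H0 \<longrightarrow> vect elts K H1 \<longrightarrow>
    (\<forall>x\<in>carrier (fobj X H0). \<forall>y\<in>carrier (fobj Y H1). \<forall>h\<in>lin K (tensor K H0 H1) V.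
      m (gen V H0 H1 x y h) = \<beta> H0 H1 x y h)"
proof -
  define extends where "extends c g \<longleftrightarrow> g \<in> lin K (T V c c) P \<and>
    (\<forall>x\<in>carrier (fobj X (fst c)). \<forall>y\<in>carrier (fobj Y (snd c)). \<forall>h\<in>carrier (homV V c).
      g (triple V c x y h) = \<beta> (fst c) (snd c) x y h)" for c g
  \<comment> \<open>One extension is selected for every pair of spaces, which gives the family of
    maps required by \<open>coend_lift\<close>.\<close>
  define k where "k c = (SOME g. extends c g)" for c
  have k_extends: "extends c (k c)" if c: "c \<in> Ob" for c
  proof -
    have "\<exists>g. extends c g"
      unfolding extends_def day_integrand_def Bex_def[symmetric]
      by (rule tensor3_lift[OF pair_objsD(5,6)[OF c] homV_module[OF V' c] P])
        (simp_all add: xy[OF pair_objsD(1,2)[OF c]] h[OF pair_objsD(1,2)[OF c]])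
    from someI_ex[OF this] show ?thesis by (simp only: k_def)
  qed
  then have k: "k c \<in> lin K (T V c c) P" if "c \<in> Ob" for c
    using that by (simp add: extends_def)
  have k_pure: "k c (triple V c x y h) = \<beta> (fst c) (snd c) x y h"
    if "c \<in> Ob" "x \<in> carrier (fobj X (fst c))" "y \<in> carrier (fobj Y (snd c))"
      "h \<in> carrier (homV V c)" for c x y h
    using k_extends[OF that(1)] that by (simp add: extends_def)
  \<comment> \<open>The hypothesis covers triples only; both sides are additive in \<open>t\<close>,
    so the equation spreads to the whole integrand by induction.\<close>
  have k_dinat: "k c (day_left K X Y V c d fg t) = k d (day_right K X Y V c d fg t)"
    if c: "c \<in> Ob" and d: "d \<in> Ob" and fg: "fg \<in> pair_homs K c d"
      and t: "t \<in> carrier (T V d c)" for c d fg t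
  proof -
    note L = day_left_lin[OF V' c d fg] and R = day_right_lin[OF V' c d fg]
    have f: "fst fg \<in> lin K (fst c) (fst d)" and g: "snd fg \<in> lin K (snd c) (snd d)"
      using fg by (auto simp: pair_homs_def)
    note Xf = linear_functor_lin[OF X pair_objsD(1)[OF c] pair_objsD(1)[OF d] f]
      and Yg = linear_functor_lin[OF Y pair_objsD(2)[OF c] pair_objsD(2)[OF d] g]
    from t have "t \<in> carrier (tensor K (XY c) (homV V d))" by (simp add: day_integrand_def)
    then show ?thesis
    proof (rule tensor3_induct[OF pair_objsD(5,6)[OF c] homV_module[OF V' d]])
      fix x y h assume x: "x \<in> carrier (fobj X (fst c))" and y: "y \<in> carrier (fobj Y (snd c))"
        and "h \<in> carrier (homV V d)"
      then have h: "h \<in> lin K (tensor K (fst d) (snd d)) V" by simp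
      let ?t = "pure K (XY c) (homV V d) (pure K (fobj X (fst c)) (fobj Y (snd c)) x y) h"
      have "compose (carrier (tensor K (fst c) (snd c))) h
          (tensor_map K (fst c) (snd c) (fst d) (snd d) (fst fg) (snd fg)) \<in> carrier (homV V c)"
        using lin_compose[OF tensor_map_lin[OF pair_objsD(3,4)[OF c] pair_objsD(3,4)[OF d] f g] h
            pair_objsD(8)[OF c]] by simp
      from k_pure[OF c x y this]
      have "k c (day_left K X Y V c d fg ?t) = \<beta> (fst c) (snd c) x y
          (compose (carrier (tensor K (fst c) (snd c))) h
            (tensor_map K (fst c) (snd c) (fst d) (snd d) (fst fg) (snd fg)))"
        by (simp add: day_left_pure[OF V' c d fg pure_closed[OF pair_objsD(5,6)[OF c] x y] h])
      also have "\<dots> = \<beta> (fst d) (snd d) (fmap X (fst c) (fst d) (fst fg) x)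
          (fmap Y (snd c) (snd d) (snd fg) y) h"
        using dinatural[OF pair_objsD(1,2)[OF c] pair_objsD(1,2)[OF d] f g x y h] by simp
      also have "\<dots> = k d (day_right K X Y V c d fg ?t)"
        using k_pure[OF d lin_closed[OF Xf x] lin_closed[OF Yg y], of h] h
        by (simp add: day_right_pure[OF V' c d fg x y h])
      finally show "k c (day_left K X Y V c d fg ?t) = k d (day_right K X Y V c d fg ?t)" .
    next
      fix s t assume "s \<in> carrier (tensor K (XY c) (homV V d))"
        and "t \<in> carrier (tensor K (XY c) (homV V d))"
        and eq: "k c (day_left K X Y V c d fg s) = k d (day_right K X Y V c d fg s)"
          "k c (day_left K X Y V c d fg t) = k d (day_right K X Y V c d fg t)"
      then have s: "s \<in> carrier (T V d c)"
        and t: "t \<in> carrier (T V d c)" by (simp_all add: day_integrand_def)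
      have "k c (day_left K X Y V c d fg (s \<oplus>\<^bsub>T V d c\<^esub> t)) =
          k d (day_right K X Y V c d fg (s \<oplus>\<^bsub>T V d c\<^esub> t))"
        by (simp add: lin_add[OF L s t] lin_add[OF R s t] eq
            lin_add[OF k[OF c] lin_closed[OF L s] lin_closed[OF L t]]
            lin_add[OF k[OF d] lin_closed[OF R s] lin_closed[OF R t]])
      then show "k c (day_left K X Y V c d fg (s \<oplus>\<^bsub>tensor K (XY c) (homV V d)\<^esub> t)) =
          k d (day_right K X Y V c d fg (s \<oplus>\<^bsub>tensor K (XY c) (homV V d)\<^esub> t))"
        by (simp add: day_integrand_def)
    qed
  qed
  have "\<exists>m\<in>lin K (Day V) P.
      \<forall>c\<in>Ob. \<forall>t\<in>carrier (T V c c). m (cinj c t) = k c t"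
    unfolding day_space_def
    by (rule coend_lift[OF _ _ _ _ P k k_dinat]) (rule coend_facts; assumption | assumption)+
  then obtain m where m: "m \<in> lin K (Day V) P"
    and m_eq: "\<forall>c\<in>Ob. \<forall>t\<in>carrier (T V c c). m (cinj c t) = k c t" ..
  show ?thesis
  proof (intro bexI[OF _ m] allI impI ballI)
    fix H0 H1 :: "('k, 'u) module" and x y h
    assume "vect elts K H0" "vect elts K H1" and x: "x \<in> carrier (fobj X H0)"
      and y: "y \<in> carrier (fobj Y H1)" and h: "h \<in> lin K (tensor K H0 H1) V"
    then have c: "(H0, H1) \<in> Ob" by (simp add: pair_objs_def)
    have "pure K (XY (H0, H1)) (homV V (H0, H1)) (pure K (fobj X H0) (fobj Y H1) x y) h
        \<in> carrier (T V (H0, H1) (H0, H1))"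
      unfolding day_integrand_def
      using pair_objsD(5-7)[OF c] homV_module[OF V' c] x y h by (simp add: pure_closed)
    then show "m (gen V H0 H1 x y h) = \<beta> H0 H1 x y h"
      using m_eq c k_pure[OF c, of x y h] x y h by (simp add: day_gen_def)
  qed
qed

end

text \<open>This justifies the definite description in \<open>day_map\<close>: existence by
  \<open>day_lift\<close>, applied to the generators of the target with \<open>h\<close> replaced by
  its composite with \<open>f\<close>, and uniqueness by \<open>day_eqI\<close>.\<close>

lemma day_map:
  assumes V: "vect elts K V" and W: "vect elts K W" and f: "f \<in> lin K V W"
  shows day_map_lin: "Day_map V W f \<in> lin K (Day V) (Day W)"
    and day_map_gen: "vect elts K H0 \<Longrightarrow> vect elts K H1 \<Longrightarrow>
      x \<in> carrier (fobj X H0) \<Longrightarrow> y \<in> carrier (fobj Y H1) \<Longrightarrow> h \<in> lin K (tensor K H0 H1) V \<Longrightarrow>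
      Day_map V W f (gen V H0 H1 x y h) =
      gen W H0 H1 x y (compose (carrier (tensor K H0 H1)) f h)"
proof -
  have t: "module K (tensor K H0 H1)" if "vect elts K H0" "vect elts K H1"
    for H0 H1 :: "('k, 'u) module"
    using that by (intro tensor_module vect_module)
  have fh: "compose (carrier (tensor K H0 H1)) f h \<in> lin K (tensor K H0 H1) W"
    if "vect elts K H0" "vect elts K H1" "h \<in> lin K (tensor K H0 H1) V"
    for H0 H1 :: "('k, 'u) module" and h
    by (rule lin_compose[OF that(3) f t[OF that(1,2)]])
  have "\<exists>m\<in>lin K (Day V) (Day W).
      \<forall>H0 H1. vect elts K H0 \<longrightarrow> vect elts K H1 \<longrightarrow>
      (\<forall>x\<in>carrier (fobj X H0). \<forall>y\<in>carrier (fobj Y H1). \<forall>h\<in>lin K (tensor K H0 H1) V.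
        m (gen V H0 H1 x y h) = gen W H0 H1 x y (compose (carrier (tensor K H0 H1)) f h))"
  proof (rule day_lift[OF V day_space_module[OF W]])
    fix H0 H1 :: "('k, 'u) module" and h
    assume "vect elts K H0" "vect elts K H1" "h \<in> lin K (tensor K H0 H1) V"
    then show "bilinear K (fobj X H0) (fobj Y H1) (Day W)
        (\<lambda>x y. gen W H0 H1 x y (compose (carrier (tensor K H0 H1)) f h))"
      by (intro gen_bilinear[OF W] fh)
  next
    fix H0 H1 :: "('k, 'u) module" and x y
    assume H: "vect elts K H0" "vect elts K H1"
      and xy: "x \<in> carrier (fobj X H0)" "y \<in> carrier (fobj Y H1)"
    have post: "(\<lambda>h\<in>lin K (tensor K H0 H1) V. compose (carrier (tensor K H0 H1)) f h) \<in>
        lin K (homs K (tensor K H0 H1) V) (homs K (tensor K H0 H1) W)"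
      by (rule homs_postcompose[OF t[OF H] vect_module[OF V] f])
    \<comment> \<open>Written as postcomposition with \<open>f\<close> followed by the generator map
      at \<open>W\<close>, the assignment inherits linearity from its two factors.\<close>
    have "(\<lambda>h\<in>lin K (tensor K H0 H1) V. gen W H0 H1 x y (compose (carrier (tensor K H0 H1)) f h)) =
        compose (carrier (homs K (tensor K H0 H1) V))
          (\<lambda>h\<in>lin K (tensor K H0 H1) W. gen W H0 H1 x y h)
          (\<lambda>h\<in>lin K (tensor K H0 H1) V. compose (carrier (tensor K H0 H1)) f h)"
      using fh[OF H] by (auto simp: compose_def[of "lin K (tensor K H0 H1) V"] fun_eq_iff)
    also have "\<dots> \<in> lin K (homs K (tensor K H0 H1) V) (Day W)"
      by (rule lin_compose[OF post gen_lin[OF W H xy] homs_module[OF t[OF H] vect_module[OF V]]])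
    finally show "(\<lambda>h\<in>lin K (tensor K H0 H1) V.
        gen W H0 H1 x y (compose (carrier (tensor K H0 H1)) f h)) \<in>
        lin K (homs K (tensor K H0 H1) V) (Day W)" .
  next
    fix H0 H1 H0' H1' :: "('k, 'u) module" and g g' x y h
    assume H: "vect elts K H0" "vect elts K H1" and H': "vect elts K H0'" "vect elts K H1'"
      and g: "g \<in> lin K H0 H0'" "g' \<in> lin K H1 H1'"
      and xy: "x \<in> carrier (fobj X H0)" "y \<in> carrier (fobj Y H1)"
      and h: "h \<in> lin K (tensor K H0' H1') V"
    have q: "tensor_map K H0 H1 H0' H1' g g' \<in> lin K (tensor K H0 H1) (tensor K H0' H1')"
      using H H' g by (intro tensor_map_lin vect_module)
    \<comment> \<open>Postcomposition with \<open>f\<close> commutes with precomposition by the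
      tensor product of the two arrows, so the relation at \<open>W\<close> can be applied.\<close>
    have "compose (carrier (tensor K H0 H1)) (compose (carrier (tensor K H0' H1')) f h)
        (tensor_map K H0 H1 H0' H1' g g') =
      compose (carrier (tensor K H0 H1)) f
        (compose (carrier (tensor K H0 H1)) h (tensor_map K H0 H1 H0' H1' g g'))"
      using lin_closed[OF q] by (auto simp: compose_def fun_eq_iff)
    then show "gen W H0' H1' (fmap X H0 H0' g x) (fmap Y H1 H1' g' y)
        (compose (carrier (tensor K H0' H1')) f h) =
      gen W H0 H1 x y (compose (carrier (tensor K H0 H1)) f
        (compose (carrier (tensor K H0 H1)) h (tensor_map K H0 H1 H0' H1' g g')))"
      using gen_relation[OF W H H' g xy fh[OF H' h]] by simp
  qed
  then obtain m where m: "m \<in> lin K (Day V) (Day W)"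
    and m_gen: "\<forall>H0 H1. vect elts K H0 \<longrightarrow> vect elts K H1 \<longrightarrow>
      (\<forall>x\<in>carrier (fobj X H0). \<forall>y\<in>carrier (fobj Y H1). \<forall>h\<in>lin K (tensor K H0 H1) V.
        m (gen V H0 H1 x y h) = gen W H0 H1 x y (compose (carrier (tensor K H0 H1)) f h))" ..
  have "Day_map V W f = m"
    unfolding day_map_def
  proof (rule the_equality)
    fix m' assume m': "m' \<in> lin K (Day V) (Day W) \<and>
      (\<forall>H0 H1. vect elts K H0 \<longrightarrow> vect elts K H1 \<longrightarrow>
      (\<forall>x\<in>carrier (fobj X H0). \<forall>y\<in>carrier (fobj Y H1). \<forall>h\<in>lin K (tensor K H0 H1) V.
        m' (gen V H0 H1 x y h) = gen W H0 H1 x y (compose (carrier (tensor K H0 H1)) f h)))"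
    show "m' = m"
      by (rule day_eqI[OF V conjunct1[OF m'] m]) (simp add: m' m_gen)
  qed (use m m_gen in blast)
  then show "Day_map V W f \<in> lin K (Day V) (Day W)"
    and "vect elts K H0 \<Longrightarrow> vect elts K H1 \<Longrightarrow>
      x \<in> carrier (fobj X H0) \<Longrightarrow> y \<in> carrier (fobj Y H1) \<Longrightarrow> h \<in> lin K (tensor K H0 H1) V \<Longrightarrow>
      Day_map V W f (gen V H0 H1 x y h) =
      gen W H0 H1 x y (compose (carrier (tensor K H0 H1)) f h)"
    using m m_gen by blast+
qed

end

section \<open>The comparison map\<close>

locale born_tensor_space = grothendieck_universe elts
  for elts :: "'u \<Rightarrow> 'u set" +
  fixes K :: "'k ring" and \<Gamma> :: "'g set" and \<F> and \<Delta> :: "'d set" and \<G>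
  assumes cring_K: "cring K" and small_K: "small elts (carrier K)"
    and small_\<Gamma>: "small elts \<Gamma>" and small_\<Delta>: "small elts \<Delta>"
    and \<F>: "bornology \<Gamma> \<F>" and \<G>: "bornology \<Delta> \<G>"
begin

abbreviation "X \<equiv> born_functor \<Gamma> \<F> :: ('k, 'u, 'g \<Rightarrow> 'u) vfunctor"
abbreviation "Y \<equiv> born_functor \<Delta> \<G> :: ('k, 'u, 'd \<Rightarrow> 'u) vfunctor"
abbreviation "target V \<equiv> born_space (\<Gamma> \<times> \<Delta>) (born_tensor \<Gamma> \<F> \<Delta> \<G>) (V :: ('k, 'u) module)"

sublocale day_convolution elts K X Y
  by (intro day_convolution.intro linear_functor_born \<F> \<G> small_\<Gamma> small_\<Delta>)

lemmas bornology_target = bornology_born_tensor[OF \<F> \<G>]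

definition outer :: "('k, 'u) module \<Rightarrow> ('k, 'u) module \<Rightarrow> ('g \<Rightarrow> 'u) \<Rightarrow> ('d \<Rightarrow> 'u) \<Rightarrow>
    (('u \<times> 'u \<Rightarrow> 'k) set \<Rightarrow> 'u) \<Rightarrow> 'g \<times> 'd \<Rightarrow> 'u" where
  "outer H0 H1 s t h = (\<lambda>(\<gamma>, \<delta>)\<in>\<Gamma> \<times> \<Delta>. h (pure K H0 H1 (s \<gamma>) (t \<delta>)))"

definition is_comparison where
  "is_comparison V m \<longleftrightarrow> m \<in> lin K (Day V) (target V) \<and>
    (\<forall>H0 H1. vect elts K H0 \<longrightarrow> vect elts K H1 \<longrightarrow>
      (\<forall>s\<in>carrier (fobj X H0). \<forall>t\<in>carrier (fobj Y H1). \<forall>h\<in>lin K (tensor K H0 H1) V.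
        m (gen V H0 H1 s t h) = outer H0 H1 s t h))"

context
  fixes V :: "('k, 'u) module"
  assumes V: "vect elts K V"
begin

private lemma V': "module K V"
  by (rule vect_module[OF V])

text \<open>Outside the product of the two supports one factor of the pure tensor is zero. The
  support therefore lies in a rectangle with bounded sides.\<close>

lemma outer_closed:
  assumes H0: "module K H0" and H1: "module K H1"
    and s: "s \<in> carrier (born_space \<Gamma> \<F> H0)" and t: "t \<in> carrier (born_space \<Delta> \<G> H1)"
    and h: "h \<in> lin K (tensor K H0 H1) V"
  shows "outer H0 H1 s t h \<in> carrier (target V)"
proof (rule born_spaceI[OF bornology_target])
  let ?F = "{\<gamma> \<in> \<Gamma>. s \<gamma> \<noteq> \<zero>\<^bsub>H0\<^esub>}" and ?G = "{\<delta> \<in> \<Delta>. t \<delta> \<noteq> \<zero>\<^bsub>H1\<^esub>}"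
  show "?F \<times> ?G \<in> born_tensor \<Gamma> \<F> \<Delta> \<G>"
    using born_space_support[OF s] born_space_support[OF t] by (auto simp: born_tensor_eq[OF \<F> \<G>])
  show "outer H0 H1 s t h \<in> extensional (\<Gamma> \<times> \<Delta>)" by (simp add: outer_def)
  fix p assume "p \<in> \<Gamma> \<times> \<Delta>"
  then obtain \<gamma> \<delta> where p: "p = (\<gamma>, \<delta>)" "\<gamma> \<in> \<Gamma>" "\<delta> \<in> \<Delta>" by blast
  note mem = born_space_closed[OF s p(2)] born_space_closed[OF t p(3)]
  show "outer H0 H1 s t h p \<in> carrier V"
    using p lin_closed[OF h pure_closed[OF H0 H1 mem]] by (simp add: outer_def)
  assume "p \<notin> ?F \<times> ?G"
  then have "pure K H0 H1 (s \<gamma>) (t \<delta>) = \<zero>\<^bsub>tensor K H0 H1\<^esub>"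
    using p mem pure_zero[OF H0 H1] by auto
  then show "outer H0 H1 s t h p = \<zero>\<^bsub>V\<^esub>"
    using p lin_zero[OF h tensor_module[OF H0 H1] V'] by (simp add: outer_def)
qed

text \<open>Dinaturality is the identity \<open>(f \<otimes> g) (s \<gamma> \<otimes> t \<delta>) =
  f (s \<gamma>) \<otimes> g (t \<delta>)\<close> at each point, followed by \<open>h\<close>;
  trilinearity is likewise checked at each point.\<close>

lemma comparison_exists: "\<exists>m. is_comparison V m"
  unfolding is_comparison_def Bex_def[symmetric]
proof (rule day_lift[OF V born_space_module[OF bornology_target V']])
  fix H0 H1 :: "('k, 'u) module" and h
  assume "vect elts K H0" "vect elts K H1" and h: "h \<in> lin K (tensor K H0 H1) V"
  then have H: "module K H0" "module K H1" by (simp_all add: vect_module)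
  note mem = born_space_closed[of _ \<Gamma> \<F> H0] born_space_closed[of _ \<Delta> \<G> H1]
  note b = bilinear_pure[OF H] pure_closed[OF H]
  show "bilinear K (fobj X H0) (fobj Y H1) (target V) (\<lambda>s t. outer H0 H1 s t h)"
    unfolding born_functor_simps
  proof (rule bilinearI[OF born_space_module[OF \<F> H(1)] born_space_module[OF \<G> H(2)]
        outer_closed[OF H _ _ h]])
  qed (auto simp: outer_def fun_eq_iff mem b(2) lin_add[OF h] lin_smult[OF h]
      bilinear_add_left[OF H b(1)] bilinear_add_right[OF H b(1)]
      bilinear_smult_left[OF H b(1)] bilinear_smult_right[OF H b(1)] simp del: born_space_simps(1))
next
  fix H0 H1 :: "('k, 'u) module" and s t
  assume "vect elts K H0" "vect elts K H1" "s \<in> carrier (fobj X H0)" "t \<in> carrier (fobj Y H1)"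
  then have H: "module K H0" "module K H1"
    and s: "s \<in> carrier (born_space \<Gamma> \<F> H0)" and t: "t \<in> carrier (born_space \<Delta> \<G> H1)"
    by (simp_all add: vect_module)
  have "(\<lambda>h\<in>carrier (homs K (tensor K H0 H1) V). outer H0 H1 s t h)
      \<in> lin K (homs K (tensor K H0 H1) V) (target V)"
  proof (rule lin_restrictI[OF homs_module[OF tensor_module[OF H] V']])
    show "outer H0 H1 s t h \<in> carrier (target V)"
      if "h \<in> carrier (homs K (tensor K H0 H1) V)" for h
      using outer_closed[OF H s t] that by simp
  qed (auto simp: outer_def fun_eq_iff born_space_closed[OF s] born_space_closed[OF t]
      pure_closed[OF H])
  then show "(\<lambda>h\<in>lin K (tensor K H0 H1) V. outer H0 H1 s t h)
      \<in> lin K (homs K (tensor K H0 H1) V) (target V)" by simp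
next
  fix H0 H1 H0' H1' :: "('k, 'u) module" and f g s t h
  assume "vect elts K H0" "vect elts K H1" "vect elts K H0'" "vect elts K H1'"
    and f: "f \<in> lin K H0 H0'" and g: "g \<in> lin K H1 H1'"
    and "s \<in> carrier (fobj X H0)" "t \<in> carrier (fobj Y H1)"
    and h: "h \<in> lin K (tensor K H0' H1') V"
  then have H: "module K H0" "module K H1" and H': "module K H0'" "module K H1'"
    and s: "s \<in> carrier (born_space \<Gamma> \<F> H0)" and t: "t \<in> carrier (born_space \<Delta> \<G> H1)"
    by (simp_all add: vect_module)
  show "outer H0' H1' (fmap X H0 H0' f s) (fmap Y H1 H1' g t) h =
      outer H0 H1 s t (compose (carrier (tensor K H0 H1)) h (tensor_map K H0 H1 H0' H1' f g))"
    using s t born_space_closed[OF s] born_space_closed[OF t]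
    by (auto simp: outer_def fun_eq_iff compose_eq tensor_map_pure[OF H H' f g] pure_closed[OF H]
        simp del: born_space_simps(1))
qed

end

text \<open>The choice leaves no freedom for spaces \<open>V\<close> in Vect: by
  \<open>day_eqI\<close> a linear map out of the coend is determined by its values on
  generators.\<close>

definition comparison :: "('k, 'u) module \<Rightarrow>
    (('k, 'u) vpair \<Rightarrow> ('k, 'u, 'g \<Rightarrow> 'u, 'd \<Rightarrow> 'u) day_elem) set \<Rightarrow> 'g \<times> 'd \<Rightarrow> 'u" where
  "comparison V = (SOME m. is_comparison V m)"

lemma comparison:
  assumes "vect elts K V"
  shows comparison_lin: "comparison V \<in> lin K (Day V) (target V)"
    and comparison_gen: "vect elts K H0 \<Longrightarrow> vect elts K H1 \<Longrightarrow>
      s \<in> carrier (born_space \<Gamma> \<F> H0) \<Longrightarrow> t \<in> carrier (born_space \<Delta> \<G> H1) \<Longrightarrow>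
      h \<in> lin K (tensor K H0 H1) V \<Longrightarrow>
      comparison V (gen V H0 H1 s t h) = outer H0 H1 s t h"
  using someI_ex[OF comparison_exists[OF assms], folded comparison_def]
  by (simp_all only: is_comparison_def born_functor_simps)

section \<open>Normal forms\<close>

text \<open>The copy of the free space is chosen once for each set \<open>A\<close>, so that two
  normal forms over the same pair of sets involve maps with the same source, which can be added and
  compared.\<close>

definition free_on :: "'i set \<Rightarrow> ('k, 'u) module \<times> ('i \<Rightarrow> 'u)" where
  "free_on A = (SOME He. vect elts K (fst He) \<and> basis K A (fst He) (snd He))"

abbreviation "free_mod A \<equiv> fst (free_on A)"
abbreviation "free_basis A \<equiv> snd (free_on A)"

lemma free_on:
  assumes "small elts A"
  shows free_mod_vect: "vect elts K (free_mod A)"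
    and free_basis: "basis K A (free_mod A) (free_basis A)"
proof -
  have "\<exists>He. vect elts K (fst He :: ('k, 'u) module) \<and> basis K A (fst He) (snd He)"
    using small_basis[OF cring_K small_K assms] by auto
  from someI_ex[OF this]
  show "vect elts K (free_mod A)" "basis K A (free_mod A) (free_basis A)"
    by (simp_all add: free_on_def)
qed

text \<open>The element that the Yoneda lemma assigns to the identity of the free space on
  \<open>A\<close>, that is, the value of \<open>coordinates\<close> at this identity.\<close>

definition universal :: "'i set \<Rightarrow> 'i set \<Rightarrow> 'i \<Rightarrow> 'u" where
  "universal S A = (\<lambda>i\<in>S. if i \<in> A then free_basis A i else \<zero>\<^bsub>free_mod A\<^esub>)"

lemma universal_closed:
  assumes b: "bornology S \<B>" and S: "small elts S" and A: "A \<in> \<B>"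
  shows "universal S A \<in> carrier (born_space S \<B> (free_mod A))"
proof -
  have A': "small elts A" by (rule small_subset[OF bornology_subset[OF b A] S])
  interpret H: module K "free_mod A" by (rule vect_module[OF free_mod_vect[OF A']])
  show ?thesis
    by (rule born_spaceI[OF b A]) (auto simp: universal_def basis_closed[OF free_basis[OF A']])
qed

lemma universal_support: "A \<subseteq> S \<Longrightarrow> {i \<in> S. universal S A i \<noteq> \<zero>\<^bsub>free_mod A\<^esub>} \<subseteq> A"
  by (auto simp: universal_def)

text \<open>By the Yoneda lemma an element of the functor supported in \<open>A\<close> comes from a map out of the
  free space on \<open>A\<close>.\<close>

lemma universal_factor:
  assumes b: "bornology S \<B>" and S: "small elts S" and A: "A \<in> \<B>" and V: "module K V"
    and s: "s \<in> carrier (born_space S \<B> V)" and supp: "{i \<in> S. s i \<noteq> \<zero>\<^bsub>V\<^esub>} \<subseteq> A"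
  shows "\<exists>f\<in>lin K (free_mod A) V. compose S f (universal S A) = s"
proof -
  have A': "small elts A" by (rule small_subset[OF bornology_subset[OF b A] S])
  note H = vect_module[OF free_mod_vect[OF A']]
  have "s i \<in> carrier V" if "i \<in> A" for i
    using born_space_closed[OF s] bornology_subset[OF b A] that by blast
  then obtain f where f: "f \<in> lin K (free_mod A) V"
    and f_eq: "\<And>i. i \<in> A \<Longrightarrow> f (free_basis A i) = s i"
    using basis_lift[OF free_basis[OF A'] V, of s] by blast
  have "compose S f (universal S A) = s"
    using born_space_extensional[OF s] supp
    by (intro extensionalityI[of _ S])
      (auto simp: compose_def universal_def f_eq lin_zero[OF f H V])
  with f show ?thesis by blast
qed

definition normal_form :: "('k, 'u) module \<Rightarrow> 'g set \<Rightarrow> 'd set \<Rightarrow> (('u \<times> 'u \<Rightarrow> 'k) set \<Rightarrow> 'u) \<Rightarrow>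
    (('k, 'u) vpair \<Rightarrow> ('k, 'u, 'g \<Rightarrow> 'u, 'd \<Rightarrow> 'u) day_elem) set" where
  "normal_form V F G h = gen V (free_mod F) (free_mod G) (universal \<Gamma> F) (universal \<Delta> G) h"

abbreviation "normal_form_homs V F G \<equiv> lin K (tensor K (free_mod F) (free_mod G)) V"

lemma small_bounded: "F \<in> \<F> \<Longrightarrow> small elts F" "G \<in> \<G> \<Longrightarrow> small elts G"
  using small_subset[OF bornology_subset[OF \<F>] small_\<Gamma>] small_subset[OF bornology_subset[OF \<G>] small_\<Delta>]
  by blast+

context
  fixes V :: "('k, 'u) module"
  assumes V: "vect elts K V"
begin

text \<open>Both vectors are images of universal elements under maps \<open>f\<close> and
  \<open>g\<close>, and \<open>gen_relation\<close> moves these into \<open>h\<close>. The bounded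
  sets may be larger than the supports, and this freedom is what makes enlargement of normal forms a
  special case.\<close>

lemma gen_normal_form:
  assumes H0: "vect elts K H0" and H1: "vect elts K H1"
    and s: "s \<in> carrier (born_space \<Gamma> \<F> H0)" and t: "t \<in> carrier (born_space \<Delta> \<G> H1)"
    and h: "h \<in> lin K (tensor K H0 H1) V"
    and F: "F \<in> \<F>" "{\<gamma> \<in> \<Gamma>. s \<gamma> \<noteq> \<zero>\<^bsub>H0\<^esub>} \<subseteq> F"
    and G: "G \<in> \<G>" "{\<delta> \<in> \<Delta>. t \<delta> \<noteq> \<zero>\<^bsub>H1\<^esub>} \<subseteq> G"
  shows "\<exists>h'\<in>normal_form_homs V F G. gen V H0 H1 s t h = normal_form V F G h'"
proof -
  obtain f where f: "f \<in> lin K (free_mod F) H0" and fs: "compose \<Gamma> f (universal \<Gamma> F) = s"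
    using universal_factor[OF \<F> small_\<Gamma> F(1) vect_module[OF H0] s F(2)] by blast
  obtain g where g: "g \<in> lin K (free_mod G) H1" and gt: "compose \<Delta> g (universal \<Delta> G) = t"
    using universal_factor[OF \<G> small_\<Delta> G(1) vect_module[OF H1] t G(2)] by blast
  note HF = free_mod_vect[OF small_bounded(1)[OF F(1)]]
    and HG = free_mod_vect[OF small_bounded(2)[OF G(1)]]
  note uF = universal_closed[OF \<F> small_\<Gamma> F(1)] and uG = universal_closed[OF \<G> small_\<Delta> G(1)]
  let ?h = "compose (carrier (tensor K (free_mod F) (free_mod G))) h
    (tensor_map K (free_mod F) (free_mod G) H0 H1 f g)"
  have q: "tensor_map K (free_mod F) (free_mod G) H0 H1 f g
      \<in> lin K (tensor K (free_mod F) (free_mod G)) (tensor K H0 H1)"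
    by (rule tensor_map_lin[OF vect_module[OF HF] vect_module[OF HG] vect_module[OF H0]
          vect_module[OF H1] f g])
  have "?h \<in> normal_form_homs V F G"
    by (rule lin_compose[OF q h tensor_module[OF vect_module[OF HF] vect_module[OF HG]]])
  moreover have "gen V H0 H1 s t h = normal_form V F G ?h"
    using gen_relation[OF V HF HG H0 H1 f g, of "universal \<Gamma> F" "universal \<Delta> G" h] uF uG h
    by (simp add: normal_form_def fs gt del: born_space_simps(1))
  ultimately show ?thesis by blast
qed

text \<open>A normal form is itself a generator, with universal elements as vectors, and these are
  supported in the larger sets as well.\<close>

lemma normal_form_mono:
  assumes F: "F \<in> \<F>" "F' \<in> \<F>" "F \<subseteq> F'" and G: "G \<in> \<G>" "G' \<in> \<G>" "G \<subseteq> G'"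
    and h: "h \<in> normal_form_homs V F G"
  shows "\<exists>h'\<in>normal_form_homs V F' G'. normal_form V F G h = normal_form V F' G' h'"
  unfolding normal_form_def[of V F G]
proof (rule gen_normal_form)
  show "{\<gamma> \<in> \<Gamma>. universal \<Gamma> F \<gamma> \<noteq> \<zero>\<^bsub>free_mod F\<^esub>} \<subseteq> F'"
    using universal_support[OF bornology_subset[OF \<F> F(1)]] F(3) by blast
  show "{\<delta> \<in> \<Delta>. universal \<Delta> G \<delta> \<noteq> \<zero>\<^bsub>free_mod G\<^esub>} \<subseteq> G'"
    using universal_support[OF bornology_subset[OF \<G> G(1)]] G(3) by blast
qed (intro free_mod_vect small_bounded universal_closed[OF \<F> small_\<Gamma>]
    universal_closed[OF \<G> small_\<Delta>] F G h)+

lemma normal_form_common: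
  assumes F: "F \<in> \<F>" "F' \<in> \<F>" and G: "G \<in> \<G>" "G' \<in> \<G>"
    and h: "h \<in> normal_form_homs V F G" and h': "h' \<in> normal_form_homs V F' G'"
  shows "\<exists>k\<in>normal_form_homs V (F \<union> F') (G \<union> G'). \<exists>k'\<in>normal_form_homs V (F \<union> F') (G \<union> G').
    normal_form V F G h = normal_form V (F \<union> F') (G \<union> G') k \<and> normal_form V F' G' h' = normal_form V (F \<union> F') (G \<union> G') k'"
  using normal_form_mono[OF F(1) bornology_Un[OF \<F> F] _ G(1) bornology_Un[OF \<G> G] _ h]
    normal_form_mono[OF F(2) bornology_Un[OF \<F> F] _ G(2) bornology_Un[OF \<G> G] _ h']
  by (metis Un_upper1 Un_upper2)

lemma normal_form_exists:
  assumes z: "z \<in> carrier (Day V)"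
  shows "\<exists>F\<in>\<F>. \<exists>G\<in>\<G>. \<exists>h\<in>normal_form_homs V F G. z = normal_form V F G h"
proof (rule day_induct[OF V z])
  fix H0 H1 :: "('k, 'u) module" and s t h
  assume H: "vect elts K H0" "vect elts K H1"
    and "s \<in> carrier (fobj X H0)" "t \<in> carrier (fobj Y H1)" and h: "h \<in> lin K (tensor K H0 H1) V"
  then have s: "s \<in> carrier (born_space \<Gamma> \<F> H0)" and t: "t \<in> carrier (born_space \<Delta> \<G> H1)"
    by simp_all
  show "\<exists>F\<in>\<F>. \<exists>G\<in>\<G>. \<exists>k\<in>normal_form_homs V F G. gen V H0 H1 s t h = normal_form V F G k"
    using gen_normal_form[OF H s t h born_space_support[OF s] subset_refl born_space_support[OF t] subset_refl]
      born_space_support[OF s] born_space_support[OF t] by blast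
next
  fix z w
  assume "\<exists>F\<in>\<F>. \<exists>G\<in>\<G>. \<exists>h\<in>normal_form_homs V F G. z = normal_form V F G h"
    "\<exists>F\<in>\<F>. \<exists>G\<in>\<G>. \<exists>h\<in>normal_form_homs V F G. w = normal_form V F G h"
  then obtain F G h F' G' h' where F: "F \<in> \<F>" "F' \<in> \<F>" and G: "G \<in> \<G>" "G' \<in> \<G>"
    and h: "h \<in> normal_form_homs V F G" "h' \<in> normal_form_homs V F' G'"
    and zw: "z = normal_form V F G h" "w = normal_form V F' G' h'" by blast
  let ?F = "F \<union> F'" and ?G = "G \<union> G'"
  obtain k k' where k: "k \<in> normal_form_homs V ?F ?G" "k' \<in> normal_form_homs V ?F ?G"
    and zw': "z = normal_form V ?F ?G k" "w = normal_form V ?F ?G k'"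
    using normal_form_common[OF F G h] zw by metis
  note F' = bornology_Un[OF \<F> F] and G' = bornology_Un[OF \<G> G]
  note HF = free_mod_vect[OF small_bounded(1)[OF F']]
    and HG = free_mod_vect[OF small_bounded(2)[OF G']]
  let ?homs = "homs K (tensor K (free_mod ?F) (free_mod ?G)) V"
  interpret H: module K ?homs
    by (intro homs_module tensor_module vect_module[OF HF] vect_module[OF HG] vect_module[OF V])
  have "k \<oplus>\<^bsub>?homs\<^esub> k' \<in> normal_form_homs V ?F ?G" using H.a_closed[of k k'] k by simp
  \<comment> \<open>Over common sets both summands have the same universal elements, so linearity of
    a generator in its last argument merges them.\<close>
  moreover have "z \<oplus>\<^bsub>Day V\<^esub> w = normal_form V ?F ?G (k \<oplus>\<^bsub>?homs\<^esub> k')"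
    using lin_add[OF gen_lin[OF V HF HG, of "universal \<Gamma> ?F" "universal \<Delta> ?G"], of k k'] k
      H.a_closed[of k k'] universal_closed[OF \<F> small_\<Gamma> F'] universal_closed[OF \<G> small_\<Delta> G']
    by (simp add: zw' normal_form_def del: born_space_simps(1))
  ultimately show "\<exists>F\<in>\<F>. \<exists>G\<in>\<G>. \<exists>h\<in>normal_form_homs V F G. z \<oplus>\<^bsub>Day V\<^esub> w = normal_form V F G h"
    using F' G' by blast
qed

text \<open>The function obtained is the table of values of \<open>h\<close> on pairs of basis
  vectors, extended by zero because the universal elements vanish outside \<open>F\<close> and
  \<open>G\<close>. Injectivity and surjectivity are both read off from this formula.\<close>

lemma comparison_normal_form:
  assumes F: "F \<in> \<F>" and G: "G \<in> \<G>" and h: "h \<in> normal_form_homs V F G"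
  shows "comparison V (normal_form V F G h) = (\<lambda>(\<gamma>, \<delta>)\<in>\<Gamma> \<times> \<Delta>.
    if \<gamma> \<in> F \<and> \<delta> \<in> G then h (pure K (free_mod F) (free_mod G) (free_basis F \<gamma>) (free_basis G \<delta>))
    else \<zero>\<^bsub>V\<^esub>)"
proof -
  note sF = small_bounded(1)[OF F] and sG = small_bounded(2)[OF G]
  note HF = vect_module[OF free_mod_vect[OF sF]] and HG = vect_module[OF free_mod_vect[OF sG]]
  interpret HF: module K "free_mod F" by (rule HF)
  interpret HG: module K "free_mod G" by (rule HG)
  have "comparison V (normal_form V F G h) =
      outer (free_mod F) (free_mod G) (universal \<Gamma> F) (universal \<Delta> G) h"
    unfolding normal_form_def
    by (intro comparison_gen[OF V] free_mod_vect sF sG universal_closed[OF \<F> small_\<Gamma>]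
        universal_closed[OF \<G> small_\<Delta>] F G h)
  then show ?thesis
    using pure_zero[OF HF HG] lin_zero[OF h tensor_module[OF HF HG] vect_module[OF V]]
      basis_closed[OF free_basis[OF sF]] basis_closed[OF free_basis[OF sG]]
    by (auto simp: outer_def universal_def fun_eq_iff)
qed

lemma comparison_bij: "bij_betw (comparison V) (carrier (Day V)) (carrier (target V))"
proof (rule bij_betw_imageI)
  show "inj_on (comparison V) (carrier (Day V))"
  proof (rule inj_onI)
    fix z w assume "z \<in> carrier (Day V)" "w \<in> carrier (Day V)"
      and eq: "comparison V z = comparison V w"
    then obtain F G h F' G' h' where F: "F \<in> \<F>" "F' \<in> \<F>" and G: "G \<in> \<G>" "G' \<in> \<G>"
      and h: "h \<in> normal_form_homs V F G" "h' \<in> normal_form_homs V F' G'"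
      and zw: "z = normal_form V F G h" "w = normal_form V F' G' h'" using normal_form_exists by meson
    let ?F = "F \<union> F'" and ?G = "G \<union> G'"
    obtain k k' where k: "k \<in> normal_form_homs V ?F ?G" "k' \<in> normal_form_homs V ?F ?G"
      and zw': "z = normal_form V ?F ?G k" "w = normal_form V ?F ?G k'"
      using normal_form_common[OF F G h] zw by metis
    note F' = bornology_Un[OF \<F> F] and G' = bornology_Un[OF \<G> G]
    \<comment> \<open>The two functions being equal, the maps \<open>k\<close> and \<open>k'\<close>
      agree on all pairs of basis vectors over the common sets, and this determines them.\<close>
    have "k = k'"
    proof (rule basis_tensor_eqI[OF free_basis[OF small_bounded(1)[OF F']]
          free_basis[OF small_bounded(2)[OF G']] vect_module[OF V] k])
      fix \<gamma> \<delta> assume "\<gamma> \<in> ?F" "\<delta> \<in> ?G"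
      moreover from this have "\<gamma> \<in> \<Gamma>" "\<delta> \<in> \<Delta>"
        using bornology_subset[OF \<F> F'] bornology_subset[OF \<G> G'] by blast+
      ultimately show "k (pure K (free_mod ?F) (free_mod ?G) (free_basis ?F \<gamma>) (free_basis ?G \<delta>)) =
          k' (pure K (free_mod ?F) (free_mod ?G) (free_basis ?F \<gamma>) (free_basis ?G \<delta>))"
        using fun_cong[OF eq, of "(\<gamma>, \<delta>)"]
        unfolding zw' comparison_normal_form[OF F' G' k(1)] comparison_normal_form[OF F' G' k(2)]
        by (simp del: Un_iff)
    qed
    then show "z = w" using zw' by simp
  qed
  show "comparison V ` carrier (Day V) = carrier (target V)"
  proof (intro equalityI subsetI)
    fix u assume "u \<in> comparison V ` carrier (Day V)"
    then show "u \<in> carrier (target V)" using lin_closed[OF comparison_lin[OF V]] by blast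
  next
    fix u assume u: "u \<in> carrier (target V)"
    \<comment> \<open>A bounded set of the product need not be a rectangle but lies in one. The map
      \<open>h\<close> is prescribed by \<open>u\<close> on all of this rectangle, zero values
      included.\<close>
    obtain F G where F: "F \<in> \<F>" and G: "G \<in> \<G>"
      and supp: "{p \<in> \<Gamma> \<times> \<Delta>. u p \<noteq> \<zero>\<^bsub>V\<^esub>} \<subseteq> F \<times> G"
      using born_space_support[OF u] unfolding born_tensor_eq[OF \<F> \<G>] by blast
    note sF = small_bounded(1)[OF F] and sG = small_bounded(2)[OF G]
    have "u (\<gamma>, \<delta>) \<in> carrier V" if "\<gamma> \<in> F" "\<delta> \<in> G" for \<gamma> \<delta>
      using born_space_closed[OF u, of "(\<gamma>, \<delta>)"] bornology_subset[OF \<F> F] bornology_subset[OF \<G> G]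
        that by blast
    then have "\<exists>h\<in>normal_form_homs V F G. \<forall>\<gamma>\<in>F. \<forall>\<delta>\<in>G.
        h (pure K (free_mod F) (free_mod G) (free_basis F \<gamma>) (free_basis G \<delta>)) = u (\<gamma>, \<delta>)"
      by (rule basis_tensor_lift[OF free_basis[OF sF] free_basis[OF sG] vect_module[OF V]])
    then obtain h where h: "h \<in> normal_form_homs V F G" and h_eq: "\<forall>\<gamma>\<in>F. \<forall>\<delta>\<in>G.
        h (pure K (free_mod F) (free_mod G) (free_basis F \<gamma>) (free_basis G \<delta>)) = u (\<gamma>, \<delta>)" ..
    have zero: "u (\<gamma>, \<delta>) = \<zero>\<^bsub>V\<^esub>" if "\<gamma> \<in> \<Gamma>" "\<delta> \<in> \<Delta>" "\<gamma> \<notin> F \<or> \<delta> \<notin> G" for \<gamma> \<delta>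
      using supp that by blast
    have "comparison V (normal_form V F G h) = u"
      unfolding comparison_normal_form[OF F G h]
      using born_space_extensional[OF u] h_eq zero
      by (intro extensionalityI[of _ "\<Gamma> \<times> \<Delta>"]) auto
    moreover have "normal_form V F G h \<in> carrier (Day V)"
      unfolding normal_form_def using universal_closed[OF \<F> small_\<Gamma> F] universal_closed[OF \<G> small_\<Delta> G]
      by (intro gen_closed[OF V] free_mod_vect sF sG h) (simp_all only: born_functor_simps)
    ultimately show "u \<in> comparison V ` carrier (Day V)" by blast
  qed
qed

end

text \<open>On a generator both sides send a pair of points to
  \<open>f (h (s \<gamma> \<otimes> t \<delta>))\<close>, and both sides are additive in
  \<open>z\<close>.\<close>

lemma comparison_natural:
  assumes V: "vect elts K V" and W: "vect elts K W" and f: "f \<in> lin K V W" and z: "z \<in> carrier (Day V)"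
  shows "comparison W (Day_map V W f z) = compose (\<Gamma> \<times> \<Delta>) f (comparison V z)"
proof (rule day_induct[OF V z])
  fix H0 H1 :: "('k, 'u) module" and s t h
  assume H: "vect elts K H0" "vect elts K H1"
    and st: "s \<in> carrier (fobj X H0)" "t \<in> carrier (fobj Y H1)"
    and h: "h \<in> lin K (tensor K H0 H1) V"
  then have s: "s \<in> carrier (born_space \<Gamma> \<F> H0)" and t: "t \<in> carrier (born_space \<Delta> \<G> H1)"
    by simp_all
  note H' = vect_module[OF H(1)] vect_module[OF H(2)]
  show "comparison W (Day_map V W f (gen V H0 H1 s t h)) =
      compose (\<Gamma> \<times> \<Delta>) f (comparison V (gen V H0 H1 s t h))"
    using born_space_closed[OF s] born_space_closed[OF t]
    unfolding day_map_gen[OF V W f H st h] comparison_gen[OF V H s t h]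
      comparison_gen[OF W H s t lin_compose[OF h f tensor_module[OF H']]]
    by (auto simp: outer_def compose_def fun_eq_iff pure_closed[OF H'])
next
  fix z w assume z: "z \<in> carrier (Day V)" and w: "w \<in> carrier (Day V)"
    and eq: "comparison W (Day_map V W f z) = compose (\<Gamma> \<times> \<Delta>) f (comparison V z)"
      "comparison W (Day_map V W f w) = compose (\<Gamma> \<times> \<Delta>) f (comparison V w)"
  note m = day_map_lin[OF V W f]
  have "comparison W (Day_map V W f (z \<oplus>\<^bsub>Day V\<^esub> w)) =
      compose (\<Gamma> \<times> \<Delta>) f (comparison V z) \<oplus>\<^bsub>target W\<^esub> compose (\<Gamma> \<times> \<Delta>) f (comparison V w)"
    by (simp only: lin_add[OF m z w] lin_add[OF comparison_lin[OF W] lin_closed[OF m z] lin_closed[OF m w]] eq)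
  also have "\<dots> = compose (\<Gamma> \<times> \<Delta>) f (comparison V z \<oplus>\<^bsub>target V\<^esub> comparison V w)"
    using born_space_closed[OF lin_closed[OF comparison_lin[OF V] z]]
      born_space_closed[OF lin_closed[OF comparison_lin[OF V] w]]
    by (auto simp: compose_def fun_eq_iff lin_add[OF f])
  also have "\<dots> = compose (\<Gamma> \<times> \<Delta>) f (comparison V (z \<oplus>\<^bsub>Day V\<^esub> w))"
    by (simp only: lin_add[OF comparison_lin[OF V] z w])
  finally show "comparison W (Day_map V W f (z \<oplus>\<^bsub>Day V\<^esub> w)) =
      compose (\<Gamma> \<times> \<Delta>) f (comparison V (z \<oplus>\<^bsub>Day V\<^esub> w))" .
qed

text \<open>Membership in the subcategory is proved for the space of bounded functions on the
  product and carried back along the inverse of the comparison, since the transfer also supplies the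
  functoriality of the tensor product.\<close>

lemma comparison_iso:
  "ind_iso elts K (functor_tensor elts K X Y)
    (born_functor (\<Gamma> \<times> \<Delta>) (born_tensor \<Gamma> \<F> \<Delta> \<G>)) comparison"
proof -
  let ?XY = "functor_tensor elts K X Y"
  let ?B = "born_functor (\<Gamma> \<times> \<Delta>) (born_tensor \<Gamma> \<F> \<Delta> \<G>) :: ('k, 'u, 'g \<times> 'd \<Rightarrow> 'u) vfunctor"
  have XY: "fobj ?XY V = Day V" "fmap ?XY V W f = Day_map V W f" for V W f
    by (simp_all add: functor_tensor_def)
  note small = small_Times[OF small_\<Gamma> small_\<Delta>]
  have natural: "comparison W (fmap ?XY V W f z) = fmap ?B V W f (comparison V z)"
    if V: "vect elts K V" and W: "vect elts K W" and f: "f \<in> lin K V W"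
      and "z \<in> carrier (fobj ?XY V)" for z f and V W :: "('k, 'u) module"
  proof -
    have z: "z \<in> carrier (Day V)" using that(4) by (simp only: XY)
    show ?thesis
      using comparison_natural[OF V W f z] lin_closed[OF comparison_lin[OF V] z]
      by (simp add: XY del: born_space_simps(1))
  qed
  have mod: "module K (fobj ?XY V)"
    and lin: "comparison V \<in> lin K (fobj ?XY V) (fobj ?B V)"
    and bij: "bij_betw (comparison V) (carrier (fobj ?XY V)) (carrier (fobj ?B V))"
    if "vect elts K V" for V :: "('k, 'u) module"
    using that by (simp_all only: XY born_functor_simps(1) day_space_module comparison_lin
        comparison_bij)
  have map_lin: "fmap ?XY V W f \<in> lin K (fobj ?XY V) (fobj ?XY W)"
    if "vect elts K V" "vect elts K W" "f \<in> lin K V W" for f and V W :: "('k, 'u) module"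
    using that by (simp only: XY day_map_lin)
  note B = linear_functor_born[OF bornology_target small]
  have "linear_functor elts K ?XY"
    by (rule linear_functor_transfer[OF B mod map_lin lin bij natural])
  moreover have "nat_iso elts K ?XY ?B comparison"
    by (rule nat_iso_transfer(1)[OF B mod map_lin lin bij natural])
  \<comment> \<open>This direction is the one needed for the presentation: the cocone of
    representables ends in \<open>?B\<close> and is prolonged to \<open>?XY\<close>.\<close>
  moreover have inv: "nat_iso elts K ?B ?XY (\<lambda>V. \<lambda>y\<in>carrier (fobj ?B V).
      inv_into (carrier (fobj ?XY V)) (comparison V) y)"
    by (rule nat_iso_transfer(2)[OF B mod map_lin lin bij natural])
  moreover obtain I r G c where G: "\<forall>i\<in>elts I. vect elts K (G i :: ('k, 'u) module)"
    and union: "directed_union elts K (elts I) r (\<lambda>i. yoneda K (G i)) ?B c"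
    using directed_union_born[OF cring_K small_K bornology_target small] by blast
  ultimately show ?thesis
    unfolding ind_iso_def
    using ind_vect_op_directed_union[OF union G]
      ind_vect_op_directed_union[OF directed_union_iso[OF union _ inv] G] by blast
qed

end

text \<open>Canonicity is expressed by the formula on generators: as these generate every value of
  the tensor product, it determines the linear components of \<open>\<phi>\<close>.\<close>

theorem lemma6p4:
  fixes elts :: "'u \<Rightarrow> 'u set"
    and K :: "'k ring"
    and \<Gamma> :: "'g set" and \<F> :: "'g set set"
    and \<Delta> :: "'d set" and \<G> :: "'d set set"
  assumes "grothendieck_universe elts"
    and "field K" and "small elts (carrier K)"
    and "small elts \<Gamma>" and "small elts \<Delta>"
    and "bornology \<Gamma> \<F>" and "bornology \<Delta> \<G>"
  shows "\<exists>\<phi>. ind_iso elts K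
             (functor_tensor elts K (born_functor \<Gamma> \<F>) (born_functor \<Delta> \<G>))
             (born_functor (\<Gamma> \<times> \<Delta>) (born_tensor \<Gamma> \<F> \<Delta> \<G>)) \<phi> \<and>
           (\<forall>V H\<^sub>0 H\<^sub>1 s t h. vect elts K V \<longrightarrow> vect elts K H\<^sub>0 \<longrightarrow> vect elts K H\<^sub>1 \<longrightarrow>
              s \<in> carrier (born_space \<Gamma> \<F> H\<^sub>0) \<longrightarrow>
              t \<in> carrier (born_space \<Delta> \<G> H\<^sub>1) \<longrightarrow>
              h \<in> lin K (tensor K H\<^sub>0 H\<^sub>1) V \<longrightarrow>
              \<phi> V (day_gen elts K (born_functor \<Gamma> \<F>) (born_functor \<Delta> \<G>) V H\<^sub>0 H\<^sub>1 s t h) =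
              (\<lambda>(\<gamma>, \<delta>)\<in>\<Gamma> \<times> \<Delta>. h (pure K H\<^sub>0 H\<^sub>1 (s \<gamma>) (t \<delta>))))"
proof -
  have "cring K" using assms(2) by (simp add: field_def domain_def)
  then interpret born_tensor_space elts K \<Gamma> \<F> \<Delta> \<G>
    using assms by (intro born_tensor_space.intro born_tensor_space_axioms.intro)
  show ?thesis
    using comparison_iso comparison_gen[unfolded outer_def] by blast
qed

end
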